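(* Let $M$ be a Calabi-Yau manifold of complex dimension $n$ with holomorphic volume form $\varphi$ and Kähler form $\omega$. Let $L_0\subset M$ be a compact special Lagrangian submanifold and let $f$ be a holomorphic function on a neighbourhood $U$ of $L_0$. On the moduli-space of special Lagrangian submanifolds through $L_0$ contained in $U$ (connected component of $L_0$), consider the function $\xi(L)=\int_L f$. Then $\xi$ is constant.
   Context: $\omega$ is an arbitrary Kähler form on $M$, and $\varphi$ is a nowhere vanishing holomorphic $(n,0)$-form. An $n$-dimensional submanifold $L\subset M$ is special Lagrangian if $\omega|_L=0$ and $\mathrm{Im}\,\varphi|_L=0$; it is oriented so that $\mathrm{Re}\,\varphi|_L>0$. The integral $\int_L f$ is taken with respect to the volume element $\mathrm{Re}\,\varphi|_L=\varphi|_L$, which is the Riemannian volume element of $L$ for the metric conformal to that of $\omega$ in which $\varphi$ has length $\sqrt2^{\,n}$ (the Kähler metric itself, if it is a Calabi-Yau metric normalized in this way). The moduli-space consists of special Lagrangian embeddings of the manifold $L_0$ modulo diffeomorphisms of $L_0$. *)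

theory Defs
  imports "HOL-Analysis.Analysis"
begin

section \<open>Smooth and holomorphic maps between coordinate spaces\<close>

text \<open>
  \<open>iter_deriv [v\<^sub>1, \<dots>, v\<^sub>k] f\<close> is the iterated directional derivative
  \<open>\<partial>\<^sub>v\<^sub>1 \<dots> \<partial>\<^sub>v\<^sub>k f\<close>.  All of these being differentiable on an open set
  is the same as being of class \<open>C\<^sup>\<infinity>\<close> there.
\<close>

fun iter_deriv ::
  "'a::real_normed_vector list \<Rightarrow> ('a \<Rightarrow> 'b::real_normed_vector) \<Rightarrow> 'a \<Rightarrow> 'b" where
  "iter_deriv [] f = f"
| "iter_deriv (v # vs) f = (\<lambda>x. frechet_derivative (iter_deriv vs f) (at x) v)"

definition smooth_on ::
  "'a::real_normed_vector set \<Rightarrow> ('a \<Rightarrow> 'b::real_normed_vector) \<Rightarrow> bool" where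
  "smooth_on S f \<longleftrightarrow> (\<forall>vs. \<forall>x\<in>S. iter_deriv vs f differentiable (at x))"

definition cholomorphic_on :: "(complex^'n) set \<Rightarrow> (complex^'n \<Rightarrow> complex) \<Rightarrow> bool" where
  "cholomorphic_on S h \<longleftrightarrow>
     (\<forall>z\<in>S. \<exists>D. (h has_derivative D) (at z) \<and> Vector_Spaces.linear (*s) (*) D)"


section \<open>Complex manifolds\<close>

text \<open>
  The manifold is a whole Hausdorff, second countable type \<open>'m\<close>.  A chart is a pair of its
  domain and its coordinate map; values of the map outside the domain are irrelevant.
\<close>

type_synonym ('m, 'n) chart = "'m set \<times> ('m \<Rightarrow> complex^'n)"

definition chart_inv :: "('m, 'n) chart \<Rightarrow> complex^'n \<Rightarrow> 'm" where
  "chart_inv C = inv_into (fst C) (snd C)"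

definition complex_atlas ::
  "('m::{t2_space,second_countable_topology}, 'n::finite) chart set \<Rightarrow> bool" where
  "complex_atlas A \<longleftrightarrow>
     (\<forall>(D, c)\<in>A. open D \<and> open (c ` D) \<and> (\<exists>g. homeomorphism D (c ` D) c g)) \<and>
     (\<Union>(D, c)\<in>A. D) = UNIV \<and>
     (\<forall>C\<in>A. \<forall>C'\<in>A. \<forall>i.
        cholomorphic_on (snd C ` (fst C \<inter> fst C')) (\<lambda>z. snd C' (chart_inv C z) $ i))"

definition holomorphic_fun_on ::
  "('m, 'n::finite) chart set \<Rightarrow> 'm set \<Rightarrow> ('m \<Rightarrow> complex) \<Rightarrow> bool" where
  "holomorphic_fun_on A U f \<longleftrightarrow>
     (\<forall>C\<in>A. cholomorphic_on (snd C ` (fst C \<inter> U)) (f \<circ> chart_inv C))"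


section \<open>Differential forms\<close>

text \<open>
  A tangent vector at \<open>p\<close> is given by its coordinate vector in a chart around \<open>p\<close>.  Accordingly
  a form assigns to every chart and every point of its domain a multilinear form on the
  coordinate vectors, these being related by the differentials of the coordinate changes.
\<close>

definition transition_diff :: "('m, 'n::finite) chart \<Rightarrow> ('m, 'n) chart \<Rightarrow> 'm \<Rightarrow> complex^'n \<Rightarrow> complex^'n" where
  "transition_diff C C' p = frechet_derivative (snd C' \<circ> chart_inv C) (at (snd C p))"

text \<open>
  The conditions on each chart are: bilinear, alternating (a 2-form), smooth coefficients,
  of type \<open>(1,1)\<close>, positive on complex lines, and closed.  Closedness is \<open>d\<omega>(u,v,w) = 0\<close>,
  evaluated on the commuting coordinate vector fields with constant coefficients \<open>u\<close>, \<open>v\<close>, \<open>w\<close>.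
\<close>

definition kaehler_form ::
  "('m, 'n::finite) chart set \<Rightarrow>
   (('m, 'n) chart \<Rightarrow> 'm \<Rightarrow> complex^'n \<Rightarrow> complex^'n \<Rightarrow> real) \<Rightarrow> bool" where
  "kaehler_form A \<omega> \<longleftrightarrow>
     (\<forall>C\<in>A. \<forall>C'\<in>A. \<forall>p\<in>fst C \<inter> fst C'. \<forall>u v.
        \<omega> C' p (transition_diff C C' p u) (transition_diff C C' p v) = \<omega> C p u v) \<and>
     (\<forall>C\<in>A. \<forall>p\<in>fst C.
        bilinear (\<omega> C p) \<and>
        (\<forall>u. \<omega> C p u u = 0) \<and>
        (\<forall>u v. \<omega> C p (\<i> *s u) (\<i> *s v) = \<omega> C p u v) \<and>
        (\<forall>u. u \<noteq> 0 \<longrightarrow> \<omega> C p u (\<i> *s u) > 0)) \<and>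
     (\<forall>C\<in>A. \<forall>u v. smooth_on (snd C ` fst C) (\<lambda>z. \<omega> C (chart_inv C z) u v)) \<and>
     (\<forall>C\<in>A. \<forall>z\<in>snd C ` fst C. \<forall>u v w.
        frechet_derivative (\<lambda>z. \<omega> C (chart_inv C z) v w) (at z) u
      + frechet_derivative (\<lambda>z. \<omega> C (chart_inv C z) w u) (at z) v
      + frechet_derivative (\<lambda>z. \<omega> C (chart_inv C z) u v) (at z) w = 0)"

text \<open>
  The arguments of an \<open>(n,0)\<close>-form are a family of \<open>n\<close> vectors indexed by \<open>'n\<close>;
  type \<open>(n,0)\<close> means complex multilinear and alternating.
\<close>

definition holomorphic_volume_form ::
  "('m, 'n::finite) chart set \<Rightarrow>
   (('m, 'n) chart \<Rightarrow> 'm \<Rightarrow> ('n \<Rightarrow> complex^'n) \<Rightarrow> complex) \<Rightarrow> bool" where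
  "holomorphic_volume_form A \<phi> \<longleftrightarrow>
     (\<forall>C\<in>A. \<forall>C'\<in>A. \<forall>p\<in>fst C \<inter> fst C'. \<forall>v.
        \<phi> C' p (\<lambda>i. transition_diff C C' p (v i)) = \<phi> C p v) \<and>
     (\<forall>C\<in>A. \<forall>p\<in>fst C.
        (\<forall>v i. Vector_Spaces.linear (*s) (*) (\<lambda>u. \<phi> C p (v(i := u)))) \<and>
        (\<forall>v i j. i \<noteq> j \<and> v i = v j \<longrightarrow> \<phi> C p v = 0) \<and>
        (\<exists>v. \<phi> C p v \<noteq> 0)) \<and>
     (\<forall>C\<in>A. \<forall>v. cholomorphic_on (snd C ` fst C) (\<lambda>z. \<phi> C (chart_inv C z) v))"


section \<open>Submanifolds of real dimension n\<close>

definition smooth_map ::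
  "('m::topological_space, 'n::finite) chart set \<Rightarrow> (real^'n) set \<Rightarrow> (real^'n \<Rightarrow> 'm) \<Rightarrow> bool" where
  "smooth_map A V \<tau> \<longleftrightarrow>
     continuous_on V \<tau> \<and> (\<forall>(D, c)\<in>A. smooth_on (V \<inter> \<tau> -` D) (c \<circ> \<tau>))"

text \<open>
  An arbitrarily chosen chart around \<open>p\<close>, used to express differentials in coordinates.  The notions
  built on it below do not depend on this choice.
\<close>

definition chart_at :: "('m, 'n) chart set \<Rightarrow> 'm \<Rightarrow> ('m, 'n) chart" where
  "chart_at A p = (SOME C. C \<in> A \<and> p \<in> fst C)"

definition coord_diff ::
  "('m, 'n::finite) chart set \<Rightarrow> (real^'n \<Rightarrow> 'm) \<Rightarrow> real^'n \<Rightarrow> real^'n \<Rightarrow> complex^'n" where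
  "coord_diff A \<tau> x = frechet_derivative (snd (chart_at A (\<tau> x)) \<circ> \<tau>) (at x)"

definition smooth_immersion ::
  "('m::topological_space, 'n::finite) chart set \<Rightarrow> (real^'n) set \<Rightarrow> (real^'n \<Rightarrow> 'm) \<Rightarrow> bool" where
  "smooth_immersion A V \<tau> \<longleftrightarrow> smooth_map A V \<tau> \<and> (\<forall>x\<in>V. inj (coord_diff A \<tau> x))"

definition local_param ::
  "('m::topological_space, 'n::finite) chart set \<Rightarrow> 'm set \<Rightarrow> (real^'n) set \<Rightarrow>
   (real^'n \<Rightarrow> 'm) \<Rightarrow> bool" where
  "local_param A L V \<sigma> \<longleftrightarrow>
     open V \<and> smooth_immersion A V \<sigma> \<and>
     openin (top_of_set L) (\<sigma> ` V) \<and> (\<exists>g. homeomorphism V (\<sigma> ` V) \<sigma> g)"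

definition submanifold :: "('m::topological_space, 'n::finite) chart set \<Rightarrow> 'm set \<Rightarrow> bool" where
  "submanifold A L \<longleftrightarrow> (\<forall>p\<in>L. \<exists>V \<sigma>. local_param A L V \<sigma> \<and> p \<in> \<sigma> ` V)"

definition pullback2 ::
  "('m, 'n::finite) chart set \<Rightarrow> (('m, 'n) chart \<Rightarrow> 'm \<Rightarrow> complex^'n \<Rightarrow> complex^'n \<Rightarrow> real) \<Rightarrow>
   (real^'n \<Rightarrow> 'm) \<Rightarrow> real^'n \<Rightarrow> real^'n \<Rightarrow> real^'n \<Rightarrow> real" where
  "pullback2 A \<omega> \<tau> x u v =
     \<omega> (chart_at A (\<tau> x)) (\<tau> x) (coord_diff A \<tau> x u) (coord_diff A \<tau> x v)"

definition pullback_n ::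
  "('m, 'n::finite) chart set \<Rightarrow> (('m, 'n) chart \<Rightarrow> 'm \<Rightarrow> ('n \<Rightarrow> complex^'n) \<Rightarrow> complex) \<Rightarrow>
   (real^'n \<Rightarrow> 'm) \<Rightarrow> real^'n \<Rightarrow> ('n \<Rightarrow> real^'n) \<Rightarrow> complex" where
  "pullback_n A \<phi> \<tau> x v = \<phi> (chart_at A (\<tau> x)) (\<tau> x) (\<lambda>i. coord_diff A \<tau> x (v i))"

definition special_lagrangian ::
  "('m::topological_space, 'n::finite) chart set \<Rightarrow>
   (('m, 'n) chart \<Rightarrow> 'm \<Rightarrow> complex^'n \<Rightarrow> complex^'n \<Rightarrow> real) \<Rightarrow>
   (('m, 'n) chart \<Rightarrow> 'm \<Rightarrow> ('n \<Rightarrow> complex^'n) \<Rightarrow> complex) \<Rightarrow> 'm set \<Rightarrow> bool" where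
  "special_lagrangian A \<omega> \<phi> L \<longleftrightarrow>
     submanifold A L \<and>
     (\<forall>V \<sigma>. local_param A L V \<sigma> \<longrightarrow>
        (\<forall>x\<in>V. (\<forall>u v. pullback2 A \<omega> \<sigma> x u v = 0) \<and> (\<forall>v. Im (pullback_n A \<phi> \<sigma> x v) = 0)))"


section \<open>Volume element and integral on a special Lagrangian submanifold\<close>

text \<open>The coefficient of \<open>Re \<phi>|\<^sub>L\<close> with respect to \<open>dx\<^sub>1 \<and> \<dots> \<and> dx\<^sub>n\<close> in a local parametrization.\<close>

definition volume_density ::
  "('m, 'n::finite) chart set \<Rightarrow> (('m, 'n) chart \<Rightarrow> 'm \<Rightarrow> ('n \<Rightarrow> complex^'n) \<Rightarrow> complex) \<Rightarrow>
   (real^'n \<Rightarrow> 'm) \<Rightarrow> real^'n \<Rightarrow> real" where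
  "volume_density A \<phi> \<sigma> x = Re (pullback_n A \<phi> \<sigma> x (\<lambda>i. axis i 1))"

text \<open>
  The orientation of \<open>L\<close> is the one for which \<open>Re \<phi>|\<^sub>L > 0\<close>.
\<close>

definition oriented_param ::
  "('m::topological_space, 'n::finite) chart set \<Rightarrow>
   (('m, 'n) chart \<Rightarrow> 'm \<Rightarrow> ('n \<Rightarrow> complex^'n) \<Rightarrow> complex) \<Rightarrow> 'm set \<Rightarrow>
   (real^'n) set \<Rightarrow> (real^'n \<Rightarrow> 'm) \<Rightarrow> bool" where
  "oriented_param A \<phi> L V \<sigma> \<longleftrightarrow> local_param A L V \<sigma> \<and> (\<forall>x\<in>V. volume_density A \<phi> \<sigma> x > 0)"

text \<open>
  The volume element \<open>Re \<phi>|\<^sub>L\<close> as a measure on \<open>L\<close>: the unique Borel measure which in every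
  oriented parametrization is \<open>Re \<phi>(\<partial>\<^sub>1\<sigma>, \<dots>, \<partial>\<^sub>n\<sigma>) dx\<^sub>1 \<dots> dx\<^sub>n\<close>.
\<close>

definition slag_volume ::
  "('m::topological_space, 'n::finite) chart set \<Rightarrow>
   (('m, 'n) chart \<Rightarrow> 'm \<Rightarrow> ('n \<Rightarrow> complex^'n) \<Rightarrow> complex) \<Rightarrow> 'm set \<Rightarrow> 'm measure" where
  "slag_volume A \<phi> L =
     (THE \<mu>. sets \<mu> = sets (restrict_space borel L) \<and>
        (\<forall>V \<sigma>. oriented_param A \<phi> L V \<sigma> \<longrightarrow>
           (\<forall>B\<in>sets borel. B \<subseteq> V \<longrightarrow>
              emeasure \<mu> (\<sigma> ` B) = (\<integral>\<^sup>+x\<in>B. ennreal (volume_density A \<phi> \<sigma> x) \<partial>lborel))))"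

definition slag_integral ::
  "('m::topological_space, 'n::finite) chart set \<Rightarrow>
   (('m, 'n) chart \<Rightarrow> 'm \<Rightarrow> ('n \<Rightarrow> complex^'n) \<Rightarrow> complex) \<Rightarrow>
   ('m \<Rightarrow> complex) \<Rightarrow> 'm set \<Rightarrow> complex" where
  "slag_integral A \<phi> f L = (LINT p|slag_volume A \<phi> L. f p)"


section \<open>The moduli space\<close>

text \<open>
  Smoothness of maps defined on \<open>L\<close> is tested in its local parametrizations.  A smooth map from \<open>L\<close>
  to the embedded submanifold \<open>L\<close> is a smooth map into the ambient manifold with values in \<open>L\<close>.
\<close>

definition diffeomorphism_of ::
  "('m::topological_space, 'n::finite) chart set \<Rightarrow> 'm set \<Rightarrow> ('m \<Rightarrow> 'm) \<Rightarrow> bool" where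
  "diffeomorphism_of A L \<psi> \<longleftrightarrow>
     bij_betw \<psi> L L \<and>
     (\<forall>V \<sigma>. local_param A L V \<sigma> \<longrightarrow>
        smooth_map A V (\<psi> \<circ> \<sigma>) \<and> smooth_map A V (inv_into L \<psi> \<circ> \<sigma>))"

definition smooth_embedding ::
  "('m::topological_space, 'n::finite) chart set \<Rightarrow> 'm set \<Rightarrow> ('m \<Rightarrow> 'm) \<Rightarrow> bool" where
  "smooth_embedding A L F \<longleftrightarrow>
     (\<forall>V \<sigma>. local_param A L V \<sigma> \<longrightarrow> smooth_immersion A V (F \<circ> \<sigma>)) \<and>
     (\<exists>G. homeomorphism L (F ` L) F G)"

definition slag_embeddings ::
  "('m::topological_space, 'n::finite) chart set \<Rightarrow>
   (('m, 'n) chart \<Rightarrow> 'm \<Rightarrow> complex^'n \<Rightarrow> complex^'n \<Rightarrow> real) \<Rightarrow>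
   (('m, 'n) chart \<Rightarrow> 'm \<Rightarrow> ('n \<Rightarrow> complex^'n) \<Rightarrow> complex) \<Rightarrow>
   'm set \<Rightarrow> 'm set \<Rightarrow> ('m \<Rightarrow> 'm) set" where
  "slag_embeddings A \<omega> \<phi> L0 U =
     {F \<in> extensional L0. smooth_embedding A L0 F \<and> F ` L0 \<subseteq> U \<and> special_lagrangian A \<omega> \<phi> (F ` L0)}"

text \<open>
  The \<open>C\<^sup>\<infinity>\<close> topology: a subbasic neighbourhood of \<open>F\<close> consists of the embeddings whose coordinate
  expressions and their partial derivatives of order at most \<open>k\<close> are uniformly \<open>\<epsilon>\<close>-close to
  those of \<open>F\<close> on a compact subset \<open>K\<close> of a parameter domain.
\<close>

definition smooth_nbhd ::
  "('m, 'n::finite) chart \<Rightarrow> (real^'n \<Rightarrow> 'm) \<Rightarrow> (real^'n) set \<Rightarrow> nat \<Rightarrow> real \<Rightarrow>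
   ('m \<Rightarrow> 'm) \<Rightarrow> ('m \<Rightarrow> 'm) set" where
  "smooth_nbhd C \<sigma> K k \<epsilon> F =
     {G. G ` \<sigma> ` K \<subseteq> fst C \<and>
         (\<forall>x\<in>K. \<forall>vs. set vs \<subseteq> Basis \<and> length vs \<le> k \<longrightarrow>
            norm (iter_deriv vs (snd C \<circ> G \<circ> \<sigma>) x - iter_deriv vs (snd C \<circ> F \<circ> \<sigma>) x) < \<epsilon>)}"

definition embedding_topology ::
  "('m::topological_space, 'n::finite) chart set \<Rightarrow>
   (('m, 'n) chart \<Rightarrow> 'm \<Rightarrow> complex^'n \<Rightarrow> complex^'n \<Rightarrow> real) \<Rightarrow>
   (('m, 'n) chart \<Rightarrow> 'm \<Rightarrow> ('n \<Rightarrow> complex^'n) \<Rightarrow> complex) \<Rightarrow>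
   'm set \<Rightarrow> 'm set \<Rightarrow> ('m \<Rightarrow> 'm) topology" where
  "embedding_topology A \<omega> \<phi> L0 U =
     topology_generated_by
       {slag_embeddings A \<omega> \<phi> L0 U \<inter> smooth_nbhd C \<sigma> K k \<epsilon> F | C V \<sigma> K k \<epsilon> F.
          C \<in> A \<and> local_param A L0 V \<sigma> \<and> compact K \<and> K \<subseteq> V \<and> \<epsilon> > 0 \<and>
          F \<in> slag_embeddings A \<omega> \<phi> L0 U \<and> F ` \<sigma> ` K \<subseteq> fst C}"

definition reparam_rel ::
  "('m::topological_space, 'n::finite) chart set \<Rightarrow>
   (('m, 'n) chart \<Rightarrow> 'm \<Rightarrow> complex^'n \<Rightarrow> complex^'n \<Rightarrow> real) \<Rightarrow>
   (('m, 'n) chart \<Rightarrow> 'm \<Rightarrow> ('n \<Rightarrow> complex^'n) \<Rightarrow> complex) \<Rightarrow>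
   'm set \<Rightarrow> 'm set \<Rightarrow> (('m \<Rightarrow> 'm) \<times> ('m \<Rightarrow> 'm)) set" where
  "reparam_rel A \<omega> \<phi> L0 U =
     {(F, G). F \<in> slag_embeddings A \<omega> \<phi> L0 U \<and> G \<in> slag_embeddings A \<omega> \<phi> L0 U \<and>
        (\<exists>\<psi>. diffeomorphism_of A L0 \<psi> \<and> (\<forall>p\<in>L0. G p = F (\<psi> p)))}"

text \<open>
  Points are the equivalence classes \<open>E // r\<close> of embeddings, with the quotient topology; the
  preimage of a set \<open>W\<close> of classes under the projection is \<open>\<Union>W\<close>.
\<close>

definition moduli_space ::
  "('m::topological_space, 'n::finite) chart set \<Rightarrow>
   (('m, 'n) chart \<Rightarrow> 'm \<Rightarrow> complex^'n \<Rightarrow> complex^'n \<Rightarrow> real) \<Rightarrow>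
   (('m, 'n) chart \<Rightarrow> 'm \<Rightarrow> ('n \<Rightarrow> complex^'n) \<Rightarrow> complex) \<Rightarrow>
   'm set \<Rightarrow> 'm set \<Rightarrow> ('m \<Rightarrow> 'm) set topology" where
  "moduli_space A \<omega> \<phi> L0 U =
     topology (\<lambda>W. W \<subseteq> slag_embeddings A \<omega> \<phi> L0 U // reparam_rel A \<omega> \<phi> L0 U \<and>
                   openin (embedding_topology A \<omega> \<phi> L0 U) (\<Union>W))"

definition base_point ::
  "('m::topological_space, 'n::finite) chart set \<Rightarrow>
   (('m, 'n) chart \<Rightarrow> 'm \<Rightarrow> complex^'n \<Rightarrow> complex^'n \<Rightarrow> real) \<Rightarrow>
   (('m, 'n) chart \<Rightarrow> 'm \<Rightarrow> ('n \<Rightarrow> complex^'n) \<Rightarrow> complex) \<Rightarrow>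
   'm set \<Rightarrow> 'm set \<Rightarrow> ('m \<Rightarrow> 'm) set" where
  "base_point A \<omega> \<phi> L0 U = reparam_rel A \<omega> \<phi> L0 U `` {restrict id L0}"

text \<open>All members of a class have the same image, which is therefore equal to this union.\<close>

definition submanifold_of_class :: "'m set \<Rightarrow> ('m \<Rightarrow> 'm) set \<Rightarrow> 'm set" where
  "submanifold_of_class L0 X = (\<Union>F\<in>X. F ` L0)"

end

theory Submission
  imports Defs "HOL-Complex_Analysis.Cauchy_Integral_Formula"
begin

text \<open>
  On a special Lagrangian \<open>L\<close> the form \<open>\<phi>\<close> restricts to the volume element, so \<open>\<xi>(L)\<close> is the
  integral over \<open>L\<close> of the holomorphic \<open>n\<close>-form \<open>f \<phi>\<close>, which is closed.  An embedding
  \<open>G\<close> that is \<open>C\<^sup>\<infinity>\<close>-close to \<open>F\<close> is joined to \<open>F\<close> by finitely many modifications, each of them a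
  convex combination inside one coordinate ball.  One such modification does not change the
  integral: in coordinates \<open>f \<phi> = h dz\<^sub>1 \<dots> dz\<^sub>n\<close>, and replacing \<open>z\<^sub>k\<close> by a primitive of \<open>h\<close> in the
  variable \<open>z\<^sub>k\<close> reduces the claim to the fact that the integral of \<open>det Du\<close> vanishes for compactly
  supported \<open>u\<close>.  The latter holds because \<open>id + t u\<close> permutes a large ball for small \<open>t\<close>, so that the
  integral of \<open>det (I + t Du)\<close>, a polynomial in \<open>t\<close>, is constant.  Hence \<open>\<xi>\<close> is locally constant.
\<close>

section \<open>Maps of class C^k\<close>

text \<open>The maps that join \<open>F\<close> to a nearby embedding are in general neither
  embeddings nor special Lagrangian, so no volume measure of their images is at hand. The integral
  is therefore extended to a functional \<open>J\<close> on all C^1 maps from the image of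
  \<open>F\<close> into \<open>U\<close>: the pullback of phi is written as a complex density times
  the volume measure of that fixed submanifold. Only for the two end maps is \<open>J\<close>
  compared with \<open>slag_integral\<close>. Closedness of the form enters only inside one
  coordinate ball, as the vanishing of the integral of a compactly supported Jacobian. Cutoffs are
  needed only up to first derivatives, whence the parallel notion \<open>C1_map\<close>. As
  \<open>slag_volume\<close> is a definite description, existence and uniqueness of the measure must
  be settled before any integral can be evaluated. The Kaehler form enters through a single fact: a
  Lagrangian tangent space is totally real, so phi does not vanish on it and oriented
  parametrizations exist.\<close>

primrec Ck_on :: "nat \<Rightarrow> 'a::real_normed_vector set \<Rightarrow> ('a \<Rightarrow> 'b::real_normed_vector) \<Rightarrow> bool" where
  "Ck_on 0 S f = continuous_on S f"
| "Ck_on (Suc k) S f = ((\<forall>x\<in>S. f differentiable (at x)) \<and>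
     (\<forall>v. Ck_on k S (\<lambda>x. frechet_derivative f (at x) v)))"

lemma frechet_derivative_cong_open:
  assumes "open S" "x \<in> S" "\<And>y. y \<in> S \<Longrightarrow> f y = g y"
  shows "frechet_derivative f (at x) = frechet_derivative g (at x)"
proof -
  have "(f has_derivative D) (at x) \<longleftrightarrow> (g has_derivative D) (at x)" for D
    using assms has_derivative_transform_within_open[of f D x UNIV S g]
      has_derivative_transform_within_open[of g D x UNIV S f] by auto
  then show ?thesis unfolding frechet_derivative_def by simp
qed

lemma differentiable_cong_open:
  assumes "open S" "x \<in> S" "\<And>y. y \<in> S \<Longrightarrow> f y = g y" "f differentiable (at x)"
  shows "g differentiable (at x)"
  using assms has_derivative_transform_within_open[of f _ x UNIV S g]
  unfolding differentiable_def by blast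

lemma Ck_on_cong:
  assumes "open S" "\<And>x. x \<in> S \<Longrightarrow> f x = g x" "Ck_on k S f"
  shows "Ck_on k S g"
  using assms
proof (induction k arbitrary: f g)
  case 0 then show ?case using continuous_on_cong[of S S f g] by auto
next
  case (Suc k)
  have "Ck_on k S (\<lambda>x. frechet_derivative g (at x) v)" for v
  proof (rule Suc.IH[OF Suc.prems(1)])
    show "frechet_derivative f (at x) v = frechet_derivative g (at x) v" if "x \<in> S" for x
      using frechet_derivative_cong_open[OF Suc.prems(1) that Suc.prems(2)] by simp
    show "Ck_on k S (\<lambda>x. frechet_derivative f (at x) v)" using Suc.prems(3) by simp
  qed
  moreover have "\<forall>x\<in>S. g differentiable (at x)"
    using Suc.prems(3) differentiable_cong_open[OF Suc.prems(1) _ Suc.prems(2)] by fastforce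
  ultimately show ?case by simp
qed

lemma Ck_on_subset: "Ck_on k S f \<Longrightarrow> T \<subseteq> S \<Longrightarrow> Ck_on k T f"
  by (induction k arbitrary: f) (auto intro: continuous_on_subset)

lemma Ck_on_Suc_D: "Ck_on (Suc k) S f \<Longrightarrow> Ck_on k S f"
proof (induction k arbitrary: f)
  case 0 then show ?case
    by (auto intro!: differentiable_imp_continuous_on differentiable_at_imp_differentiable_on)
next
  case (Suc k) then show ?case by auto
qed

lemma Ck_on_mono: "Ck_on k S f \<Longrightarrow> j \<le> k \<Longrightarrow> Ck_on j S f"
  by (induction k) (use Ck_on_Suc_D le_Suc_eq in \<open>auto simp del: Ck_on.simps(2)\<close>)

lemma Ck_on_imp_continuous_on: "Ck_on k S f \<Longrightarrow> continuous_on S f"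
  using Ck_on_mono[of k S f 0] by simp

lemma Ck_on_SucI:
  assumes "open S" "\<And>x. x \<in> S \<Longrightarrow> (f has_derivative f' x) (at x)"
    "\<And>v. Ck_on k S (\<lambda>x. f' x v)"
  shows "Ck_on (Suc k) S f"
proof -
  have "frechet_derivative f (at x) = f' x" if "x \<in> S" for x
    using frechet_derivative_at[OF assms(2)[OF that]] by simp
  then have "Ck_on k S (\<lambda>x. frechet_derivative f (at x) v)" for v
    by (intro Ck_on_cong[OF assms(1) _ assms(3)[of v]]) auto
  then show ?thesis using assms(2) by (auto simp: differentiable_def)
qed

lemma Ck_on_has_derivative:
  "Ck_on (Suc k) S f \<Longrightarrow> x \<in> S \<Longrightarrow> (f has_derivative frechet_derivative f (at x)) (at x)"
  by (simp add: frechet_derivative_works)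

lemma Ck_on_differentiable: "Ck_on k S f \<Longrightarrow> 0 < k \<Longrightarrow> x \<in> S \<Longrightarrow> f differentiable (at x)"
  by (cases k) auto

lemma Ck_on_local:
  assumes "\<And>x. x \<in> S \<Longrightarrow> \<exists>T. open T \<and> x \<in> T \<and> Ck_on k T f"
  shows "Ck_on k S f"
  using assms
proof (induction k arbitrary: f)
  case 0
  have "continuous (at x) f" if "x \<in> S" for x
    using 0[OF that] by (auto simp: continuous_on_eq_continuous_at)
  then show ?case by (auto intro: continuous_at_imp_continuous_on)
next
  case (Suc k)
  have "Ck_on k S (\<lambda>x. frechet_derivative f (at x) v)" for v
    using Suc.prems by (intro Suc.IH) fastforce
  then show ?case using Suc.prems by fastforce
qed

lemma Ck_on_const [intro, simp]: "Ck_on k S (\<lambda>x. c)"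
  by (induction k arbitrary: c) (auto simp: frechet_derivative_const)

lemma Ck_on_linear_compose:
  assumes "bounded_linear h" "open S" "Ck_on k S f"
  shows "Ck_on k S (\<lambda>x. h (f x))"
  using assms(3)
proof (induction k arbitrary: f)
  case 0 then show ?case
    using assms(1) by (auto intro: bounded_linear.continuous_on)
next
  case (Suc k)
  show ?case
  proof (rule Ck_on_SucI[OF assms(2)])
    show "((\<lambda>x. h (f x)) has_derivative (\<lambda>v. h (frechet_derivative f (at x) v))) (at x)" if "x \<in> S" for x
      using bounded_linear.has_derivative[OF assms(1) Ck_on_has_derivative[OF Suc.prems that]] .
    show "Ck_on k S (\<lambda>x. h (frechet_derivative f (at x) v))" for v
      using Suc by auto
  qed
qed

lemma Ck_on_linear: assumes "bounded_linear h" "open S" shows "Ck_on k S h"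
proof (cases k)
  case 0 then show ?thesis using assms(1)
    by (simp add: linear_continuous_on)
next
  case (Suc j)
  then show ?thesis
    using Ck_on_SucI[OF assms(2), of h "\<lambda>_. h" j] bounded_linear_imp_has_derivative[OF assms(1)]
    by (auto simp del: Ck_on.simps)
qed

lemma Ck_on_id: "open S \<Longrightarrow> Ck_on k S (\<lambda>x. x)"
  by (rule Ck_on_linear) (auto intro: bounded_linear_ident)

lemma Ck_on_add:
  assumes "open S" "Ck_on k S f" "Ck_on k S g"
  shows "Ck_on k S (\<lambda>x. f x + g x)"
  using assms(2,3)
proof (induction k arbitrary: f g)
  case 0 then show ?case by (auto intro: continuous_intros)
next
  case (Suc k)
  show ?case
  proof (rule Ck_on_SucI[OF assms(1)])
    show "((\<lambda>x. f x + g x) has_derivative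
      (\<lambda>v. frechet_derivative f (at x) v + frechet_derivative g (at x) v)) (at x)" if "x \<in> S" for x
      using Suc.prems that by (intro has_derivative_add Ck_on_has_derivative)
    show "Ck_on k S (\<lambda>x. frechet_derivative f (at x) v + frechet_derivative g (at x) v)" for v
      using Suc by auto
  qed
qed

lemma Ck_on_sum:
  assumes "open S" "\<And>i. i \<in> I \<Longrightarrow> Ck_on k S (f i)"
  shows "Ck_on k S (\<lambda>x. \<Sum>i\<in>I. f i x)"
  using assms(2) by (induction I rule: infinite_finite_induct) (auto intro: Ck_on_add[OF assms(1)])

lemma Ck_on_bilinear:
  assumes B: "bounded_bilinear B" and "open S" "Ck_on k S f" "Ck_on k S g"
  shows "Ck_on k S (\<lambda>x. B (f x) (g x))"
  using assms(3,4)
proof (induction k arbitrary: f g)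
  case 0 then show ?case using B by (auto intro: bounded_bilinear.continuous_on)
next
  case (Suc k)
  have fg: "Ck_on k S f" "Ck_on k S g" using Suc.prems Ck_on_Suc_D by blast+
  show ?case
  proof (rule Ck_on_SucI[OF assms(2)])
    show "((\<lambda>x. B (f x) (g x)) has_derivative
      (\<lambda>v. B (f x) (frechet_derivative g (at x) v) + B (frechet_derivative f (at x) v) (g x))) (at x)"
      if "x \<in> S" for x
      using Suc.prems that by (intro bounded_bilinear.FDERIV[OF B] Ck_on_has_derivative)
    show "Ck_on k S (\<lambda>x. B (f x) (frechet_derivative g (at x) v) + B (frechet_derivative f (at x) v) (g x))" for v
      using Suc fg by (auto intro!: Ck_on_add[OF assms(2)])
  qed
qed

lemmas Ck_on_mult = Ck_on_bilinear[OF bounded_bilinear_mult]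
lemmas Ck_on_scaleR = Ck_on_bilinear[OF bounded_bilinear_scaleR]

lemma Ck_on_diff:
  assumes "open S" "Ck_on k S f" "Ck_on k S g"
  shows "Ck_on k S (\<lambda>x. f x - g x)"
  using Ck_on_add[OF assms(1,2) Ck_on_linear_compose[OF bounded_linear_minus[OF bounded_linear_ident] assms(1,3)]] by simp

lemma Ck_on_prod:
  fixes f :: "'i \<Rightarrow> 'a::real_normed_vector \<Rightarrow> 'b::{real_normed_algebra,comm_ring_1}"
  assumes "open S" "\<And>i. i \<in> I \<Longrightarrow> Ck_on k S (f i)"
  shows "Ck_on k S (\<lambda>x. \<Prod>i\<in>I. f i x)"
  using assms(2) by (induction I rule: infinite_finite_induct) (auto intro: Ck_on_mult[OF assms(1)])

lemma Ck_on_det: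
  fixes M :: "'a::real_normed_vector \<Rightarrow> 'b::{real_normed_algebra,comm_ring_1}^'n^'n"
  assumes "open S" "\<And>i j. Ck_on k S (\<lambda>x. M x $ i $ j)"
  shows "Ck_on k S (\<lambda>x. det (M x))"
  unfolding det_def
  by (intro Ck_on_sum Ck_on_mult Ck_on_prod assms Ck_on_const)

lemma bounded_linear_axis: "bounded_linear (axis i :: 'b::real_normed_vector \<Rightarrow> 'b^'n)"
proof (rule bounded_linear_intro[of _ 1])
  show "norm (axis i x :: 'b^'n) \<le> norm x * 1" for x
    by (simp add: norm_vec_def L2_set_def axis_def if_distrib[of norm] if_distrib[of "\<lambda>y. y\<^sup>2"] cong: if_cong)
qed (auto simp: axis_def vec_eq_iff)

lemma Ck_on_vec:
  fixes f :: "'a::real_normed_vector \<Rightarrow> 'b::real_normed_vector^'n"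
  assumes "open S" "\<And>i. Ck_on k S (\<lambda>x. f x $ i)"
  shows "Ck_on k S f"
proof -
  have "(\<Sum>i\<in>UNIV. axis i (v $ i)) = v" for v :: "'b^'n"
    by (simp add: vec_eq_iff axis_def if_distrib sum.delta cong: if_cong)
  then have eq: "f = (\<lambda>x. \<Sum>i\<in>UNIV. axis i (f x $ i))" by simp
  show ?thesis
    by (subst eq, intro Ck_on_sum Ck_on_linear_compose[OF bounded_linear_axis] assms)
qed

lemma Ck_on_nth:
  fixes f :: "'a::real_normed_vector \<Rightarrow> 'b::real_normed_vector^'n"
  assumes "open S" "Ck_on k S f"
  shows "Ck_on k S (\<lambda>x. f x $ i)"
  by (rule Ck_on_linear_compose[OF bounded_linear_vec_nth assms])

lemma Ck_on_compose:
  fixes g :: "'a::real_normed_vector \<Rightarrow> 'b::euclidean_space" and f :: "'b \<Rightarrow> 'c::real_normed_vector"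
  assumes "open S" "open T" "Ck_on k S g" "Ck_on k T f" "g ` S \<subseteq> T"
  shows "Ck_on k S (\<lambda>x. f (g x))"
  using assms(3,4)
proof (induction k arbitrary: f)
  case 0 then show ?case using assms(5) by (auto intro: continuous_on_compose2)
next
  case (Suc k)
  have g: "Ck_on k S g" using Suc.prems Ck_on_Suc_D by blast
  show ?case
  proof (rule Ck_on_SucI[OF assms(1)])
    fix x assume x: "x \<in> S"
    let ?g = "frechet_derivative g (at x)" and ?f = "frechet_derivative f (at (g x))"
    have "((\<lambda>x. f (g x)) has_derivative (\<lambda>v. ?f (?g v))) (at x)"
      using Suc.prems x assms(5)
      by (intro has_derivative_compose[of g _ x UNIV f]) (auto intro!: Ck_on_has_derivative simp del: Ck_on.simps)
    \<comment> \<open>The direction \<open>?g v\<close> varies with \<open>x\<close>, whereas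
      \<open>Ck_on\<close> controls derivatives in fixed directions only. Expansion in
      \<open>Basis\<close> moves the dependence on \<open>x\<close> into scalar factors.\<close>
    moreover have "?f (?g v) = (\<Sum>b\<in>Basis. (?g v \<bullet> b) *\<^sub>R ?f b)" for v
    proof -
      have "linear ?f" using Suc.prems x assms(5)
        by (intro has_derivative_linear[OF Ck_on_has_derivative]) auto
      then show ?thesis
        by (subst (1) euclidean_representation[of "?g v", symmetric], simp only: linear_sum linear_scale)
    qed
    ultimately show "((\<lambda>x. f (g x)) has_derivative (\<lambda>v. \<Sum>b\<in>Basis. (?g v \<bullet> b) *\<^sub>R ?f b)) (at x)" by simp
  next
    fix v
    have "Ck_on k S (\<lambda>x. frechet_derivative f (at (g x)) b)" for b
      using Suc.IH[of "\<lambda>y. frechet_derivative f (at y) b", OF g] Suc.prems(2) by auto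
    moreover have "Ck_on k S (\<lambda>x. frechet_derivative g (at x) v \<bullet> b)" for b
      using Suc.prems by (intro Ck_on_linear_compose[OF bounded_linear_inner_left assms(1)]) auto
    ultimately show "Ck_on k S (\<lambda>x. \<Sum>b\<in>Basis. (frechet_derivative g (at x) v \<bullet> b) *\<^sub>R frechet_derivative f (at (g x)) b)"
      by (intro Ck_on_sum Ck_on_scaleR assms)
  qed
qed

text \<open>The derivative of the reciprocal is built from the reciprocal itself, needed at one
  order less, so the induction closes.\<close>

lemma Ck_on_inverse:
  fixes f :: "'a::real_normed_vector \<Rightarrow> real"
  assumes "open S" "Ck_on k S f" "\<And>x. x \<in> S \<Longrightarrow> f x \<noteq> 0"
  shows "Ck_on k S (\<lambda>x. inverse (f x))"
  using assms(2)
proof (induction k)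
  case 0 then show ?case using assms(3) by (auto intro: continuous_on_inverse)
next
  case (Suc k)
  have f: "Ck_on k S f" using Suc.prems Ck_on_Suc_D by blast
  show ?case
  proof (rule Ck_on_SucI[OF assms(1)])
    show "((\<lambda>x. inverse (f x)) has_derivative
      (\<lambda>v. - (inverse (f x) * frechet_derivative f (at x) v * inverse (f x)))) (at x)" if "x \<in> S" for x
      using Suc.prems that assms(3) by (intro Deriv.has_derivative_inverse Ck_on_has_derivative) auto
    have "Ck_on k S (\<lambda>x. 0 - (inverse (f x) * frechet_derivative f (at x) v * inverse (f x)))" for v
      using Suc f by (intro Ck_on_mult Ck_on_diff assms Ck_on_const) auto
    then show "Ck_on k S (\<lambda>x. - (inverse (f x) * frechet_derivative f (at x) v * inverse (f x)))" for v
      by simp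
  qed
qed

section \<open>Iterated derivatives and finite orders of differentiability\<close>

lemma iter_deriv_append:
  "iter_deriv vs (iter_deriv ws f) = iter_deriv (vs @ ws) f"
  by (induction vs) auto

text \<open>\<open>Ck_on\<close> strips the innermost derivative, while \<open>iter_deriv\<close>
  adds the outermost one. The forward direction therefore appends a new direction at the end of the
  list. The backward direction keeps the claim for all \<open>k\<close> at once, so that each
  derivative can be paid for with one order.\<close>

lemma smooth_on_iff_Ck_on: "smooth_on S f \<longleftrightarrow> (\<forall>k. Ck_on k S f)"
proof
  show "\<forall>k. Ck_on k S f" if "smooth_on S f"
  proof
    fix k show "Ck_on k S f" using that
    proof (induction k arbitrary: f)
      case 0
      then have "\<forall>x\<in>S. iter_deriv [] f differentiable (at x)" unfolding smooth_on_def by blast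
      then show ?case
        by (auto intro!: differentiable_imp_continuous_on differentiable_at_imp_differentiable_on)
    next
      case (Suc k)
      have "smooth_on S (\<lambda>x. frechet_derivative f (at x) v)" for v
      proof -
        have "iter_deriv vs (\<lambda>x. frechet_derivative f (at x) v) = iter_deriv (vs @ [v]) f" for vs
          using iter_deriv_append[of vs "[v]" f] by simp
        then show ?thesis using Suc.prems unfolding smooth_on_def by simp
      qed
      moreover have "\<forall>x\<in>S. iter_deriv [] f differentiable (at x)"
        using Suc.prems unfolding smooth_on_def by blast
      ultimately show ?case using Suc.IH by simp
    qed
  qed
  show "smooth_on S f" if k: "\<forall>k. Ck_on k S f"
  proof -
    have "\<forall>k. Ck_on k S (iter_deriv vs f)" for vs
    proof (induction vs)
      case Nil then show ?case using k by simp
    next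
      case (Cons v vs)
      then have "Ck_on (Suc k) S (iter_deriv vs f)" for k by blast
      then show ?case by simp
    qed
    then show ?thesis unfolding smooth_on_def
      using Ck_on_differentiable[OF spec[of _ 1]] by fastforce
  qed
qed

section \<open>Left inverses of immersions\<close>

text \<open>The map \<open>g\<close> is only known to be continuous. With a left inverse
  \<open>l\<close> of \<open>u'\<close>, the map \<open>l (u z)\<close> agrees with the identity to
  first order at \<open>g x\<close>, so increments of \<open>g\<close> differ from those of the
  differentiable map \<open>l (u (g y))\<close> by a small multiple of themselves, which can be
  absorbed.\<close>

lemma has_derivative_left_factor:
  fixes g :: "'a::real_normed_vector \<Rightarrow> 'b::euclidean_space" and u :: "'b \<Rightarrow> 'c::euclidean_space"
  assumes u: "(u has_derivative u') (at (g x))" and "inj u'"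
    and g: "continuous (at x) g" and w: "((\<lambda>y. u (g y)) has_derivative w') (at x)"
  obtains g' where "(g has_derivative g') (at x)" "\<And>v. u' (g' v) = w' v"
proof -
  have lu: "linear u'" using u has_derivative_linear by blast
  obtain l where l: "linear l" "l \<circ> u' = id"
    using linear_injective_left_inverse[OF lu \<open>inj u'\<close>] by blast
  have bl: "bounded_linear l" using l(1) linear_conv_bounded_linear by blast
  define d where "d = (\<lambda>v. l (w' v))"
  have lu1: "((\<lambda>y. l (u y)) has_derivative (\<lambda>v. v)) (at (g x))"
    using bounded_linear.has_derivative[OF bl u] l(2) by (simp add: fun_eq_iff)
  have lw: "((\<lambda>y. l (u (g y))) has_derivative d) (at x)"
    using bounded_linear.has_derivative[OF bl w] by (simp add: d_def)
  have bd: "bounded_linear d" using lw has_derivative_bounded_linear by blast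
  obtain B where B: "\<And>v. norm (d v) \<le> norm v * B" "B > 0" 
    using bounded_linear.pos_bounded[OF bd] by (auto simp: mult.commute)
  have "(g has_derivative d) (at x)"
    unfolding has_derivative_at_alt
  proof (intro conjI allI impI bd)
    fix e :: real assume e: "0 < e"
    \<comment> \<open>The bound 1/2 lets \<open>e1 * norm ?k\<close> be absorbed, which gives
      \<open>norm ?k \<le> norm ?h * (2 * B + 1)\<close>. The total error is then at most
      \<open>e1 * (2 * B + 2) * norm ?h\<close>, and 2 B + 3 leaves room.\<close>
    define e1 where "e1 = min (1/2) (e / (2 * B + 3))"
    have "e1 \<le> e / (2 * B + 3)" by (simp add: e1_def)
    moreover have "e1 \<le> 1/2" unfolding e1_def by (rule min.cobounded1)
    moreover have "0 < e1" using e B(2) by (simp add: e1_def)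
    moreover have "e1 * (2 * B + 3) \<le> e"
      using \<open>e1 \<le> e / (2 * B + 3)\<close> B(2) by (simp add: pos_le_divide_eq)
    ultimately have e1: "0 < e1" "e1 \<le> 1/2" "e1 * (2 * B + 3) \<le> e" by auto
    obtain r where r: "r > 0" "\<And>z. norm (z - g x) < r \<Longrightarrow> norm (l (u z) - l (u (g x)) - (z - g x)) \<le> e1 * norm (z - g x)"
      using lu1 e1(1) unfolding has_derivative_at_alt by blast
    obtain s where s: "s > 0" "\<And>y. norm (y - x) < s \<Longrightarrow> norm (l (u (g y)) - l (u (g x)) - d (y - x)) \<le> e1 * norm (y - x)"
      using lw e1(1) unfolding has_derivative_at_alt by blast
    obtain t where t: "t > 0" "\<And>y. norm (y - x) < t \<Longrightarrow> norm (g y - g x) < r"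
      using g r(1) unfolding continuous_at dist_norm LIM_def by (metis diff_self norm_zero zero_less_norm_iff)
    show "\<exists>q>0. \<forall>y. norm (y - x) < q \<longrightarrow> norm (g y - g x - d (y - x)) \<le> e * norm (y - x)"
    proof (intro exI[of _ "min s t"] conjI allI impI)
      fix y assume y: "norm (y - x) < min s t"
      let ?k = "g y - g x" and ?h = "y - x"
      let ?a = "l (u (g y)) - l (u (g x))"
      have 1: "norm (?a - ?k) \<le> e1 * norm ?k" using r(2) t(2) y by auto
      have 2: "norm (?a - d ?h) \<le> e1 * norm ?h" using s(2) y by auto
      have "?k - d ?h = (?a - d ?h) - (?a - ?k)" by simp
      then have "norm (?k - d ?h) = norm ((?a - d ?h) - (?a - ?k))" by (rule arg_cong)
      then have 3: "norm (?k - d ?h) \<le> e1 * norm ?h + e1 * norm ?k"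
        using 1 2 norm_triangle_ineq4[of "?a - d ?h" "?a - ?k"] by linarith
      have "norm ?k \<le> norm (?k - d ?h) + norm (d ?h)"
        using norm_triangle_ineq[of "?k - d ?h" "d ?h"] by simp
      also have "\<dots> \<le> (1/2) * norm ?h + (1/2) * norm ?k + norm ?h * B"
        using 3 B(1)[of ?h] mult_right_mono[OF e1(2) norm_ge_zero[of ?h]] mult_right_mono[OF e1(2) norm_ge_zero[of ?k]] by linarith
      finally have k: "norm ?k \<le> norm ?h * (2 * B + 1)" by (simp add: algebra_simps)
      have "norm (?k - d ?h) \<le> e1 * norm ?h + e1 * (norm ?h * (2 * B + 1))"
        using 3 mult_left_mono[OF k, of e1] e1(1) by linarith
      also have "\<dots> \<le> e1 * (2 * B + 3) * norm ?h" using e1(1) B(2) by (simp add: algebra_simps)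
      also have "\<dots> \<le> e * norm ?h" using e1(3) by (rule mult_right_mono) simp
      finally show "norm (?k - d ?h) \<le> e * norm ?h" .
    qed (use s(1) t(1) in auto)
  qed
  moreover have "u' (d v) = w' v" for v
    using has_derivative_unique[OF has_derivative_compose[OF calculation u] w] by metis
  ultimately show thesis using that by blast
qed

text \<open>A bootstrap: Cramer's rule expresses the derivative of \<open>g\<close> through
  \<open>g\<close> itself and the derivative of \<open>u (g x)\<close>, where \<open>u\<close> is
  \<open>s\<close> followed by a linear left inverse of its derivative at \<open>g x0\<close>.
  Regularity C^k of \<open>g\<close> thus yields C^(k+1). The target of \<open>s\<close> may have
  larger dimension, as for a parametrization read in a complex chart.\<close>

lemma Ck_on_left_factor:
  fixes s :: "real^'n \<Rightarrow> 'c::euclidean_space" and g :: "'a::real_normed_vector \<Rightarrow> real^'n"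
  assumes V: "open V" and W: "open W" and s: "\<And>k. Ck_on k V s" and g: "continuous_on W g" "g ` W \<subseteq> V"
    and x0: "x0 \<in> W" and inj: "inj (frechet_derivative s (at (g x0)))"
    and sg: "\<And>k. Ck_on k W (\<lambda>x. s (g x))"
  obtains N where "open N" "x0 \<in> N" "N \<subseteq> W" "\<And>k. Ck_on k N g"
proof -
  have gx0: "g x0 \<in> V" using x0 g(2) by auto
  have ds: "(s has_derivative frechet_derivative s (at (g x0))) (at (g x0))"
    using Ck_on_has_derivative[OF s[of "Suc 0"] gx0] .
  obtain l where l: "linear l" "l \<circ> frechet_derivative s (at (g x0)) = id"
    using linear_injective_left_inverse[OF has_derivative_linear[OF ds] inj] by blast
  have bl: "bounded_linear l" using l(1) linear_conv_bounded_linear by blast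
  define u where "u = (\<lambda>y. l (s y))"
  define D where "D = (\<lambda>y. matrix (frechet_derivative u (at y)))"
  have u: "Ck_on k V u" for k unfolding u_def by (rule Ck_on_linear_compose[OF bl V s])
  have Dij: "Ck_on k V (\<lambda>y. D y $ i $ j)" for k i j
    using u[of "Suc k"] unfolding D_def matrix_def by (auto intro!: Ck_on_nth V)
  have detD: "Ck_on k V (\<lambda>y. det (D y))" for k
    by (rule Ck_on_det[OF V Dij])
  have "(u has_derivative (\<lambda>v. v)) (at (g x0))"
    using bounded_linear.has_derivative[OF bl ds] l(2) by (simp add: fun_eq_iff u_def)
  then have "frechet_derivative u (at (g x0)) = id" using frechet_derivative_at[of u "\<lambda>v. v" "g x0"] by (simp add: id_def)
  then have det1: "det (D (g x0)) = 1" unfolding D_def by (simp add: matrix_id det_I)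
  \<comment> \<open>Near \<open>x0\<close> the derivative of \<open>u\<close> along \<open>g\<close>
    stays invertible, by continuity of the determinant.\<close>
  define N where "N = {x \<in> W. det (D (g x)) \<noteq> 0}"
  have contdet: "continuous_on W (\<lambda>x. det (D (g x)))"
    using detD[of 0] g by (auto intro: continuous_on_compose2)
  have N: "open N" "x0 \<in> N" "N \<subseteq> W"
    using continuous_open_preimage[OF contdet W, of "-{0}"] x0 det1
    by (auto simp: N_def vimage_def Int_def)
  have ug: "Ck_on k N (\<lambda>x. u (g x))" for k
    unfolding u_def using Ck_on_subset[OF sg N(3)] by (intro Ck_on_linear_compose[OF bl N(1)])
  let ?w = "\<lambda>x. frechet_derivative (\<lambda>x. u (g x)) (at x)"
  \<comment> \<open>Cramer's formula for the derivative of \<open>g\<close> in direction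
    \<open>v\<close>, written with products and a reciprocal so that the C^k rules apply.\<close>
  define G where "G = (\<lambda>x v. \<chi> k. det (\<chi> i j. if j = k then ?w x v $ i else D (g x) $ i $ j) * inverse (det (D (g x))))"
  have dg: "(g has_derivative G x) (at x)" if x: "x \<in> N" for x
  proof -
    have gx: "g x \<in> V" using x N(3) g(2) by auto
    have du: "(u has_derivative frechet_derivative u (at (g x))) (at (g x))"
      using Ck_on_has_derivative[OF u[of "Suc 0"] gx] .
    have mu: "D (g x) *v v = frechet_derivative u (at (g x)) v" for v
      unfolding D_def using du by (simp add: matrix_works has_derivative_linear)
    have nz: "det (D (g x)) \<noteq> 0" using x by (simp add: N_def)
    have "inj ((*v) (D (g x)))"
      using nz by (metis inj_matrix_vector_mult invertible_det_nz)
    then have "inj (frechet_derivative u (at (g x)))" by (simp add: mu[abs_def] fun_eq_iff)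
    moreover have "continuous (at x) g"
      using g(1) W x N(3) by (auto simp: continuous_on_eq_continuous_at)
    moreover have "((\<lambda>x. u (g x)) has_derivative ?w x) (at x)"
      using Ck_on_has_derivative[OF ug[of "Suc 0"] x] .
    ultimately obtain g' where g': "(g has_derivative g') (at x)" "\<And>v. frechet_derivative u (at (g x)) (g' v) = ?w x v"
      using has_derivative_left_factor[of u "frechet_derivative u (at (g x))" g x "?w x"] du by metis
    have "g' v = G x v" for v
    proof -
      have "D (g x) *v g' v = ?w x v" using g'(2) mu by simp
      then show ?thesis unfolding G_def using cramer[OF nz] by (simp add: divide_inverse)
    qed
    then show ?thesis using g'(1) by presburger
  qed
  have "Ck_on k N g" for k
  proof (induction k)
    case 0 then show ?case using g(1) N(3) continuous_on_subset by auto
  next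
    case (Suc k)
    show ?case
    proof (rule Ck_on_SucI[OF N(1) dg])
      fix v
      have w: "Ck_on k N (\<lambda>x. ?w x v)" using ug[of "Suc k"] by simp
      have gN: "g ` N \<subseteq> V" using N(3) g(2) by auto
      have 1: "Ck_on k N (\<lambda>x. D (g x) $ i $ j)" for i j
        by (rule Ck_on_compose[OF N(1) V Suc.IH Dij gN])
      have 2: "Ck_on k N (\<lambda>x. det (\<chi> i j. if j = m then ?w x v $ i else D (g x) $ i $ j))" for m
      proof (rule Ck_on_det[OF N(1)])
        fix i j show "Ck_on k N (\<lambda>x. (\<chi> i j. if j = m then ?w x v $ i else D (g x) $ i $ j) $ i $ j)"
          using 1 Ck_on_nth[OF N(1) w] by (cases "j = m") auto
      qed
      have 3: "Ck_on k N (\<lambda>x. det (D (g x)))"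
        by (rule Ck_on_compose[OF N(1) V Suc.IH detD gN])
      show "Ck_on k N (\<lambda>x. G x v)"
        unfolding G_def
      proof (rule Ck_on_vec[OF N(1)], simp, rule Ck_on_mult[OF N(1) 2])
        show "Ck_on k N (\<lambda>x. inverse (det (D (g x))))"
          by (rule Ck_on_inverse[OF N(1) 3]) (auto simp: N_def)
      qed
    qed
  qed
  then show thesis using that[OF N] by blast
qed

section \<open>Determinants and change of variables\<close>

text \<open>The difference \<open>e\<close> of the two sides is multilinear and alternating and
  vanishes on the standard basis, which forces it to be zero.\<close>

lemma multilinear_alternating_eq_det:
  fixes g :: "('n::finite \<Rightarrow> 'a::field^'n) \<Rightarrow> 'a"
  assumes add: "\<And>v i x y. g (v(i := x + y)) = g (v(i := x)) + g (v(i := y))"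
    and scale: "\<And>v i c x. g (v(i := c *s x)) = c * g (v(i := x))"
    and alt: "\<And>v i j. i \<noteq> j \<Longrightarrow> v i = v j \<Longrightarrow> g v = 0"
  shows "g v = g (\<lambda>i. axis i 1) * det (\<chi> i. v i)"
proof -
  define e where "e = (\<lambda>v. g v - g (\<lambda>i. axis i 1) * det (\<chi> i. v i :: 'a^'n^'n))"
  have rows: "(\<chi> i. (v(k := x)) i) = (\<chi> i. if i = k then x else v i)" for v :: "'n \<Rightarrow> 'a^'n" and k x
    by (simp add: vec_eq_iff)
  have eadd: "e (v(i := x + y)) = e (v(i := x)) + e (v(i := y))" for v i x y
    unfolding e_def rows add det_row_add[of i "\<lambda>_. x" "\<lambda>_. y" v] by (simp add: algebra_simps)
  have escale: "e (v(i := c *s x)) = c * e (v(i := x))" for v i c x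
    unfolding e_def rows scale det_row_mul[of i c "\<lambda>_. x" v] by (simp add: algebra_simps)
  have ealt: "e v = 0" if "i \<noteq> j" "v i = v j" for v i j
  proof -
    have "det (\<chi> i. v i :: 'a^'n^'n) = 0"
      using that by (intro det_identical_rows[of i j]) (auto simp: row_def vec_eq_iff)
    then show ?thesis using alt[OF that] by (simp add: e_def)
  qed
  have e1: "e (\<lambda>i. axis i 1) = 0"
  proof -
    have "(\<chi> i. axis i 1 :: 'a^'n^'n) = mat 1"
      by (simp add: mat_def axis_def vec_eq_iff)
    then show ?thesis by (simp add: e_def det_I)
  qed
  \<comment> \<open>Polarization: the form vanishes when both arguments are
    \<open>v a + v b\<close>, and the two mixed terms that survive the expansion are
    opposite.\<close>
  have esw: "e (v \<circ> Transposition.transpose a b) = - e v" if "a \<noteq> b" for v a b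
  proof -
    let ?w = "\<lambda>x y. v(a := x, b := y)"
    have s: "e (?w (x + x') y) = e (?w x y) + e (?w x' y)" for x x' y
      using eadd[of "v(b := y)" a x x'] that by (simp add: fun_upd_twist)
    have t: "e (?w x (y + y')) = e (?w x y) + e (?w x y')" for x y y'
      using eadd[of "v(a := x)" b y y'] by simp
    have z: "e (?w x x) = 0" for x by (rule ealt[OF that]) (use that in simp)
    have "0 = e (?w (v a + v b) (v a + v b))" by (rule z[symmetric])
    also have "\<dots> = e (?w (v a) (v b)) + e (?w (v b) (v a))"
      unfolding s t by (simp only: z add_0_left add_0_right add.commute)
    also have "?w (v a) (v b) = v" by (simp add: fun_eq_iff)
    also have "?w (v b) (v a) = v \<circ> Transposition.transpose a b"
      by (simp add: fun_eq_iff Transposition.transpose_def)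
    finally show ?thesis by (simp add: eq_neg_iff_add_eq_0 add.commute o_def)
  qed
  have perm: "e (v \<circ> p) = of_int (sign p) * e v" if "p permutes (UNIV::'n set)" for p v
    using that finite_class.finite_UNIV
  proof (induction p arbitrary: v rule: permutes_induct)
    case id then show ?case by (simp add: sign_id)
  next
    case (swap a b p)
    have "e (v \<circ> (Transposition.transpose a b \<circ> p)) = e ((v \<circ> Transposition.transpose a b) \<circ> p)"
      by (simp add: comp_assoc)
    also have "\<dots> = - (of_int (sign p) * e v)"
      unfolding swap.IH esw[OF \<open>a \<noteq> b\<close>] by simp
    also have "\<dots> = of_int (sign (Transposition.transpose a b \<circ> p)) * e v"
    proof -
      have "permutation p" using swap.hyps permutation_permutes finite by blast
      then show ?thesis
        using swap.hyps by (simp add: sign_compose[OF permutation_swap_id] sign_swap_id)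
    qed
    finally show ?case .
  qed
  \<comment> \<open>Induction on the set \<open>T\<close> of rows not yet known to be basis vectors.
    Once it is empty, the rows are a permutation of the basis or contain a repetition.\<close>
  have "e v = 0" if "\<forall>i\<in>-T. \<exists>j. v i = axis j 1" for T v
    using finite[of T] that
  proof (induction T arbitrary: v rule: finite_induct)
    case empty
    then obtain p where p: "\<And>i. v i = axis (p i) 1" by (metis Compl_empty_eq UNIV_I)
    show ?case
    proof (cases "inj p")
      case True
      then have "bij p" using finite_UNIV_inj_surj[of p] by (simp add: bij_def)
      then have "p permutes UNIV" by (intro bij_imp_permutes) auto
      from perm[OF this, of "\<lambda>i. axis i 1"] have "e ((\<lambda>i. axis i 1) \<circ> p) = 0" by (simp only: e1 mult_zero_right)
      moreover have "v = (\<lambda>i. axis i 1) \<circ> p" using p by auto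
      ultimately show ?thesis by (simp only:)
    next
      case False
      then obtain i j where "i \<noteq> j" "p i = p j" by (auto simp: inj_def)
      then show ?thesis by (intro ealt[of i j]) (auto simp: p)
    qed
  next
    case (insert k T)
    have lin: "e (v(k := (\<Sum>j\<in>J. c j *s axis j 1))) = (\<Sum>j\<in>J. c j * e (v(k := axis j 1)))" for J and c :: "'n \<Rightarrow> 'a"
      using finite[of J]
    proof (induction J rule: finite_induct)
      case empty
      show ?case using escale[of v k 0 0] by (simp only: sum.empty vector_smult_lzero mult_zero_left)
    next
      case (insert j J)
      show ?case unfolding sum.insert[OF insert.hyps] eadd escale insert.IH ..
    qed
    have "v k = (\<Sum>j\<in>UNIV. v k $ j *s axis j 1)"
      by (simp add: vec_eq_iff axis_def if_distrib sum.delta cong: if_cong)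
    then have "e v = e (v(k := (\<Sum>j\<in>UNIV. v k $ j *s axis j 1)))" by simp
    also have "\<dots> = 0"
      unfolding lin using insert.prems by (intro sum.neutral ballI) (auto intro!: insert.IH)
    finally show ?case .
  qed
  from this[of UNIV] have "e v = 0" by simp
  then show ?thesis by (simp add: e_def)
qed

text \<open>As a function of the rows of \<open>A\<close> the left side is multilinear, alternating
  and normalized, hence the determinant. The two index types differ, as is needed to pass to a
  well-ordered copy.\<close>

lemma det_reindex:
  fixes A :: "'a::field^'n^'n" and e :: "'m::finite \<Rightarrow> 'n::finite"
  assumes "bij e"
  shows "det (\<chi> i j. A $ e i $ e j) = det A"
proof -
  define h where "h = inv e"
  have h: "e (h i) = i" "h (e k) = k" for i k using assms by (auto simp: h_def bij_def surj_f_inv_f)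
  let ?g = "\<lambda>v::'n \<Rightarrow> 'a^'n. det (\<chi> i j. v (e i) $ e j)"
  have rows: "(\<chi> i j. (v(k := x)) (e i) $ e j) = (\<chi> i. if i = h k then (\<chi> j. x $ e j) else (\<chi> j. v (e i) $ e j))"
    for v :: "'n \<Rightarrow> 'a^'n" and k x using h by (auto simp: vec_eq_iff)
  have "?g (\<lambda>i. A $ i) = ?g (\<lambda>i. axis i 1) * det (\<chi> i. A $ i)"
  proof (rule multilinear_alternating_eq_det)
    fix v :: "'n \<Rightarrow> 'a^'n" and i and x y :: "'a^'n"
    have eq: "(\<chi> j. (x + y) $ e j) = (\<chi> j. x $ e j) + (\<chi> j. y $ e j)" by (simp add: vec_eq_iff)
    show "?g (v(i := x + y)) = ?g (v(i := x)) + ?g (v(i := y))"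
      unfolding rows eq by (rule det_row_add)
  next
    fix v :: "'n \<Rightarrow> 'a^'n" and i c and x :: "'a^'n"
    have eq: "(\<chi> j. (c *s x) $ e j) = c *s (\<chi> j. x $ e j)" by (simp add: vec_eq_iff)
    show "?g (v(i := c *s x)) = c * ?g (v(i := x))"
      unfolding rows eq by (rule det_row_mul)
  next
    fix v :: "'n \<Rightarrow> 'a^'n" and i j assume "i \<noteq> j" "v i = v j"
    then show "?g v = 0"
      using h by (intro det_identical_rows[of "h i" "h j"]) (auto simp: row_def vec_eq_iff, metis)
  qed
  moreover have "(\<chi> i j. axis (e i) (1::'a) $ e j) = (mat 1 :: 'a^'m^'m)"
    using assms by (auto simp: mat_def axis_def vec_eq_iff bij_def inj_eq)
  ultimately show ?thesis by (simp add: det_I)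
qed

text \<open>
  The change of variables theorem of the library is stated for index types with a well-order.
  It is transported to arbitrary finite index types through the following well-ordered copy.
\<close>

typedef (overloaded) ('n::finite) idx = "{..<CARD('n)}"
  by (rule exI[of _ 0]) simp

instance idx :: (finite) finite
proof
  have "(UNIV::'a idx set) = Abs_idx ` {..<CARD('a)}"
    using type_definition.Abs_image[OF type_definition_idx] by metis
  then show "finite (UNIV::'a idx set)" by (metis finite_imageI finite_lessThan)
qed

instantiation idx :: (finite) wellorder
begin
definition "x \<le> y \<longleftrightarrow> Rep_idx x \<le> Rep_idx y"
definition "x < y \<longleftrightarrow> Rep_idx x < Rep_idx y"
instance
proof
  fix P :: "'a idx \<Rightarrow> bool" and a
  assume "\<And>x. (\<And>y. y < x \<Longrightarrow> P y) \<Longrightarrow> P x"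
  then show "P a" unfolding less_idx_def by (induction a rule: measure_induct_rule[of Rep_idx]) blast
qed (auto simp: less_eq_idx_def less_idx_def Rep_idx_inject)
end

lemma bij_idx: obtains e :: "'n::finite idx \<Rightarrow> 'n" where "bij e"
proof -
  have "card (UNIV::'n idx set) = card (UNIV::'n set)"
    using type_definition.card[OF type_definition_idx] by (metis card_lessThan)
  then show thesis using that finite_same_card_bij[of "UNIV::'n idx set" "UNIV::'n set"] by auto
qed

lemma prod_Basis_cart: "(\<Prod>b\<in>Basis. f (b :: real^'n)) = (\<Prod>i\<in>UNIV. f (axis i 1))"
proof -
  have "(Basis::(real^'n) set) = (\<lambda>i. axis i 1) ` UNIV" by (auto simp: Basis_vec_def)
  moreover have "inj (\<lambda>i. axis i 1 :: real^'n)" by (simp add: inj_on_def axis_eq_axis)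
  ultimately show ?thesis using prod.reindex[of "\<lambda>i. axis i 1" UNIV f] by (simp only: o_def)
qed

text \<open>Renaming coordinates carries boxes to boxes with the same side lengths, and boxes
  determine Lebesgue measure.\<close>

lemma lborel_reindex:
  fixes e :: "'m::finite \<Rightarrow> 'n::finite"
  assumes "bij e"
  shows "distr lborel borel (\<lambda>x::real^'n. \<chi> i. x $ e i) = (lborel :: (real^'m) measure)"
proof (rule lborel_eqI[symmetric])
  fix l u :: "real^'m" assume lu: "\<And>b. b \<in> Basis \<Longrightarrow> l \<bullet> b \<le> u \<bullet> b"
  have m: "(\<lambda>x::real^'n. \<chi> i. x $ e i) \<in> borel_measurable borel"
    by (intro borel_measurable_continuous_onI continuous_intros)
  define h where "h = inv e"
  have h: "e (h i) = i" "h (e k) = k" for i k using assms by (auto simp: h_def bij_def surj_f_inv_f)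
  have lu': "l $ i \<le> u $ i" for i using lu[of "axis i 1"] by (simp add: inner_axis)
  have "(\<lambda>x::real^'n. \<chi> i. x $ e i) -` box l u = box (\<chi> i. l $ h i) (\<chi> i. u $ h i)"
    by (auto simp: mem_box_cart) (metis h)+
  then have "emeasure (distr lborel borel (\<lambda>x::real^'n. \<chi> i. x $ e i)) (box l u)
    = emeasure lborel (box (\<chi> i. l $ h i) (\<chi> i. u $ h i) :: (real^'n) set)"
    using m by (subst emeasure_distr) auto
  also have "\<dots> = (\<Prod>b\<in>Basis. ((\<chi> i. u $ h i) - (\<chi> i. l $ h i :: real^'n)) \<bullet> b)"
    using lu' by (intro emeasure_lborel_box) (auto simp: Basis_vec_def inner_axis)
  also have "(\<Prod>b\<in>Basis. ((\<chi> i. u $ h i) - (\<chi> i. l $ h i :: real^'n)) \<bullet> b) = (\<Prod>i\<in>UNIV. (u - l) $ h i)"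
    by (simp add: prod_Basis_cart inner_axis)
  also have "\<dots> = (\<Prod>i\<in>UNIV. (u - l) $ i)"
    by (rule prod.reindex_bij_witness[of _ e h]) (use h in auto)
  also have "\<dots> = (\<Prod>b\<in>Basis. (u - l) \<bullet> b)" by (simp add: prod_Basis_cart inner_axis)
  finally show "emeasure (distr lborel borel (\<lambda>x::real^'n. \<chi> i. x $ e i)) (box l u) = (\<Prod>b\<in>Basis. (u - l) \<bullet> b)" .
qed simp

text \<open>Turns finiteness of a nonnegative integral over \<open>lborel\<close> into integrability
  for its completion, in which the change of variables theorem is phrased.\<close>

lemma absolutely_integrable_on_nonneg:
  fixes h :: "'a::euclidean_space \<Rightarrow> real"
  assumes "(\<integral>\<^sup>+x\<in>T. ennreal (h x) \<partial>lborel) \<noteq> \<infinity>" "set_borel_measurable borel T h" "\<And>x. x \<in> T \<Longrightarrow> 0 \<le> h x"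
  shows "h absolutely_integrable_on T"
proof -
  have "(\<integral>\<^sup>+x. norm (indicator T x *\<^sub>R h x) \<partial>lborel) = (\<integral>\<^sup>+x\<in>T. ennreal (h x) \<partial>lborel)"
    using assms(3) by (intro nn_integral_cong) (auto split: split_indicator)
  then have "integrable lborel (\<lambda>x. indicator T x *\<^sub>R h x)"
    using assms(1,2) unfolding integrable_iff_bounded set_borel_measurable_def
    by (auto simp: less_top)
  then show ?thesis unfolding set_integrable_def
    by (simp add: integrable_completion borel_measurable_integrable)
qed

lemma nn_integral_change_of_variables_wellorder:
  fixes g :: "real^'m::{finite,wellorder} \<Rightarrow> real^'m::_" and f :: "real^'m::_ \<Rightarrow> real"
  assumes S: "S \<in> sets borel" and gS: "g ` S \<in> sets borel"
    and der: "\<And>x. x \<in> S \<Longrightarrow> (g has_derivative g' x) (at x within S)"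
    and inj: "inj_on g S"
    and f: "\<And>y. y \<in> g ` S \<Longrightarrow> 0 \<le> f y" "set_borel_measurable borel (g ` S) f"
    and m: "set_borel_measurable borel S (\<lambda>x. \<bar>det (matrix (g' x))\<bar> * f (g x))"
  shows "(\<integral>\<^sup>+y\<in>g ` S. f y \<partial>lborel) = (\<integral>\<^sup>+x\<in>S. \<bar>det (matrix (g' x))\<bar> * f (g x) \<partial>lborel)"
proof -
  let ?F = "\<lambda>x. \<bar>det (matrix (g' x))\<bar> * f (g x)"
  have S': "S \<in> sets lebesgue" using S by auto
  \<comment> \<open>Real functions enter the vector-valued change of variables theorem as vectors of
    length one.\<close>
  have *: "?F absolutely_integrable_on S \<and> integral S ?F = b \<longleftrightarrow>
      f absolutely_integrable_on (g ` S) \<and> integral (g ` S) f = b" for b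
    using has_absolute_integral_change_of_variables[OF S' der inj, of "\<lambda>x. vec (f x) :: real^1" "vec b"]
    by (simp add: absolutely_integrable_on_1_iff integral_on_1_eq)
  have fin: "(\<integral>\<^sup>+x\<in>S. ?F x \<partial>lborel) = (\<integral>\<^sup>+y\<in>g ` S. f y \<partial>lborel)" if "f absolutely_integrable_on (g ` S)"
  proof -
    let ?b = "integral (g ` S) f"
    have "(f has_integral ?b) (g ` S)" using that absolutely_integrable_on_def integrable_integral by blast
    moreover have "?F absolutely_integrable_on S \<and> integral S ?F = ?b" using that *[of ?b] by blast
    then have "(?F has_integral ?b) S" unfolding absolutely_integrable_on_def has_integral_iff by blast
    ultimately show ?thesis using f(1)
      by (subst (1 2) nn_integral_has_integral_lebesgue'[where I="?b"]) auto
  qed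
  show ?thesis
  proof (cases "f absolutely_integrable_on (g ` S)")
    case True then show ?thesis using fin by simp
  next
    case False
    then have "\<not> ?F absolutely_integrable_on S" using * by blast
    then have "(\<integral>\<^sup>+x\<in>S. ?F x \<partial>lborel) = \<infinity>"
      using absolutely_integrable_on_nonneg[OF _ m] f(1) by auto
    moreover have "(\<integral>\<^sup>+y\<in>g ` S. f y \<partial>lborel) = \<infinity>"
      using False absolutely_integrable_on_nonneg[OF _ f(2)] f(1) by auto
    ultimately show ?thesis by simp
  qed
qed

text \<open>Conjugation of \<open>g\<close> by the coordinate renaming \<open>T\<close>, which
  preserves Lebesgue measure and, by \<open>det_reindex\<close>, Jacobian determinants.\<close>

lemma nn_integral_change_of_variables:
  fixes g :: "real^'n::finite \<Rightarrow> real^'n" and f :: "real^'n \<Rightarrow> real"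
  assumes S: "S \<in> sets borel" and gS: "g ` S \<in> sets borel"
    and der: "\<And>x. x \<in> S \<Longrightarrow> (g has_derivative g' x) (at x within S)"
    and inj: "inj_on g S"
    and f: "\<And>y. y \<in> g ` S \<Longrightarrow> 0 \<le> f y" "set_borel_measurable borel (g ` S) f"
    and m: "set_borel_measurable borel S (\<lambda>x. \<bar>det (matrix (g' x))\<bar> * f (g x))"
  shows "(\<integral>\<^sup>+y\<in>g ` S. f y \<partial>lborel) = (\<integral>\<^sup>+x\<in>S. \<bar>det (matrix (g' x))\<bar> * f (g x) \<partial>lborel)"
proof -
  obtain e :: "'n idx \<Rightarrow> 'n" where e: "bij e" using bij_idx by blast
  define h where "h = inv e"
  have h: "e (h i) = i" "h (e k) = k" for i k using e by (auto simp: h_def bij_def surj_f_inv_f)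
  define T where "T = (\<lambda>x::real^'n. \<chi> i. x $ e i)"
  define R where "R = (\<lambda>y::real^'n idx. \<chi> i. y $ h i)"
  have TR: "T (R y) = y" "R (T x) = x" for x y using h by (simp_all add: T_def R_def vec_eq_iff)
  have linT: "bounded_linear T" "bounded_linear R"
    by (auto simp: T_def R_def linear_iff vec_eq_iff simp flip: linear_conv_bounded_linear)
  have mT: "T \<in> borel_measurable borel" "R \<in> borel_measurable borel"
    using linT by (auto intro!: borel_measurable_continuous_onI linear_continuous_on)
  have img: "T ` X = R -` X" for X using TR by (auto simp: image_iff) metis
  have lb: "(lborel :: (real^'n idx) measure) = distr lborel borel T"
    using lborel_reindex[OF e] by (simp add: T_def)
  have tr: "(\<integral>\<^sup>+y\<in>T ` X. ennreal (k (R y)) \<partial>lborel) = (\<integral>\<^sup>+x\<in>X. ennreal (k x) \<partial>lborel)"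
    if "set_borel_measurable borel X k" "X \<in> sets borel" "\<And>x. x \<in> X \<Longrightarrow> 0 \<le> k x" for X k
  proof -
    have eq: "ennreal (k (R y)) * indicator (T ` X) y = ennreal (indicator X (R y) *\<^sub>R k (R y))" for y
      unfolding img by (auto split: split_indicator)
    have "(\<lambda>y. ennreal (indicator X (R y) *\<^sub>R k (R y))) \<in> borel_measurable borel"
      using measurable_compose[OF mT(2), of "\<lambda>x. ennreal (indicator X x *\<^sub>R k x)" borel] that(1)
      by (auto simp: set_borel_measurable_def)
    then show ?thesis
      unfolding eq by (subst lb, subst nn_integral_distr)
        (use mT TR in \<open>auto intro!: nn_integral_cong split: split_indicator\<close>)
  qed
  define G where "G = (\<lambda>y. T (g (R y)))"
  define G' where "G' = (\<lambda>y v. T (g' (R y) (R v)))"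
  have GS: "G ` T ` S = T ` g ` S" using TR by (auto simp: G_def image_iff)
  have setb: "T ` X \<in> sets borel" if "X \<in> sets borel" for X
    unfolding img using mT(2) that measurable_sets_borel by blast
  have sm: "set_borel_measurable borel (T ` X) (\<lambda>y. k (R y))" if "set_borel_measurable borel X k" for X and k :: "_ \<Rightarrow> real"
  proof -
    have "(\<lambda>y. indicator (T ` X) y *\<^sub>R k (R y)) = (\<lambda>y. (\<lambda>x. indicator X x *\<^sub>R k x) (R y))"
      unfolding img by (auto split: split_indicator)
    then show ?thesis using measurable_compose[OF mT(2), of "\<lambda>x. indicator X x *\<^sub>R k x" borel] that
      unfolding set_borel_measurable_def by simp
  qed
  have detG: "det (matrix (G' y)) = det (matrix (g' (R y)))" for y
  proof -
    have hj: "h i = j \<longleftrightarrow> i = e j" for i j using h by metis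
    have R1: "R (axis j 1) = axis (e j) 1" for j
      unfolding vec_eq_iff R_def axis_def by (simp add: hj)
    then have "matrix (G' y) = (\<chi> i j. matrix (g' (R y)) $ e i $ e j)"
      by (simp add: matrix_def G'_def T_def R1)
    then show ?thesis using det_reindex[OF e] by metis
  qed
  have "(\<integral>\<^sup>+y\<in>g ` S. f y \<partial>lborel) = (\<integral>\<^sup>+y\<in>G ` T ` S. f (R y) \<partial>lborel)"
    unfolding GS by (rule tr[symmetric]) (use f gS in auto)
  also have "\<dots> = (\<integral>\<^sup>+y\<in>T ` S. \<bar>det (matrix (G' y))\<bar> * f (R (G y)) \<partial>lborel)"
  proof (rule nn_integral_change_of_variables_wellorder)
    show "(G has_derivative G' y) (at y within T ` S)" if "y \<in> T ` S" for y
    proof -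
      have y: "R y \<in> S" using that TR by auto
      have RT: "R ` T ` S = S" using TR by (auto simp: image_iff)
      have "((\<lambda>y. g (R y)) has_derivative (\<lambda>v. g' (R y) (R v))) (at y within T ` S)"
        using has_derivative_in_compose[of R R y "T ` S" g "g' (R y)"] der[OF y] RT
          bounded_linear_imp_has_derivative[OF linT(2)] by auto
      then show ?thesis unfolding G_def G'_def using bounded_linear.has_derivative[OF linT(1)] by blast
    qed
    show "inj_on G (T ` S)"
      using inj TR by (auto simp: inj_on_def G_def) metis
    show "set_borel_measurable borel (G ` T ` S) (\<lambda>y. f (R y))" unfolding GS by (rule sm) (rule f)
    have "set_borel_measurable borel (T ` S) (\<lambda>y. \<bar>det (matrix (g' (R y)))\<bar> * f (g (R y)))"
      by (rule sm[OF m])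
    then show "set_borel_measurable borel (T ` S) (\<lambda>x. \<bar>det (matrix (G' x))\<bar> * f (R (G x)))"
      by (simp add: detG G_def TR)
    show "T ` S \<in> sets borel" "G ` T ` S \<in> sets borel" using GS setb S gS by auto
    show "0 \<le> f (R y)" if "y \<in> G ` T ` S" for y using that GS TR f(1) by auto
  qed
  also have "\<dots> = (\<integral>\<^sup>+y\<in>T ` S. \<bar>det (matrix (g' (R y)))\<bar> * f (g (R y)) \<partial>lborel)"
    by (simp add: detG G_def TR)
  also have "\<dots> = (\<integral>\<^sup>+x\<in>S. \<bar>det (matrix (g' x))\<bar> * f (g x) \<partial>lborel)"
    by (rule tr[OF m S]) (use f(1) in auto)
  finally show ?thesis .
qed

section \<open>Integrals of Jacobian determinants\<close>

text \<open>Multilinear expansion by the set \<open>S\<close> of rows taken from \<open>B\<close>.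
  With c = t it exhibits det (I + t Du) as a polynomial in t; with c = \<i> it splits a complex
  Jacobian into real ones.\<close>

lemma det_add_scaled:
  fixes A B :: "'a::comm_ring_1^'n^'n"
  shows "det (\<chi> i j. A $ i $ j + c * B $ i $ j) =
    (\<Sum>S\<in>UNIV. c ^ card S * det (\<chi> i. if i \<in> S then B $ i else A $ i))"
proof -
  have split: "(\<Prod>i\<in>UNIV. A $ i $ p i + c * B $ i $ p i) =
      (\<Sum>S\<in>UNIV. c ^ card S * (\<Prod>i\<in>UNIV. (if i \<in> S then B $ i else A $ i) $ p i))" for p
  proof -
    have "(\<Prod>i\<in>UNIV. A $ i $ p i + c * B $ i $ p i) = (\<Prod>i\<in>UNIV. c * B $ i $ p i + A $ i $ p i)"
      by (simp add: add.commute)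
    also have "\<dots> = (\<Sum>S\<in>Pow UNIV. (\<Prod>i\<in>S. c * B $ i $ p i) * (\<Prod>i\<in>UNIV-S. A $ i $ p i))"
      by (rule prod_add) simp
    also have "\<dots> = (\<Sum>S\<in>UNIV. c ^ card S * (\<Prod>i\<in>UNIV. (if i \<in> S then B $ i else A $ i) $ p i))"
    proof (rule sum.cong)
      fix S :: "'n set"
      have "(\<Prod>i\<in>UNIV. (if i \<in> S then B $ i else A $ i) $ p i) = (\<Prod>i\<in>UNIV. if i \<in> S then B $ i $ p i else A $ i $ p i)"
        by (rule prod.cong) auto
      also have "\<dots> = (\<Prod>i\<in>S. B $ i $ p i) * (\<Prod>i\<in>UNIV-S. A $ i $ p i)"
        by (simp add: prod.If_cases Compl_eq_Diff_UNIV)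
      finally show "(\<Prod>i\<in>S. c * B $ i $ p i) * (\<Prod>i\<in>UNIV-S. A $ i $ p i)
        = c ^ card S * (\<Prod>i\<in>UNIV. (if i \<in> S then B $ i else A $ i) $ p i)"
        by (simp add: prod.distrib mult.assoc)
    qed auto
    finally show ?thesis .
  qed
  show ?thesis
    unfolding det_def vec_lambda_beta split
    by (simp add: sum_distrib_left sum.swap[of _ "{p. p permutes UNIV}"] mult_ac)
qed

lemma det_of_real: "det (\<chi> i j. of_real (A $ i $ j)) = (of_real (det A) :: 'a::{real_algebra_1,comm_ring_1})"
  by (simp add: det_def)

text \<open>For a complex target this is the coefficient of the pullback of dz_1 ... dz_n by
  \<open>u\<close> with respect to dx_1 ... dx_n.\<close>

definition jac :: "(real^'n::finite \<Rightarrow> 'a::real_normed_field^'n) \<Rightarrow> real^'n \<Rightarrow> 'a" where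
  "jac u x = det (\<chi> i j. frechet_derivative u (at x) (axis j 1) $ i)"

lemma jac_real: "jac u x = det (matrix (frechet_derivative u (at x)))" for u :: "real^'n \<Rightarrow> real^'n"
  by (simp add: jac_def matrix_def)

lemma jac_cong_open:
  assumes "open S" "x \<in> S" "\<And>y. y \<in> S \<Longrightarrow> f y = g y"
  shows "jac f x = jac g x"
proof -
  have "frechet_derivative f (at x) = frechet_derivative g (at x)"
    using assms by (rule frechet_derivative_cong_open)
  then show ?thesis by (simp only: jac_def)
qed

lemma continuous_on_jac:
  assumes "open S" "Ck_on 1 S u"
  shows "continuous_on S (jac u)"
proof -
  have "Ck_on 0 S (\<lambda>x. det (\<chi> i j. frechet_derivative u (at x) (axis j 1) $ i))"
    using assms by (intro Ck_on_det) (auto intro!: Ck_on_nth[where k=0, simplified])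
  then show ?thesis by (simp add: jac_def[abs_def])
qed

lemma jac_const_zero:
  fixes c :: "'a::real_normed_field^'n::finite"
  shows "jac (\<lambda>x. c) x = 0"
proof -
  \<comment> \<open>An index type is nonempty, so the zero matrix has a zero row.\<close>
  have "det ((\<chi> i j. 0) :: 'a^'n^'n) = 0"
    by (rule det_zero_row(1)[of undefined]) (simp add: row_def vec_eq_iff)
  then show ?thesis by (simp add: jac_def frechet_derivative_const)
qed

text \<open>The partial derivatives are bounded on \<open>K\<close> by compactness and vanish off
  \<open>K\<close>; the mean value inequality turns this bound into a Lipschitz constant.\<close>

lemma Lipschitz_compact_support:
  fixes u :: "real^'n \<Rightarrow> real^'n"
  assumes u: "Ck_on 1 UNIV u" and K: "compact K" "\<And>x. x \<notin> K \<Longrightarrow> u x = 0"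
  obtains M where "M > 0" "\<And>x v. norm (frechet_derivative u (at x) v) \<le> M * norm v"
    "\<And>x y. norm (u x - u y) \<le> M * norm (x - y)"
proof -
  let ?D = "\<lambda>x. frechet_derivative u (at x)"
  have du: "(u has_derivative ?D x) (at x)" for x
    using Ck_on_has_derivative[of 0 UNIV u] u by simp
  have "\<exists>b\<ge>0. \<forall>x. norm (?D x (axis i 1)) \<le> b" for i
  proof -
    have "continuous_on K (\<lambda>x. ?D x (axis i 1))"
      using u by (auto intro: continuous_on_subset)
    then have "bounded ((\<lambda>x. ?D x (axis i 1)) ` K)"
      using K(1) compact_continuous_image compact_imp_bounded by blast
    then obtain b where b: "\<And>x. x \<in> K \<Longrightarrow> norm (?D x (axis i 1)) \<le> b"
      by (auto simp: bounded_iff)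
    have "norm (?D x (axis i 1)) \<le> max b 0" for x
    proof (cases "x \<in> K")
      case True then show ?thesis using b by (simp add: max.coboundedI1)
    next
      case False
      then have "?D x = frechet_derivative (\<lambda>x. 0) (at x)"
        using K by (intro frechet_derivative_cong_open[of "-K"]) (auto simp: compact_imp_closed open_Compl)
      then show ?thesis by (simp add: frechet_derivative_const)
    qed
    then show ?thesis by (intro exI[of _ "max b 0"]) auto
  qed
  then obtain b where b: "\<And>i. b i \<ge> 0" "\<And>i x. norm (?D x (axis i 1)) \<le> b i" by metis
  \<comment> \<open>The summand 1 makes \<open>M\<close> positive, so that the parameters below 1 /
    \<open>M\<close> form a nondegenerate interval.\<close>
  define M where "M = (\<Sum>i\<in>UNIV. b i) + 1"
  have M: "M > 0" using b(1) by (simp add: M_def add_nonneg_pos sum_nonneg)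
  have bound: "norm (?D x v) \<le> M * norm v" for x v
  proof -
    have "?D x v = ?D x (\<Sum>i\<in>UNIV. v $ i *\<^sub>R axis i 1)"
      by (rule arg_cong[of _ _ "?D x"]) (simp add: vec_eq_iff axis_def if_distrib sum.delta cong: if_cong)
    also have "\<dots> = (\<Sum>i\<in>UNIV. v $ i *\<^sub>R ?D x (axis i 1))"
      by (simp only: linear_sum[OF has_derivative_linear[OF du]] linear_scale[OF has_derivative_linear[OF du]])
    finally have "norm (?D x v) \<le> (\<Sum>i\<in>UNIV. norm (v $ i *\<^sub>R ?D x (axis i 1)))"
      by (simp only: norm_sum)
    also have "\<dots> \<le> (\<Sum>i\<in>UNIV. norm v * b i)"
      using b component_le_norm_cart[of v] by (intro sum_mono) (simp add: mult_mono)
    also have "\<dots> \<le> M * norm v" by (simp add: M_def sum_distrib_left algebra_simps)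
    finally show ?thesis .
  qed
  have "norm (u x - u y) \<le> M * norm (x - y)" for x y
  proof (rule differentiable_bound[of UNIV u ?D M])
    show "onorm (?D x) \<le> M" for x using bound by (rule onorm_le)
  qed (use du in \<open>auto intro: has_derivative_at_withinI\<close>)
  then show thesis using that M bound by blast
qed

lemma integral_continuous_compact:
  fixes f :: "real^'n \<Rightarrow> 'b::{banach,second_countable_topology}"
  assumes "compact B" "continuous_on B f" shows "set_integrable lborel B f"
  unfolding set_integrable_def using assms by (rule borel_integrable_compact)

text \<open>The integral of det Du is the coefficient of the top power of t in the polynomial
  \<open>q\<close>, whereas \<open>q\<close> equals the volume of the ball for infinitely many t. A
  constant polynomial has no such coefficient because the dimension is at least 1.\<close>

lemma integral_jac_real:
  fixes u :: "real^'n::finite \<Rightarrow> real^'n"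
  assumes u: "Ck_on 1 UNIV u" and K: "compact K" "\<And>x. x \<notin> K \<Longrightarrow> u x = 0"
  shows "(LINT x|lborel. jac u x) = 0" "integrable lborel (jac u)"
proof -
  let ?D = "\<lambda>x. frechet_derivative u (at x)"
  have du: "(u has_derivative ?D x) (at x)" for x
    using Ck_on_has_derivative[of 0 UNIV u] u by simp
  obtain M where M: "M > 0" "\<And>x v. norm (?D x v) \<le> M * norm v" "\<And>x y. norm (u x - u y) \<le> M * norm (x - y)"
    using Lipschitz_compact_support[OF assms] by blast
  obtain R where "\<forall>x\<in>K. norm x \<le> R" using compact_imp_bounded[OF K(1)] by (auto simp: bounded_iff)
  then have R: "K \<subseteq> cball 0 R" by auto
  define B where "B = (cball 0 R :: (real^'n) set)"
  have B: "compact B" "K \<subseteq> B" "B \<in> sets borel" using R by (auto simp: B_def)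
  \<comment> \<open>The contribution of \<open>S\<close> to det (I + t Du): rows in \<open>S\<close>
    come from Du, the others from the identity.\<close>
  define d where "d = (\<lambda>S x. det (\<chi> i. if i \<in> S then matrix (?D x) $ i else mat 1 $ i :: real^'n^'n))"
  have contd: "continuous_on UNIV (d S)" for S
  proof -
    have "Ck_on 0 UNIV (\<lambda>x. (\<chi> i. if i \<in> S then matrix (?D x) $ i else mat 1 $ i :: real^'n^'n) $ i $ j)" for i j
      using u by (cases "i \<in> S") (auto simp: matrix_def intro!: Ck_on_nth[where k=0, simplified])
    then have "Ck_on 0 UNIV (d S)" unfolding d_def by (intro Ck_on_det) auto
    then show ?thesis by simp
  qed
  have intd: "set_integrable lborel B (d S)" for S
    using B(1) contd continuous_on_subset by (blast intro: integral_continuous_compact)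
  define c where "c = (\<lambda>S. LINT x:B|lborel. d S x)"
  define q where "q = (\<Sum>S\<in>UNIV. monom (c S) (card S))"
  have expand: "det (matrix (\<lambda>v. v + t *\<^sub>R ?D x v)) = (\<Sum>S\<in>UNIV. t ^ card S * d S x)" for t x
  proof -
    have "matrix (\<lambda>v. v + t *\<^sub>R ?D x v) = (\<chi> i j. mat 1 $ i $ j + t * matrix (?D x) $ i $ j)"
      by (auto simp: matrix_def mat_def axis_def vec_eq_iff)
    then show ?thesis unfolding d_def by (simp only: det_add_scaled)
  qed
  have poly_q: "poly q t = measure lborel B" if t: "0 \<le> t" "t * M < 1" for t
  proof -
    define g where "g = (\<lambda>x. x + t *\<^sub>R u x)"
    define g' where "g' = (\<lambda>x v. v + t *\<^sub>R ?D x v)"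
    have dg: "(g has_derivative g' x) (at x)" for x
      unfolding g_def g'_def by (intro derivative_intros du)
    have lip: "norm (t *\<^sub>R u x - t *\<^sub>R u y) \<le> (t * M) * norm (x - y)" for x y
      using mult_left_mono[OF M(3)[of x y] t(1)] t(1) by (simp flip: scaleR_diff_right)
    have less: "t * M * norm z < norm z" if "z \<noteq> 0" for z :: "real^'n" using that t(2) by simp
    have injg: "inj g"
    proof (rule injI, rule ccontr)
      fix x y assume "g x = g y" "x \<noteq> y"
      then have "x - y = - (t *\<^sub>R u x - t *\<^sub>R u y)" by (simp add: g_def algebra_simps)
      then have "norm (x - y) = norm (t *\<^sub>R u x - t *\<^sub>R u y)" by (metis norm_minus_cancel)
      then show False using lip[of x y] less[of "x - y"] \<open>x \<noteq> y\<close> by simp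
    qed
    \<comment> \<open>Solutions of \<open>g x = y\<close> are the fixed points of the contraction
      that sends x to y - t u x.\<close>
    have surjg: "\<exists>x. g x = y" for y
    proof -
      have "\<exists>!x\<in>UNIV. y - t *\<^sub>R u x = x"
      proof (rule Banach_fix[where c="t * M"])
        show "dist (y - t *\<^sub>R u v) (y - t *\<^sub>R u w) \<le> t * M * dist v w" for v w
          using lip[of w v] by (simp add: dist_norm norm_minus_commute)
      qed (use t M(1) in \<open>auto simp: complete_UNIV\<close>)
      then show ?thesis by (auto simp: g_def algebra_simps)
    qed
    have id: "g x = x" if "x \<notin> B" for x using K(2)[of x] B(2) that by (auto simp: g_def)
    have gB: "g ` B = B"
    proof (intro equalityI subsetI)
      fix y assume "y \<in> g ` B"
      then obtain x where "x \<in> B" "y = g x" by auto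
      then show "y \<in> B" using id[of y] injg by (metis injD)
    next
      fix y assume "y \<in> B"
      then show "y \<in> g ` B" using surjg[of y] id by (metis imageI)
    qed
    \<comment> \<open>The determinant is 1 at parameter 0. If it were not positive at t, it would
      vanish at some s \<le> t, and a kernel vector z = - s Du z would contradict the contraction
      bound. Positivity removes the absolute value from the change of variables.\<close>
    have pos: "det (matrix (g' x)) > 0" for x
    proof (rule ccontr)
      assume "\<not> 0 < det (matrix (g' x))"
      define k where "k = (\<lambda>s. \<Sum>S\<in>UNIV. s ^ card S * d S x)"
      have "k t \<le> 0" using \<open>\<not> 0 < _\<close> expand by (simp add: k_def g'_def)
      moreover have "k 0 > 0"
        using expand[of 0 x] by (simp add: k_def matrix_id_mat_1 det_I flip: id_def)
      moreover have "continuous_on {0..t} k" unfolding k_def by (intro continuous_intros)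
      ultimately obtain s where s: "0 \<le> s" "s \<le> t" "k s = 0"
        using IVT2'[of k t 0 0] t(1) by auto
      then have "det (matrix (\<lambda>v. v + s *\<^sub>R ?D x v)) = 0" using expand by (simp add: k_def)
      then have "\<not> inj ((*v) (matrix (\<lambda>v. v + s *\<^sub>R ?D x v)))"
        by (metis inj_matrix_vector_mult invertible_det_nz invertible_left_inverse matrix_left_invertible_injective)
      moreover have "(*v) (matrix (\<lambda>v. v + s *\<^sub>R ?D x v)) = (\<lambda>v. v + s *\<^sub>R ?D x v)"
      proof -
        have "linear (\<lambda>v. v + s *\<^sub>R ?D x v)"
          using has_derivative_linear[OF du[of x]] by (intro linear_compose_add linear_compose_scale_right) (auto simp: linear_id[unfolded id_def])
        then show ?thesis by (simp add: fun_eq_iff matrix_works)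
      qed
      ultimately obtain v w where vw: "v \<noteq> w" "v + s *\<^sub>R ?D x v = w + s *\<^sub>R ?D x w"
        by (auto simp: inj_def)
      define z where "z = v - w"
      have "?D x z = ?D x v - ?D x w"
        unfolding z_def by (rule linear_diff[OF has_derivative_linear[OF du]])
      then have "z = - (s *\<^sub>R ?D x z)"
        using vw(2) by (simp add: z_def scaleR_diff_right) (simp add: algebra_simps)
      then have "norm z = s * norm (?D x z)" using s(1) by (metis abs_of_nonneg norm_minus_cancel norm_scaleR)
      also have "\<dots> \<le> t * (M * norm z)" using s M(2)[of x z] t by (intro mult_mono) auto
      finally show False using less[of z] vw(1) by (simp add: z_def mult.assoc)
    qed
    have cont: "continuous_on UNIV (\<lambda>x. det (matrix (g' x)))"
      unfolding g'_def expand by (intro continuous_intros contd)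
    have int: "set_integrable lborel B (\<lambda>x. det (matrix (g' x)))"
      using B(1) cont continuous_on_subset by (blast intro: integral_continuous_compact)
    have "(\<integral>\<^sup>+y\<in>g ` B. ennreal 1 \<partial>lborel) = (\<integral>\<^sup>+x\<in>B. ennreal (\<bar>det (matrix (g' x))\<bar> * 1) \<partial>lborel)"
    proof (rule nn_integral_change_of_variables)
      show "set_borel_measurable borel B (\<lambda>x. \<bar>det (matrix (g' x))\<bar> * 1)"
        unfolding set_borel_measurable_def using B(3) borel_measurable_continuous_onI[OF cont] by measurable
    qed (use B gB dg injg in \<open>auto simp: set_borel_measurable_def intro: has_derivative_at_withinI inj_on_subset\<close>)
    also have "\<dots> = (\<integral>\<^sup>+x. ennreal (indicator B x *\<^sub>R det (matrix (g' x))) \<partial>lborel)"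
      using less_imp_le[OF pos] by (intro nn_integral_cong) (auto split: split_indicator)
    also have "\<dots> = ennreal (LINT x:B|lborel. det (matrix (g' x)))"
      unfolding set_lebesgue_integral_def using int less_imp_le[OF pos]
      by (intro nn_integral_eq_integral) (auto simp: set_integrable_def)
    finally have "ennreal (LINT x:B|lborel. det (matrix (g' x))) = emeasure lborel B"
      using B(3) unfolding gB by simp
    moreover have "emeasure lborel B = ennreal (measure lborel B)"
      using emeasure_compact_finite[OF B(1)] by (intro emeasure_eq_ennreal_measure) simp
    moreover have "0 \<le> (LINT x:B|lborel. det (matrix (g' x)))"
      unfolding set_lebesgue_integral_def using less_imp_le[OF pos] by (intro integral_nonneg_AE AE_I2) simp
    ultimately have "(LINT x:B|lborel. det (matrix (g' x))) = measure lborel B" by simp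
    moreover have "(LINT x:B|lborel. det (matrix (g' x))) = (\<Sum>S\<in>UNIV. t ^ card S * c S)"
    proof -
      have "integrable lborel (\<lambda>x. t ^ card S * (indicator B x *\<^sub>R d S x))" for S
        using intd[of S] unfolding set_integrable_def by simp
      then have "(\<integral>x. (\<Sum>S\<in>UNIV. t ^ card S * (indicator B x *\<^sub>R d S x)) \<partial>lborel) = (\<Sum>S\<in>UNIV. t ^ card S * c S)"
        by (subst Bochner_Integration.integral_sum) (auto simp: c_def set_lebesgue_integral_def)
      then show ?thesis unfolding set_lebesgue_integral_def g'_def expand by (simp add: sum_distrib_left mult_ac)
    qed
    ultimately show ?thesis by (simp add: q_def poly_sum poly_monom mult.commute)
  qed
  have "q - [:measure lborel B:] = 0"
  proof (rule ccontr)
    assume "q - [:measure lborel B:] \<noteq> 0"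
    then have "finite {t. poly (q - [:measure lborel B:]) t = 0}" by (rule poly_roots_finite)
    moreover have "{0..<1/M} \<subseteq> {t. poly (q - [:measure lborel B:]) t = 0}"
      using poly_q M(1) by (auto simp: pos_less_divide_eq)
    ultimately have "finite {0..<1/M}" using finite_subset by blast
    then show False using M(1) by (simp add: infinite_Ico)
  qed
  then have "coeff q CARD('n) = 0" by (simp add: coeff_pCons split: nat.split)
  moreover have "coeff q CARD('n) = (\<Sum>S\<in>UNIV. if S = UNIV then c S else 0)"
  proof -
    have "card S = CARD('n) \<longleftrightarrow> S = UNIV" for S :: "'n set"
      using card_eq_UNIV_imp_eq_UNIV[of S] by auto
    then show ?thesis unfolding q_def coeff_sum coeff_monom by simp
  qed
  ultimately have c0: "c UNIV = 0" by simp
  have dU: "d UNIV x = jac u x" for x by (simp add: d_def jac_real vec_lambda_eta)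
  have "indicator B x *\<^sub>R jac u x = jac u x" for x
  proof (cases "x \<in> B")
    case False
    then have "jac u x = jac (\<lambda>x. 0) x"
      using K B(2) by (intro jac_cong_open[of "-K"]) (auto simp: compact_imp_closed open_Compl)
    then show ?thesis by (simp add: jac_const_zero)
  qed simp
  then have "(\<lambda>x. indicator B x *\<^sub>R d UNIV x) = jac u" by (simp only: dU)
  then show "(LINT x|lborel. jac u x) = 0" "integrable lborel (jac u)"
    using intd[of UNIV] c0 by (simp_all only: c_def set_lebesgue_integral_def set_integrable_def)
qed

text \<open>A complex determinant expands over the choices of real or imaginary part in every
  component. Each term is the Jacobian of a real map \<open>w S\<close>, again compactly
  supported.\<close>

lemma integral_jac_complex:
  fixes u :: "real^'n::finite \<Rightarrow> complex^'n"
  assumes u: "Ck_on 1 UNIV u" and K: "compact K" "\<And>x. x \<notin> K \<Longrightarrow> u x = 0"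
  shows "(LINT x|lborel. jac u x) = 0" "integrable lborel (jac u)"
proof -
  define w where "w = (\<lambda>S x. \<chi> k. if k \<in> S then Im (u x $ k) else Re (u x $ k))"
  have cp: "Ck_on 1 UNIV (\<lambda>x. if k \<in> S then Im (u x $ k) else Re (u x $ k))" for S k
    using u by (cases "k \<in> S") (auto intro!: Ck_on_linear_compose[OF bounded_linear_Im] Ck_on_linear_compose[OF bounded_linear_Re] Ck_on_nth simp del: One_nat_def)
  have w: "Ck_on 1 UNIV (w S)" for S
    unfolding w_def by (rule Ck_on_vec) (simp_all del: One_nat_def add: cp)
  have w0: "w S x = 0" if "x \<notin> K" for S x using K(2)[OF that] by (simp add: w_def vec_eq_iff)
  have du: "(u has_derivative frechet_derivative u (at x)) (at x)" for x
    using Ck_on_has_derivative[of 0 UNIV u] u by simp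
  have fw: "frechet_derivative (w S) (at x) v $ k
     = (if k \<in> S then Im (frechet_derivative u (at x) v $ k) else Re (frechet_derivative u (at x) v $ k))" for S x v k
  proof -
    have "(w S has_derivative (\<lambda>v. \<chi> k. if k \<in> S then Im (frechet_derivative u (at x) v $ k) else Re (frechet_derivative u (at x) v $ k))) (at x)"
    proof (subst has_derivative_componentwise_within, intro ballI)
      fix b :: "real^'n" assume "b \<in> Basis"
      then obtain k where b: "b = axis k 1" by (auto simp: Basis_vec_def)
      have "((\<lambda>x. Im (u x $ k)) has_derivative (\<lambda>v. Im (frechet_derivative u (at x) v $ k))) (at x)"
        "((\<lambda>x. Re (u x $ k)) has_derivative (\<lambda>v. Re (frechet_derivative u (at x) v $ k))) (at x)"
        by (intro derivative_intros du bounded_linear.has_derivative[OF bounded_linear_vec_nth])+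
      then show "((\<lambda>x. w S x \<bullet> b) has_derivative (\<lambda>v. (\<chi> k. if k \<in> S then Im (frechet_derivative u (at x) v $ k) else Re (frechet_derivative u (at x) v $ k)) \<bullet> b)) (at x)"
        by (cases "k \<in> S") (simp_all add: b w_def inner_axis)
    qed
    from frechet_derivative_at[OF this, symmetric] show ?thesis by (simp only: vec_lambda_beta)
  qed
  have jac: "jac u x = (\<Sum>S\<in>UNIV. \<i> ^ card S * of_real (jac (w S) x))" for x
  proof -
    let ?A = "\<chi> i j. complex_of_real (Re (frechet_derivative u (at x) (axis j 1) $ i))"
    let ?B = "\<chi> i j. complex_of_real (Im (frechet_derivative u (at x) (axis j 1) $ i))"
    have "jac u x = det (\<chi> i j. ?A $ i $ j + \<i> * ?B $ i $ j)"
      unfolding jac_def by (simp flip: complex_eq)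
    also have "\<dots> = (\<Sum>S\<in>UNIV. \<i> ^ card S * det (\<chi> i. if i \<in> S then ?B $ i else ?A $ i))"
      by (rule det_add_scaled)
    also have "\<dots> = (\<Sum>S\<in>UNIV. \<i> ^ card S * of_real (jac (w S) x))"
    proof (rule sum.cong)
      fix S
      have "(\<chi> i. if i \<in> S then ?B $ i else ?A $ i) = (\<chi> i j. of_real ((\<chi> i j. frechet_derivative (w S) (at x) (axis j 1) $ i) $ i $ j))"
        by (auto simp: vec_eq_iff fw)
      then show "\<i> ^ card S * det (\<chi> i. if i \<in> S then ?B $ i else ?A $ i) = \<i> ^ card S * of_real (jac (w S) x)"
        by (simp only: det_of_real jac_def)
    qed simp
    finally show ?thesis .
  qed
  have r: "(LINT x|lborel. jac (w S) x) = 0" "integrable lborel (jac (w S))" for S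
    using integral_jac_real[OF w K(1) w0] by auto
  have i: "integrable lborel (\<lambda>x. \<i> ^ card S * complex_of_real (jac (w S) x))" for S
    using r(2)[of S] by simp
  show "integrable lborel (jac u)" unfolding jac[abs_def] using i by (intro Bochner_Integration.integrable_sum)
  show "(LINT x|lborel. jac u x) = 0"
    unfolding jac[abs_def] using i r by (subst Bochner_Integration.integral_sum) auto
qed

section \<open>Cutoff functions of class C^1\<close>

definition sq_pos :: "real \<Rightarrow> real" where "sq_pos y = (max 0 y)\<^sup>2"

text \<open>Squaring the positive part makes the one-sided derivatives at 0 agree; one continuous
  derivative is all that the Jacobian integrals need.\<close>

lemma Ck_on_sq_pos: "Ck_on 1 UNIV sq_pos"
proof -
  have "(sq_pos has_field_derivative 2 * max 0 y) (at y)" for y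
  proof -
    consider "y > 0" | "y < 0" | "y = 0" by linarith
    then show ?thesis
    proof cases
      case 1
      have "((\<lambda>y. y\<^sup>2) has_field_derivative 2 * y) (at y)" by (auto intro!: derivative_eq_intros)
      then show ?thesis using 1
        by (subst DERIV_cong_ev[of y y _ "\<lambda>y. y\<^sup>2" _ "2 * y"])
          (auto simp: sq_pos_def intro!: eventually_mono[OF eventually_gt_at_top] eventually_nhds_in_open[of "{0<..}", THEN eventually_mono])
    next
      case 2
      then show ?thesis
        by (subst DERIV_cong_ev[of y y _ "\<lambda>y. 0" _ 0])
          (auto simp: sq_pos_def intro!: eventually_nhds_in_open[of "{..<0}", THEN eventually_mono])
    next
      case 3
      have "\<bar>(max 0 h)\<^sup>2 / h\<bar> \<le> \<bar>h\<bar>" for h :: real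
        by (cases "h > 0") (auto simp: max_def power2_eq_square)
      then have "((\<lambda>h. (max 0 h)\<^sup>2 / h) \<longlongrightarrow> 0) (at (0::real))"
        by (intro Lim_null_comparison[OF _ tendsto_rabs_zero[OF tendsto_ident_at]]) simp
      then show ?thesis unfolding 3 DERIV_def by (simp add: sq_pos_def)
    qed
  qed
  then have "(sq_pos has_derivative (\<lambda>v. 2 * max 0 y * v)) (at y)" for y
    by (simp add: has_field_derivative_def)
  then have "Ck_on (Suc 0) UNIV sq_pos"
    by (rule Ck_on_SucI[OF open_UNIV]) (auto intro!: continuous_intros)
  then show ?thesis by simp
qed

text \<open>The inner \<open>sq_pos\<close> falls from 1 at the centre to 0 at distance r. Up to
  distance r / 2 it is at least (3/4)^2 > 1/2, so the factor 2 makes the outer argument negative and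
  the bump equals exactly 1 there.\<close>

definition bump :: "'a::euclidean_space \<Rightarrow> real \<Rightarrow> 'a \<Rightarrow> real" where
  "bump a r z = 1 - sq_pos (1 - 2 * sq_pos (1 - (z - a) \<bullet> (z - a) / r\<^sup>2))"

lemma Ck_on_bump: "Ck_on 1 UNIV (bump a r)"
proof -
  have 1: "Ck_on 1 UNIV (\<lambda>z::'a. z - a)" by (intro Ck_on_diff Ck_on_id Ck_on_const) auto
  have "Ck_on 1 UNIV (\<lambda>z. 1 - ((z - a) \<bullet> (z - a)) * inverse (r\<^sup>2))"
    using Ck_on_bilinear[OF bounded_bilinear_inner open_UNIV 1 1] by (intro Ck_on_diff Ck_on_mult Ck_on_const open_UNIV)
  then have "Ck_on 1 UNIV (\<lambda>z. sq_pos (1 - ((z - a) \<bullet> (z - a)) * inverse (r\<^sup>2)))"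
    by (intro Ck_on_compose[OF open_UNIV open_UNIV _ Ck_on_sq_pos]) auto
  then have "Ck_on 1 UNIV (\<lambda>z. 1 - 2 * sq_pos (1 - ((z - a) \<bullet> (z - a)) * inverse (r\<^sup>2)))"
    by (intro Ck_on_diff Ck_on_mult Ck_on_const open_UNIV)
  then have "Ck_on 1 UNIV (\<lambda>z. sq_pos (1 - 2 * sq_pos (1 - ((z - a) \<bullet> (z - a)) * inverse (r\<^sup>2))))"
    by (intro Ck_on_compose[OF open_UNIV open_UNIV _ Ck_on_sq_pos]) auto
  then have "Ck_on 1 UNIV (\<lambda>z. 1 - sq_pos (1 - 2 * sq_pos (1 - ((z - a) \<bullet> (z - a)) * inverse (r\<^sup>2))))"
    by (intro Ck_on_diff Ck_on_const open_UNIV)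
  then show ?thesis by (simp add: bump_def[abs_def] divide_inverse)
qed

lemma sq_pos_nonneg: "0 \<le> sq_pos y" by (simp add: sq_pos_def)

lemma sq_pos_eq_0: "y \<le> 0 \<Longrightarrow> sq_pos y = 0" by (simp add: sq_pos_def)

lemma sq_pos_le_1: "y \<le> 1 \<Longrightarrow> sq_pos y \<le> 1"
  by (auto simp: sq_pos_def max_def power_le_one)

lemma bump_range: "0 \<le> bump a r z" "bump a r z \<le> 1"
  using sq_pos_nonneg[of "1 - (z - a) \<bullet> (z - a) / r\<^sup>2"]
    sq_pos_le_1[of "1 - 2 * sq_pos (1 - (z - a) \<bullet> (z - a) / r\<^sup>2)"]
    sq_pos_nonneg[of "1 - 2 * sq_pos (1 - (z - a) \<bullet> (z - a) / r\<^sup>2)"]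
  by (auto simp: bump_def)

lemma bump_eq_0: assumes "r > 0" "dist a z \<ge> r" shows "bump a r z = 0"
proof -
  have "r\<^sup>2 \<le> (z - a) \<bullet> (z - a)"
    using assms power_mono[of r "norm (z - a)" 2] dist_norm[of z a] unfolding power2_norm_eq_inner[symmetric] dist_commute[of z a] by simp
  then have "sq_pos (1 - (z - a) \<bullet> (z - a) / r\<^sup>2) = 0" using assms(1) by (intro sq_pos_eq_0) simp
  then show ?thesis by (simp add: bump_def) (simp add: sq_pos_def)
qed

lemma bump_eq_1: assumes "r > 0" "dist a z \<le> r / 2" shows "bump a r z = 1"
proof -
  have "(z - a) \<bullet> (z - a) \<le> (r / 2)\<^sup>2"
    using assms power_mono[of "norm (z - a)" "r / 2" 2] dist_norm[of z a] unfolding power2_norm_eq_inner[symmetric] dist_commute[of z a] by simp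
  then have "(z - a) \<bullet> (z - a) / r\<^sup>2 \<le> 1/4" using assms(1) by (simp add: field_simps power2_eq_square)
  then have "3/4 \<le> 1 - (z - a) \<bullet> (z - a) / r\<^sup>2" by simp
  then have "3/4 \<le> max 0 (1 - (z - a) \<bullet> (z - a) / r\<^sup>2)" by (rule max.coboundedI2)
  then have "(3/4)\<^sup>2 \<le> sq_pos (1 - (z - a) \<bullet> (z - a) / r\<^sup>2)"
    unfolding sq_pos_def by (rule power_mono) simp
  then have "1 - 2 * sq_pos (1 - (z - a) \<bullet> (z - a) / r\<^sup>2) \<le> 0" by (simp add: power2_eq_square)
  then show ?thesis by (simp add: bump_def sq_pos_eq_0)
qed

text \<open>Being 1 on a neighbourhood of \<open>K\<close>, and not only on \<open>K\<close>, is
  what keeps Jacobians unchanged there. Balls of half size cover \<open>K\<close>, so the sum of the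
  bumps is at least 1 near \<open>K\<close>, and the outer \<open>sq_pos\<close> truncates it to
  1.\<close>

lemma C1_cutoff:
  fixes K :: "'a::euclidean_space set"
  assumes "compact K" "open V" "K \<subseteq> V"
  obtains \<eta> :: "'a \<Rightarrow> real" and N K' where "Ck_on 1 UNIV \<eta>" "open N" "K \<subseteq> N" "\<And>x. x \<in> N \<Longrightarrow> \<eta> x = 1"
    "compact K'" "K' \<subseteq> V" "\<And>x. x \<notin> K' \<Longrightarrow> \<eta> x = 0"
proof -
  have "\<exists>r>0. cball x r \<subseteq> V" if "x \<in> K" for x
    using assms that open_contains_cball by blast
  then obtain r where r: "\<And>x. x \<in> K \<Longrightarrow> r x > 0 \<and> cball x (r x) \<subseteq> V" by metis
  obtain F where F: "F \<subseteq> K" "finite F" "K \<subseteq> (\<Union>x\<in>F. ball x (r x / 2))"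
    using compactE_image[OF assms(1), of K "\<lambda>x. ball x (r x / 2)"] r by force
  define w where "w = (\<lambda>z. \<Sum>x\<in>F. bump x (r x) z)"
  define \<eta> where "\<eta> = (\<lambda>z. 1 - sq_pos (1 - w z))"
  have "Ck_on 1 UNIV w" unfolding w_def by (intro Ck_on_sum Ck_on_bump open_UNIV)
  then have "Ck_on 1 UNIV (\<lambda>z. 1 - w z)" by (intro Ck_on_diff Ck_on_const open_UNIV)
  then have "Ck_on 1 UNIV (\<lambda>z. sq_pos (1 - w z))"
    by (intro Ck_on_compose[OF open_UNIV open_UNIV _ Ck_on_sq_pos]) auto
  then have c: "Ck_on 1 UNIV \<eta>" unfolding \<eta>_def by (intro Ck_on_diff Ck_on_const open_UNIV)
  show thesis
  proof (rule that[OF c, of "\<Union>x\<in>F. ball x (r x / 2)" "\<Union>x\<in>F. cball x (r x)"])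
    fix z assume "z \<in> (\<Union>x\<in>F. ball x (r x / 2))"
    then obtain x where x: "x \<in> F" "dist x z \<le> r x / 2" by auto
    then have "bump x (r x) z = 1" using r F by (intro bump_eq_1) auto
    moreover have "bump x (r x) z \<le> w z"
      unfolding w_def using x F by (intro member_le_sum[of x F "\<lambda>x. bump x (r x) z"] bump_range)
    ultimately have "w z \<ge> 1" by simp
    then show "\<eta> z = 1" by (simp add: \<eta>_def sq_pos_eq_0)
  next
    fix z assume "z \<notin> (\<Union>x\<in>F. cball x (r x))"
    then have "w z = 0" using r F unfolding w_def by (intro sum.neutral ballI bump_eq_0) force+
    then show "\<eta> z = 0" by (simp add: \<eta>_def) (simp add: sq_pos_def)
  qed (use F r in \<open>auto intro: compact_UN\<close>)
qed

text \<open>Multiplication by one cutoff makes both maps compactly supported, and it alters their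
  Jacobians equally, because the maps agree wherever the cutoff is not 1. Only the difference is
  integrated, as neither Jacobian need be integrable on \<open>V\<close>.\<close>

lemma integral_jac_diff:
  fixes P Q :: "real^'n::finite \<Rightarrow> complex^'n"
  assumes V: "open V" and P: "Ck_on 1 V P" and Q: "Ck_on 1 V Q"
    and K: "compact K" "K \<subseteq> V" "\<And>x. x \<in> V - K \<Longrightarrow> P x = Q x"
  shows "(LINT x:V|lborel. (jac P x - jac Q x)) = 0"
proof -
  obtain \<eta> :: "real^'n \<Rightarrow> real" and N K' where c: "Ck_on 1 UNIV \<eta>" "open N" "K \<subseteq> N" "\<And>x. x \<in> N \<Longrightarrow> \<eta> x = 1"
    "compact K'" "K' \<subseteq> V" "\<And>x. x \<notin> K' \<Longrightarrow> \<eta> x = 0"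
    using C1_cutoff[OF K(1) V K(2)] by metis
  define ext where "ext = (\<lambda>(P::real^'n \<Rightarrow> complex^'n) x. if x \<in> V then \<eta> x *\<^sub>R P x else 0)"
  have cl: "open (-K')" "open (-K)" using c(5) K(1) compact_imp_closed by auto
  have ext0: "ext P x = 0" if "x \<notin> K'" for P x using c(7)[OF that] by (simp add: ext_def)
  have Ck: "Ck_on 1 UNIV (ext P)" if "Ck_on 1 V P" for P
  proof (rule Ck_on_local)
    fix x
    show "\<exists>T. open T \<and> x \<in> T \<and> Ck_on 1 T (ext P)"
    proof (cases "x \<in> V")
      case True
      have "Ck_on 1 V (\<lambda>x. \<eta> x *\<^sub>R P x)"
        using Ck_on_subset[OF c(1)] that by (intro Ck_on_scaleR V) auto
      then have "Ck_on 1 V (ext P)" by (rule Ck_on_cong[OF V, rotated]) (simp add: ext_def)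
      then show ?thesis using True V by blast
    next
      case False
      have "Ck_on 1 (-K') (ext P)"
        by (rule Ck_on_cong[OF cl(1), of "\<lambda>x. 0"]) (auto simp: ext0 simp del: One_nat_def)
      then show ?thesis using False c(6) cl(1) by blast
    qed
  qed
  have "indicator V x *\<^sub>R (jac P x - jac Q x) = jac (ext P) x - jac (ext Q) x" for x
  proof -
    \<comment> \<open>On \<open>N\<close> the cutoff is 1, on \<open>V - K\<close> the maps agree
      locally, and off \<open>K'\<close> both extensions vanish locally.\<close>
    consider "x \<in> N \<inter> V" | "x \<in> V - K" | "x \<in> - K'" using c K by blast
    then show ?thesis
    proof cases
      case 1
      then have "jac (ext P) x = jac P x" for P
        using c V by (intro jac_cong_open[of "N \<inter> V"]) (auto simp: ext_def)
      then show ?thesis using 1 by simp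
    next
      case 2
      have o: "open (V - K)" using V K(1) compact_imp_closed by blast
      have "jac P x = jac Q x" "jac (ext P) x = jac (ext Q) x"
        using K(3) by (auto intro!: jac_cong_open[OF o 2] simp: ext_def)
      then show ?thesis by simp
    next
      case 3
      have z: "jac (ext P) x = 0" for P
        using jac_cong_open[OF cl(1) 3, of "ext P" "\<lambda>x. 0"] ext0 by (simp add: jac_const_zero)
      show ?thesis
      proof (cases "x \<in> V")
        case True
        show ?thesis
        proof (cases "x \<in> K")
          case True
          then show ?thesis using c 3 by (metis ComplD in_mono zero_neq_one)
        next
          case False
          have o: "open (V - K)" using V K(1) compact_imp_closed by blast
          have "jac P x = jac Q x"
            using K(3) False True by (auto intro!: jac_cong_open[OF o])
          then show ?thesis by (simp add: z)
        qed
      qed (simp add: z)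
    qed
  qed
  then show ?thesis
    unfolding set_lebesgue_integral_def
    using integral_jac_complex[OF Ck[OF P] c(5) ext0] integral_jac_complex[OF Ck[OF Q] c(5) ext0]
    by (simp add: Bochner_Integration.integral_diff)
qed

section \<open>Holomorphic functions of several variables\<close>

lemma clinear_scale: "Vector_Spaces.linear (*s) (*) D \<Longrightarrow> D (c *s x) = c * D x" for c :: complex
  and D :: "complex^'n \<Rightarrow> complex"
  by (simp add: Vector_Spaces.linear_iff)

lemma clinear_add: "Vector_Spaces.linear (*s) (*) D \<Longrightarrow> D (x + y) = D x + D y"
  for D :: "complex^'n \<Rightarrow> complex"
  by (simp add: Vector_Spaces.linear_iff)

lemma clinearI:
  fixes D :: "complex^'n \<Rightarrow> complex"
  assumes "\<And>x y. D (x + y) = D x + D y" "\<And>c x. D (c *s x) = c * D x"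
  shows "Vector_Spaces.linear (*s) (*) D"
proof -
  have "vector_space ((*s) :: complex \<Rightarrow> complex^'n \<Rightarrow> _)" by unfold_locales
  moreover have "vector_space ((*) :: complex \<Rightarrow> complex \<Rightarrow> _)"
    by unfold_locales (auto simp: algebra_simps)
  ultimately show ?thesis using assms by (simp add: Vector_Spaces.linear_iff)
qed

lemma cholomorphic_onD:
  fixes h :: "complex^'n \<Rightarrow> complex"
  assumes "cholomorphic_on S h" "z \<in> S"
  shows "(h has_derivative frechet_derivative h (at z)) (at z)"
    "Vector_Spaces.linear (*s) (*) (frechet_derivative h (at z))"
proof -
  obtain D where D: "(h has_derivative D) (at z)" "Vector_Spaces.linear (*s) (*) D"
    using assms unfolding cholomorphic_on_def by blast
  with frechet_derivative_at[OF D(1)] show "(h has_derivative frechet_derivative h (at z)) (at z)"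
    "Vector_Spaces.linear (*s) (*) (frechet_derivative h (at z))" by simp_all
qed

lemma cholomorphic_on_subset: "cholomorphic_on S h \<Longrightarrow> T \<subseteq> S \<Longrightarrow> cholomorphic_on T h"
  unfolding cholomorphic_on_def by blast

lemma cholomorphic_on_continuous:
  assumes "cholomorphic_on S h" shows "continuous_on S h"
  using has_derivative_continuous[OF cholomorphic_onD(1)[OF assms]]
  by (intro continuous_at_imp_continuous_on ballI)

lemma cholomorphic_on_mult:
  assumes "cholomorphic_on S g" "cholomorphic_on S h"
  shows "cholomorphic_on S (\<lambda>z. g z * h z)"
  unfolding cholomorphic_on_def
proof
  fix z assume z: "z \<in> S"
  note g = cholomorphic_onD[OF assms(1) z] and h = cholomorphic_onD[OF assms(2) z]
  have "((\<lambda>z. g z * h z) has_derivative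
      (\<lambda>v. g z * frechet_derivative h (at z) v + frechet_derivative g (at z) v * h z)) (at z)"
    by (rule has_derivative_mult[OF g(1) h(1)])
  moreover have "Vector_Spaces.linear (*s) (*) (\<lambda>v. g z * frechet_derivative h (at z) v + frechet_derivative g (at z) v * h z)"
    by (rule clinearI) (simp_all add: clinear_add[OF g(2)] clinear_add[OF h(2)] clinear_scale[OF g(2)] clinear_scale[OF h(2)] algebra_simps)
  ultimately show "\<exists>D. ((\<lambda>z. g z * h z) has_derivative D) (at z) \<and> Vector_Spaces.linear (*s) (*) D" by blast
qed

lemma bounded_linear_smult_left: "bounded_linear (\<lambda>c::complex. c *s v :: complex^'n)"
  unfolding linear_conv_bounded_linear[symmetric]
  by (auto simp: linear_iff vec_eq_iff algebra_simps)

text \<open>Continuity of the derivative is Cauchy's inequality along the complex line in direction \<open>v\<close>.\<close>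

lemma cholomorphic_on_imp_C1:
  assumes "open S" "cholomorphic_on S h"
  shows "Ck_on 1 S h"
proof -
  have "continuous_on S (\<lambda>z. frechet_derivative h (at z) v)" for v
  proof (rule continuous_at_imp_continuous_on, rule ballI)
    fix z0 assume z0: "z0 \<in> S"
    obtain r where r: "r > 0" "cball z0 r \<subseteq> S" using assms(1) z0 open_contains_cball by blast
    obtain B where B: "B > 0" "\<And>c::complex. norm (c *s v) \<le> norm c * B"
      using bounded_linear.pos_bounded[OF bounded_linear_smult_left[of v]] by blast
    \<comment> \<open>A disc of radius \<open>\<rho>\<close> in direction \<open>v\<close> moves
      points by at most r / 2, so discs centred within r / 2 of \<open>z0\<close> stay in the
      ball.\<close>
    define \<rho> where "\<rho> = r / (2 * B)"
    have \<rho>: "\<rho> > 0" using r B by (simp add: \<rho>_def)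
    have in_ball: "z + c *s v \<in> cball z0 r" if "dist z z0 \<le> r / 2" "norm c \<le> \<rho>" for z c
    proof -
      have "norm (c *s v) \<le> \<rho> * B" using B(2)[of c] that(2) B(1) mult_right_mono[of "norm c" \<rho> B] by linarith
      also have "\<dots> = r / 2" using B(1) by (simp add: \<rho>_def)
      finally have "norm (c *s v) \<le> r / 2" .
      moreover have "dist z0 (z + c *s v) \<le> dist z z0 + norm (c *s v)"
        using norm_triangle_ineq[of "z - z0" "c *s v"] by (simp add: dist_norm norm_minus_commute[of z0] algebra_simps)
      ultimately show ?thesis using that(1) by simp
    qed
    have deriv: "((\<lambda>c. h (z + c *s v)) has_field_derivative frechet_derivative h (at (z + c *s v)) v) (at c)"
      if "dist z z0 \<le> r / 2" "norm c \<le> \<rho>" for z c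
    proof -
      have "z + c *s v \<in> S" using in_ball[OF that] r(2) by blast
      note h = cholomorphic_onD[OF assms(2) this]
      have "((\<lambda>c. z + c *s v) has_derivative (\<lambda>c. c *s v)) (at c)"
        using has_derivative_add[OF has_derivative_const bounded_linear_imp_has_derivative[OF bounded_linear_smult_left]] by simp
      from has_derivative_compose[OF this h(1)] show ?thesis
        unfolding has_field_derivative_def
        by (rule has_derivative_eq_rhs) (simp add: fun_eq_iff clinear_scale[OF h(2)])
    qed
    show "isCont (\<lambda>z. frechet_derivative h (at z) v) z0"
      unfolding continuous_at_eps_delta dist_norm
    proof (intro allI impI)
      fix e :: real assume e: "0 < e"
      have "continuous_on (cball z0 r) h"
        using cholomorphic_on_continuous[OF assms(2)] r(2) continuous_on_subset by blast
      then have "uniformly_continuous_on (cball z0 r) h" by (intro compact_uniformly_continuous) auto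
      \<comment> \<open>The bound \<open>e * \<rho> / 2\<close> is chosen so that Cauchy's
        inequality on the circle of radius \<open>\<rho>\<close> yields e / 2.\<close>
      then obtain d where d: "d > 0" "\<And>x y. x \<in> cball z0 r \<Longrightarrow> y \<in> cball z0 r \<Longrightarrow> dist y x < d \<Longrightarrow> dist (h y) (h x) < e * \<rho> / 2"
        unfolding uniformly_continuous_on_def using e \<rho> by (metis half_gt_zero mult_pos_pos)
      show "\<exists>d>0. \<forall>z. norm (z - z0) < d \<longrightarrow>
          norm (frechet_derivative h (at z) v - frechet_derivative h (at z0) v) < e"
      proof (intro exI[of _ "min d (r / 2)"] conjI allI impI)
        fix z assume z: "norm (z - z0) < min d (r / 2)"
        \<comment> \<open>Cauchy's inequality is applied to the difference of two restrictions to
          parallel lines, so that uniform continuity of \<open>h\<close> itself suffices.\<close>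
        let ?k = "\<lambda>c. h (z + c *s v) - h (z0 + c *s v)"
        have zz: "dist z z0 \<le> r / 2" "dist z0 z0 \<le> r / 2" using z r(1) by (auto simp: dist_norm)
        have dk: "(?k has_field_derivative frechet_derivative h (at (z + c *s v)) v - frechet_derivative h (at (z0 + c *s v)) v) (at c)"
          if "norm c \<le> \<rho>" for c
          by (intro DERIV_diff deriv zz that)
        have "norm ((deriv ^^ 1) ?k 0) \<le> fact 1 * (e * \<rho> / 2) / \<rho> ^ 1"
        proof (rule Cauchy_inequality)
          show "?k holomorphic_on ball 0 \<rho>"
            unfolding holomorphic_on_open[OF open_ball] by (intro ballI exI, rule dk) simp
          show "continuous_on (cball 0 \<rho>) ?k"
            using dk by (intro continuous_at_imp_continuous_on ballI) (auto intro: DERIV_isCont)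
          fix c :: complex assume "norm (0 - c) = \<rho>"
          then have "dist (h (z + c *s v)) (h (z0 + c *s v)) < e * \<rho> / 2"
            using z by (intro d in_ball zz) (auto simp: dist_norm)
          then show "norm (?k c) \<le> e * \<rho> / 2" by (simp add: dist_norm)
        qed (rule \<rho>)
        moreover have "deriv ?k 0 = frechet_derivative h (at z) v - frechet_derivative h (at z0) v"
          using DERIV_imp_deriv[OF dk[of 0]] \<rho> by simp
        ultimately have "norm (frechet_derivative h (at z) v - frechet_derivative h (at z0) v) \<le> e / 2"
          using \<rho> by simp
        then show "norm (frechet_derivative h (at z) v - frechet_derivative h (at z0) v) < e"
          using e by simp
      qed (use d r in auto)
    qed
  qed
  moreover have "\<forall>z\<in>S. h differentiable (at z)"
    using assms(2) unfolding cholomorphic_on_def differentiable_def by blast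
  ultimately show ?thesis by simp
qed

text \<open>The witness is \<open>H z\<close> = (z_k - a) times the integral over t in [0, 1] of h
  at z with z_k replaced by a + t (z_k - a), that is, the integral of \<open>h\<close> along a
  segment in the \<open>k\<close>-th coordinate line. Starting at the coordinate a of the centre
  keeps the segment in the ball.\<close>

lemma holomorphic_primitive:
  fixes h :: "complex^'n::finite \<Rightarrow> complex"
  assumes h: "cholomorphic_on (ball z0 R) h"
  obtains H where "cholomorphic_on (ball z0 R) H"
    "\<And>z. z \<in> ball z0 R \<Longrightarrow> frechet_derivative H (at z) (axis k 1) = h z"
proof -
  define Dh where "Dh = (\<lambda>z. frechet_derivative h (at z))"
  define a where "a = z0 $ k"
  define \<gamma> where "\<gamma> = (\<lambda>z t. z + (t - 1) *\<^sub>R axis k (z $ k - a))"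
  \<comment> \<open>The derivative of \<open>\<gamma> z t\<close> with respect to z: it scales the
    \<open>k\<close>-th coordinate by t and fixes the others.\<close>
  define L where "L = (\<lambda>t w :: complex^'n. w + (t - 1) *\<^sub>R axis k (w $ k))"
  let ?S = "ball z0 R"
  have Dh: "(h has_derivative Dh z) (at z)" "Vector_Spaces.linear (*s) (*) (Dh z)" if "z \<in> ?S" for z
    using cholomorphic_onD[OF h that] by (simp_all add: Dh_def)
  have bl: "bounded_linear (\<lambda>w::complex^'n. axis k (w $ k))"
    using bounded_linear_compose[OF bounded_linear_axis bounded_linear_vec_nth] .
  have blL: "bounded_linear (L t)" for t
    unfolding L_def by (intro bounded_linear_add bounded_linear_ident bounded_linear_scaleR_right[THEN bounded_linear_compose] bl)
  have g_in: "\<gamma> z t \<in> ?S" if "z \<in> ?S" "t \<in> {0..1}" for z t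
  proof -
    have "norm ((\<gamma> z t - z0) $ i) \<le> norm ((z - z0) $ i)" for i
    proof (cases "i = k")
      case True
      have "(\<gamma> z t - z0) $ i = t *\<^sub>R (z - z0) $ i" using True by (simp add: \<gamma>_def a_def axis_def algebra_simps)
      then show ?thesis using that(2) by (simp add: mult_left_le_one_le)
    qed (simp add: \<gamma>_def axis_def)
    then have "norm (\<gamma> z t - z0) \<le> norm (z - z0)" by (rule norm_le_componentwise_cart)
    then show ?thesis using that(1) by (simp add: dist_norm norm_minus_commute)
  qed
  have cont_g: "continuous_on X (\<lambda>(z, t). \<gamma> z t)" for X
    unfolding \<gamma>_def split_beta
    by (intro continuous_intros bounded_linear.continuous_on[OF bounded_linear_axis])
  have dg: "((\<lambda>z. \<gamma> z t) has_derivative L t) (at z within X)" for z t X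
  proof -
    have "((\<lambda>z. z + ((t - 1) *\<^sub>R axis k (z $ k) - (t - 1) *\<^sub>R axis k a)) has_derivative (\<lambda>w. w + ((t - 1) *\<^sub>R axis k (w $ k) - 0))) (at z within X)"
      by (intro has_derivative_add has_derivative_diff has_derivative_ident has_derivative_const has_derivative_scaleR_right
          bounded_linear_imp_has_derivative[OF bl])
    moreover have "(t - 1) *\<^sub>R axis k (z $ k - a) = (t - 1) *\<^sub>R axis k (z $ k) - (t - 1) *\<^sub>R axis k a" for z :: "complex^'n"
      by (simp add: axis_def vec_eq_iff algebra_simps)
    ultimately show ?thesis by (simp add: \<gamma>_def L_def)
  qed
  \<comment> \<open>The derivative in z of the integrand \<open>f z t\<close> below, packed as a
    bounded linear function for the Leibniz rule.\<close>
  define fx where "fx = (\<lambda>z t. Blinfun (\<lambda>w. (z $ k - a) * Dh (\<gamma> z t) (L t w) + w $ k * h (\<gamma> z t)))"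
  have blf: "bounded_linear (\<lambda>w. (z $ k - a) * Dh (\<gamma> z t) (L t w) + w $ k * h (\<gamma> z t))"
    if "z \<in> ?S" "t \<in> {0..1}" for z t
    using has_derivative_bounded_linear[OF Dh(1)[OF g_in[OF that]]]
    by (intro bounded_linear_add bounded_linear_mult_right[THEN bounded_linear_compose] bounded_linear_mult_left[THEN bounded_linear_compose]
        bounded_linear_vec_nth bounded_linear_compose[OF _ blL]) 
  have fx: "blinfun_apply (fx z t) w = (z $ k - a) * Dh (\<gamma> z t) (L t w) + w $ k * h (\<gamma> z t)"
    if "z \<in> ?S" "t \<in> {0..1}" for z t w
    unfolding fx_def by (subst bounded_linear_Blinfun_apply[OF blf[OF that]]) simp
  have contDh: "continuous_on ?S (\<lambda>z. Dh z v)" for v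
    using cholomorphic_on_imp_C1[OF open_ball h] by (simp add: Dh_def)
  have conth: "continuous_on ?S h" using cholomorphic_on_continuous[OF h] .
  have img: "(\<lambda>(z, t). \<gamma> z t) ` (?S \<times> {0..1}) \<subseteq> ?S" using g_in by auto
  have cont_hg: "continuous_on (?S \<times> {0..1}) (\<lambda>p. h (\<gamma> (fst p) (snd p)))"
    using continuous_on_compose2[OF conth cont_g img] by (simp add: split_beta)
  have cont_Dg: "continuous_on (?S \<times> {0..1}) (\<lambda>p. Dh (\<gamma> (fst p) (snd p)) v)" for v
    using continuous_on_compose2[OF contDh cont_g img] by (simp add: split_beta)
  \<comment> \<open>This takes t out of the argument of \<open>Dh\<close>, since continuity is known
    only for \<open>Dh\<close> in a fixed direction.\<close>
  have split_L: "Dh (\<gamma> z t) (L t w) = Dh (\<gamma> z t) w + (t - 1) * Dh (\<gamma> z t) (axis k (w $ k))"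
    if "z \<in> ?S" "t \<in> {0..1}" for z t w
  proof -
    have eq: "(t - 1) *\<^sub>R axis k (w $ k) = complex_of_real (t - 1) *s axis k (w $ k)"
      by (simp add: vec_eq_iff scaleR_conv_of_real[of _ "_::complex"] algebra_simps)
    show ?thesis
      unfolding L_def eq clinear_add[OF Dh(2)[OF g_in[OF that]]] clinear_scale[OF Dh(2)[OF g_in[OF that]]]
      by simp
  qed
  have cont_fx: "continuous_on (?S \<times> cbox 0 1) (\<lambda>(z, t). fx z t)"
  proof (rule continuous_on_blinfun_componentwise)
    fix w :: "complex^'n"
    have "continuous_on (?S \<times> {0..1}) (\<lambda>p. (fst p $ k - a) *
        (Dh (\<gamma> (fst p) (snd p)) w + complex_of_real (snd p - 1) * Dh (\<gamma> (fst p) (snd p)) (axis k (w $ k)))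
        + w $ k * h (\<gamma> (fst p) (snd p)))"
      by (intro continuous_intros cont_Dg cont_hg)
    then show "continuous_on (?S \<times> cbox 0 1) (\<lambda>p. blinfun_apply (case p of (z, t) \<Rightarrow> fx z t) w)"
      unfolding cbox_interval by (rule continuous_on_eq) (auto simp: fx split_L)
  qed
  define f where "f = (\<lambda>z t. (z $ k - a) * h (\<gamma> z t))"
  define H where "H = (\<lambda>z. integral (cbox 0 (1::real)) (f z))"
  have contt: "continuous_on {0..1} (\<lambda>t. fx z t)" "continuous_on {0..1} (\<lambda>t. f z t)" if "z \<in> ?S" for z
  proof -
    have p: "continuous_on {0..1::real} (Pair z)" "Pair z ` {0..1} \<subseteq> ?S \<times> {0..1}"
      using that by (auto intro: continuous_intros)
    show "continuous_on {0..1} (\<lambda>t. fx z t)"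
      using continuous_on_compose2[OF cont_fx p(1)] p(2) by simp
    show "continuous_on {0..1} (\<lambda>t. f z t)"
      unfolding f_def using continuous_on_compose2[OF cont_hg p] by (intro continuous_on_mult continuous_on_const) simp
  qed
  have dH: "(H has_derivative blinfun_apply (integral (cbox 0 1) (fx z))) (at z)" if z: "z \<in> ?S" for z
  proof -
    have "(H has_derivative blinfun_apply (integral (cbox 0 1) (fx z))) (at z within ?S)"
      unfolding H_def
    proof (rule leibniz_rule[OF _ _ cont_fx z convex_ball])
      fix z t assume zt: "z \<in> ?S" "t \<in> cbox 0 (1::real)"
      have "((\<lambda>z. (z $ k - a) * h (\<gamma> z t)) has_derivative
          (\<lambda>w. (z $ k - a) * Dh (\<gamma> z t) (L t w) + (w $ k - 0) * h (\<gamma> z t))) (at z within ?S)"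
        using zt g_in
        by (intro has_derivative_mult has_derivative_diff has_derivative_const has_derivative_compose[OF dg]
            Dh(1) bounded_linear_imp_has_derivative[OF bounded_linear_vec_nth]) auto
      then show "((\<lambda>z. f z t) has_derivative blinfun_apply (fx z t)) (at z within ?S)"
        unfolding f_def by (rule has_derivative_eq_rhs) (use zt in \<open>auto simp: fx fun_eq_iff\<close>)
    next
      fix z assume "z \<in> ?S" then show "f z integrable_on cbox 0 1"
        using contt(2) by (intro integrable_continuous) auto
    qed
    then show ?thesis unfolding at_within_open[OF z open_ball] .
  qed
  have app: "blinfun_apply (integral (cbox 0 1) (fx z)) w = integral {0..1} (\<lambda>t. fx z t w)" if "z \<in> ?S" for z w
  proof -
    have "fx z integrable_on cbox 0 1" using contt(1)[OF that] by (intro integrable_continuous) auto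
    from integral_linear[OF this blinfun.bounded_linear_left[of w]] show ?thesis by (simp add: o_def)
  qed
  have hol: "cholomorphic_on ?S H"
    unfolding cholomorphic_on_def
  proof
    fix z assume z: "z \<in> ?S"
    have "Vector_Spaces.linear (*s) (*) (blinfun_apply (integral (cbox 0 1) (fx z)))"
    proof (rule clinearI)
      fix c w
      have "blinfun_apply (fx z t) (c *s w) = c * blinfun_apply (fx z t) w" if "t \<in> {0..1}" for t
      proof -
        have "L t (c *s w) = c *s L t w" by (simp add: L_def vec_eq_iff axis_def algebra_simps)
        then show ?thesis using z that by (simp add: fx clinear_scale[OF Dh(2)[OF g_in[OF z that]]] algebra_simps)
      qed
      then have "integral {0..1} (\<lambda>t. blinfun_apply (fx z t) (c *s w)) = integral {0..1} (\<lambda>t. c * blinfun_apply (fx z t) w)"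
        by (intro Henstock_Kurzweil_Integration.integral_cong) auto
      then show "blinfun_apply (integral (cbox 0 1) (fx z)) (c *s w) = c * blinfun_apply (integral (cbox 0 1) (fx z)) w"
        by (simp only: app[OF z] integral_mult_right)
    qed (simp add: blinfun.add_right)
    then show "\<exists>D. (H has_derivative D) (at z) \<and> Vector_Spaces.linear (*s) (*) D" using dH[OF z] by blast
  qed
  have "frechet_derivative H (at z) (axis k 1) = h z" if z: "z \<in> ?S" for z
  proof -
    have "frechet_derivative H (at z) (axis k 1) = integral {0..1} (\<lambda>t. fx z t (axis k 1))"
      using frechet_derivative_at[OF dH[OF z]] app[OF z] by metis
    \<comment> \<open>In direction \<open>k\<close> the integrand is the t-derivative of t
      h(\<gamma> z t), so the integral is the value of h at the end point t = 1.\<close>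
    also have "((\<lambda>t. blinfun_apply (fx z t) (axis k 1)) has_integral (1 *\<^sub>R h (\<gamma> z 1) - 0 *\<^sub>R h (\<gamma> z 0))) {0..1}"
    proof (rule fundamental_theorem_of_calculus)
      fix t :: real assume t: "t \<in> {0..1}"
      have "((\<lambda>t. \<gamma> z t) has_derivative (\<lambda>s. s *\<^sub>R axis k (z $ k - a))) (at t within {0..1})"
        unfolding \<gamma>_def by (auto intro!: derivative_eq_intros)
      from has_derivative_compose[OF this Dh(1)[OF g_in[OF z t]]]
      have "((\<lambda>t. t *\<^sub>R h (\<gamma> z t)) has_derivative
          (\<lambda>s. t *\<^sub>R Dh (\<gamma> z t) (s *\<^sub>R axis k (z $ k - a)) + s *\<^sub>R h (\<gamma> z t))) (at t within {0..1})"
        by (intro has_derivative_scaleR has_derivative_ident)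
      then show "((\<lambda>t. t *\<^sub>R h (\<gamma> z t)) has_vector_derivative blinfun_apply (fx z t) (axis k 1)) (at t within {0..1})"
        unfolding has_vector_derivative_def
      proof (rule has_derivative_eq_rhs, intro ext)
        fix s :: real
        have 1: "s *\<^sub>R axis k (z $ k - a) = (complex_of_real s * (z $ k - a)) *s axis k 1"
          by (simp add: vec_eq_iff axis_def scaleR_conv_of_real[of _ "_::complex"])
        have 2: "L t (axis k 1) = complex_of_real t *s axis k 1"
          by (simp add: L_def vec_eq_iff axis_def scaleR_conv_of_real[of _ "_::complex"])
        show "t *\<^sub>R Dh (\<gamma> z t) (s *\<^sub>R axis k (z $ k - a)) + s *\<^sub>R h (\<gamma> z t) = s *\<^sub>R blinfun_apply (fx z t) (axis k 1)"
          unfolding fx[OF z t] 1 2 clinear_scale[OF Dh(2)[OF g_in[OF z t]]]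
          by (simp add: scaleR_conv_of_real[of _ "_::complex"] algebra_simps)
      qed
    qed simp
    then have "integral {0..1} (\<lambda>t. blinfun_apply (fx z t) (axis k 1)) = h (\<gamma> z 1)"
      by (simp add: integral_unique)
    also have "\<gamma> z 1 = z" by (simp add: \<gamma>_def)
    finally show ?thesis .
  qed
  then show thesis using that hol by blast
qed

text \<open>
  With a primitive \<open>H\<close> of \<open>h\<close> in the variable \<open>z\<^sub>k\<close>, replacing the coordinate \<open>z\<^sub>k\<close> by \<open>H\<close> turns
  \<open>h dz\<^sub>1 \<dots> dz\<^sub>n\<close> into \<open>dz\<^sub>1 \<dots> dz\<^sub>n\<close>.
\<close>

lemma holomorphic_straighten:
  fixes h :: "complex^'n::finite \<Rightarrow> complex"
  assumes h: "cholomorphic_on (ball z0 R) h"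
  obtains \<Phi> :: "complex^'n \<Rightarrow> complex^'n" where "Ck_on 1 (ball z0 R) \<Phi>"
    "\<And>(p::real^'n \<Rightarrow> complex^'n) x. p differentiable (at x) \<Longrightarrow> p x \<in> ball z0 R \<Longrightarrow>
      jac (\<lambda>x. \<Phi> (p x)) x = h (p x) * jac p x"
proof -
  \<comment> \<open>Any coordinate will do; the index type is nonempty.\<close>
  fix k :: 'n
  obtain H where H: "cholomorphic_on (ball z0 R) H"
    "\<And>z. z \<in> ball z0 R \<Longrightarrow> frechet_derivative H (at z) (axis k 1) = h z"
    using holomorphic_primitive[OF h] by blast
  define \<Phi> where "\<Phi> = (\<lambda>z::complex^'n. \<chi> i. if i = k then H z else z $ i)"
  have C: "Ck_on 1 (ball z0 R) \<Phi>"
  proof (rule Ck_on_vec[OF open_ball])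
    show "Ck_on 1 (ball z0 R) (\<lambda>z. \<Phi> z $ i)" for i
      using cholomorphic_on_imp_C1[OF open_ball H(1)]
        Ck_on_linear[OF bounded_linear_vec_nth[of i] open_ball[of z0 R], of 1]
      unfolding \<Phi>_def by (cases "i = k") (simp_all del: One_nat_def Ck_on.simps)
  qed
  have "jac (\<lambda>x. \<Phi> (p x)) x = h (p x) * jac p x"
    if p: "p differentiable (at x)" "p x \<in> ball z0 R" for p :: "real^'n \<Rightarrow> complex^'n" and x
  proof -
    let ?D = "frechet_derivative p (at x)" and ?DH = "frechet_derivative H (at (p x))"
    have dp: "(p has_derivative ?D) (at x)" using p(1) by (simp add: frechet_derivative_works)
    note dH = cholomorphic_onD[OF H(1) p(2)]
    have "((\<lambda>x. \<Phi> (p x)) has_derivative (\<lambda>v. \<chi> i. if i = k then ?DH (?D v) else ?D v $ i)) (at x)"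
    proof (subst has_derivative_componentwise_within, intro ballI)
      fix b :: "complex^'n" assume "b \<in> Basis"
      then obtain i c where b: "b = axis i c" by (auto simp: Basis_vec_def)
      have 1: "((\<lambda>x. H (p x)) has_derivative (\<lambda>v. ?DH (?D v))) (at x)"
        by (rule has_derivative_compose[OF dp dH(1)])
      have 2: "((\<lambda>x. p x $ i) has_derivative (\<lambda>v. ?D v $ i)) (at x)"
        by (rule bounded_linear.has_derivative[OF bounded_linear_vec_nth dp])
      show "((\<lambda>x. \<Phi> (p x) \<bullet> b) has_derivative (\<lambda>v. (\<chi> i. if i = k then ?DH (?D v) else ?D v $ i) \<bullet> b)) (at x)"
        using bounded_linear.has_derivative[OF bounded_linear_inner_left 1, of c]
          bounded_linear.has_derivative[OF bounded_linear_inner_left 2, of c]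
        by (cases "i = k") (simp_all add: b inner_axis \<Phi>_def)
    qed
    from frechet_derivative_at[OF this, symmetric]
    have "jac (\<lambda>x. \<Phi> (p x)) x = det (\<chi> i j. if i = k then ?DH (?D (axis j 1)) else ?D (axis j 1) $ i)"
      by (simp only: jac_def vec_lambda_beta if_distrib[of "\<lambda>y. y $ _"])
    \<comment> \<open>Row \<open>k\<close>, the differential of \<open>H\<close>, is by complex
      linearity the combination of the rows dz_l with the partial derivatives of \<open>H\<close> as
      coefficients. Cramer's lemma keeps only the coefficient of row \<open>k\<close>, which is
      \<open>h\<close>.\<close>
    also have "\<dots> = det (\<chi> i. if i = k then \<Sum>l\<in>UNIV. (\<chi> l. ?DH (axis l 1)) $ l *s row l (\<chi> i j. ?D (axis j 1) $ i)
        else row i (\<chi> i j. ?D (axis j 1) $ i))"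
    proof (rule arg_cong[of _ _ det], simp add: vec_eq_iff row_def, intro allI impI)
      fix j
      let ?w = "?D (axis j 1)"
      have sum: "?DH (\<Sum>l\<in>I. w l *s axis l 1) = (\<Sum>l\<in>I. w l * ?DH (axis l 1))" for I and w :: "'n \<Rightarrow> complex"
      proof (induction I rule: infinite_finite_induct)
        case (insert l I)
        then show ?case by (simp add: clinear_add[OF dH(2)] clinear_scale[OF dH(2)])
      qed (use clinear_scale[OF dH(2), of 0 0] in simp_all)
      have "?w = (\<Sum>l\<in>UNIV. ?w $ l *s axis l 1)"
        by (simp add: vec_eq_iff axis_def if_distrib sum.delta cong: if_cong)
      then have "?DH ?w = ?DH (\<Sum>l\<in>UNIV. ?w $ l *s axis l 1)" by (rule arg_cong)
      then show "?DH ?w = (\<Sum>l\<in>UNIV. ?DH (axis l 1) * ?w $ l)" unfolding sum by (simp add: mult.commute)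
    qed
    also have "\<dots> = ?DH (axis k 1) * det (\<chi> i j. ?D (axis j 1) $ i)"
      by (subst cramer_lemma_transpose) simp
    finally show ?thesis using H(2)[OF p(2)] by (simp add: jac_def)
  qed
  then show thesis using that C by blast
qed

text \<open>Straightening turns both integrands into plain Jacobians of the maps composed with
  \<open>\<Phi>\<close>, which still agree off \<open>K\<close>.\<close>

lemma integral_holomorphic_form_diff:
  fixes h :: "complex^'n::finite \<Rightarrow> complex" and P Q :: "real^'n \<Rightarrow> complex^'n"
  assumes h: "cholomorphic_on (ball z0 R) h"
    and V: "open V" and P: "Ck_on 1 V P" "P ` V \<subseteq> ball z0 R" and Q: "Ck_on 1 V Q" "Q ` V \<subseteq> ball z0 R"
    and K: "compact K" "K \<subseteq> V" "\<And>x. x \<in> V - K \<Longrightarrow> P x = Q x"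
  shows "(LINT x:V|lborel. (h (P x) * jac P x - h (Q x) * jac Q x)) = 0"
proof -
  obtain \<Phi> :: "complex^'n \<Rightarrow> complex^'n" where \<Phi>: "Ck_on 1 (ball z0 R) \<Phi>"
    "\<And>(p::real^'n \<Rightarrow> complex^'n) x. p differentiable (at x) \<Longrightarrow> p x \<in> ball z0 R \<Longrightarrow>
      jac (\<lambda>x. \<Phi> (p x)) x = h (p x) * jac p x"
    using holomorphic_straighten[OF h] by blast
  have eq: "jac (\<lambda>x. \<Phi> (p x)) x = h (p x) * jac p x"
    if "Ck_on 1 V p" "p ` V \<subseteq> ball z0 R" "x \<in> V" for p x
    using that by (intro \<Phi>(2)) (auto intro: Ck_on_differentiable)
  have "(LINT x:V|lborel. (jac (\<lambda>x. \<Phi> (P x)) x - jac (\<lambda>x. \<Phi> (Q x)) x)) = 0"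
    using K by (intro integral_jac_diff V Ck_on_compose[OF V open_ball _ \<Phi>(1)] P Q) auto
  moreover have "(LINT x:V|lborel. (jac (\<lambda>x. \<Phi> (P x)) x - jac (\<lambda>x. \<Phi> (Q x)) x)) =
      (LINT x:V|lborel. (h (P x) * jac P x - h (Q x) * jac Q x))"
    unfolding set_lebesgue_integral_def using eq[OF P] eq[OF Q]
    by (intro Bochner_Integration.integral_cong) (auto split: split_indicator)
  ultimately show ?thesis by simp
qed

section \<open>Charts and parametrizations\<close>

text \<open>Order-one counterpart of \<open>smooth_map\<close>: interpolation with
  \<open>bump\<close> leaves the smooth class.\<close>

definition C1_map :: "('m::topological_space, 'n::finite) chart set \<Rightarrow> (real^'n) set \<Rightarrow> (real^'n \<Rightarrow> 'm) \<Rightarrow> bool" where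
  "C1_map A V \<tau> \<longleftrightarrow> continuous_on V \<tau> \<and> (\<forall>C\<in>A. Ck_on 1 (V \<inter> \<tau> -` fst C) (snd C \<circ> \<tau>))"

lemma smooth_map_iff: "smooth_map A V \<tau> \<longleftrightarrow>
    continuous_on V \<tau> \<and> (\<forall>C\<in>A. \<forall>k. Ck_on k (V \<inter> \<tau> -` fst C) (snd C \<circ> \<tau>))"
  by (auto simp: smooth_map_def smooth_on_iff_Ck_on split_beta)

lemma smooth_map_imp_C1: "smooth_map A V \<tau> \<Longrightarrow> C1_map A V \<tau>"
  by (simp add: smooth_map_iff C1_map_def del: One_nat_def)

locale catlas =
  fixes A :: "('m::{t2_space,second_countable_topology}, 'n::finite) chart set"
  assumes atlas: "complex_atlas A"
begin

lemma chart_homeo: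
  assumes "C \<in> A"
  shows "open (fst C)" "open (snd C ` fst C)" "inj_on (snd C) (fst C)" "continuous_on (fst C) (snd C)"
    "continuous_on (snd C ` fst C) (chart_inv C)"
proof -
  obtain D c where C: "C = (D, c)" by force
  obtain g where o: "open D" "open (c ` D)" and g: "homeomorphism D (c ` D) c g"
    using atlas assms C unfolding complex_atlas_def by fastforce
  show "open (fst C)" "open (snd C ` fst C)" using o C by auto
  have inj: "inj_on c D" using g by (metis homeomorphism_apply1 inj_onI)
  then show "inj_on (snd C) (fst C)" using C by simp
  show "continuous_on (fst C) (snd C)" using g C by (simp add: homeomorphism_def)
  have "g (c p) = chart_inv C (c p)" if "p \<in> D" for p
    using inj C that by (simp add: chart_inv_def homeomorphism_apply1[OF g])
  then have "g z = chart_inv C z" if "z \<in> c ` D" for z using that by blast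
  then show "continuous_on (snd C ` fst C) (chart_inv C)"
    using g C continuous_on_cong[of "c ` D" "c ` D" g "chart_inv C"] by (auto simp: homeomorphism_def)
qed

lemma chart_inv_f: "C \<in> A \<Longrightarrow> p \<in> fst C \<Longrightarrow> chart_inv C (snd C p) = p"
  using chart_homeo(3) by (simp add: chart_inv_def)

lemma f_chart_inv:
  assumes "C \<in> A" "z \<in> snd C ` fst C"
  shows "snd C (chart_inv C z) = z" "chart_inv C z \<in> fst C"
  using assms by (auto simp: chart_inv_f)

lemma open_chart_image:
  assumes "C \<in> A" "open W"
  shows "open (snd C ` (fst C \<inter> W))"
proof -
  have "snd C ` (fst C \<inter> W) = snd C ` fst C \<inter> chart_inv C -` W"
    using assms(1) by (force simp: chart_inv_f f_chart_inv)
  moreover have "open (chart_inv C -` W \<inter> snd C ` fst C)"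
    using continuous_on_open_vimage[OF chart_homeo(2)[OF assms(1)], THEN iffD1, OF chart_homeo(5)[OF assms(1)]] assms(2) by blast
  ultimately show ?thesis by (simp add: Int_commute)
qed

lemma open_chart_preimage:
  assumes "C \<in> A" "open Z"
  shows "open (fst C \<inter> snd C -` Z)"
  using continuous_on_open_vimage[OF chart_homeo(1)[OF assms(1)], THEN iffD1, OF chart_homeo(4)[OF assms(1)]] assms(2)
  by (simp add: Int_commute)

lemma chart_cover: obtains C where "C \<in> A" "p \<in> fst C"
proof -
  have "p \<in> (\<Union>(D, c)\<in>A. D)" using atlas by (simp add: complex_atlas_def)
  then show thesis using that by auto
qed

lemma chart_at: "chart_at A p \<in> A" "p \<in> fst (chart_at A p)"
proof -
  have "\<exists>C. C \<in> A \<and> p \<in> fst C" using chart_cover by blast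
  from someI_ex[OF this] show "chart_at A p \<in> A" "p \<in> fst (chart_at A p)"
    unfolding chart_at_def by auto
qed

lemma transition_C1:
  assumes "C \<in> A" "C' \<in> A"
  shows "Ck_on 1 (snd C ` (fst C \<inter> fst C')) (snd C' \<circ> chart_inv C)"
proof -
  let ?S = "snd C ` (fst C \<inter> fst C')" and ?T = "snd C' \<circ> chart_inv C"
  have S: "open ?S" using open_chart_image[OF assms(1)] chart_homeo(1)[OF assms(2)] by blast
  have hol: "cholomorphic_on ?S (\<lambda>z. ?T z $ i)" for i
    using atlas assms unfolding complex_atlas_def by (auto simp: o_def)
  have C1: "Ck_on 1 ?S (\<lambda>z. ?T z $ i)" for i by (rule cholomorphic_on_imp_C1[OF S hol])
  show "Ck_on 1 ?S ?T" by (rule Ck_on_vec[OF S C1])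
qed

lemma C1_map_preimage_open:
  "C1_map A V \<tau> \<Longrightarrow> open V \<Longrightarrow> open X \<Longrightarrow> open (V \<inter> \<tau> -` X)"
  by (simp add: C1_map_def continuous_open_preimage)

lemma C1_map_subset: "C1_map A V \<tau> \<Longrightarrow> W \<subseteq> V \<Longrightarrow> C1_map A W \<tau>"
  unfolding C1_map_def by (meson Ck_on_subset Int_mono continuous_on_subset order_refl)

text \<open>One chart per point suffices, since transition maps are holomorphic and hence
  C^1.\<close>

lemma C1_map_localI:
  assumes "open V"
    and loc: "\<And>x. x \<in> V \<Longrightarrow> \<exists>T C. open T \<and> x \<in> T \<and> C \<in> A \<and> \<tau> ` T \<subseteq> fst C \<and> Ck_on 1 T (snd C \<circ> \<tau>)"
  shows "C1_map A V \<tau>"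
proof -
  have cont: "continuous_on T \<tau>" if "C \<in> A" "\<tau> ` T \<subseteq> fst C" "Ck_on 1 T (snd C \<circ> \<tau>)" for T C
  proof -
    have "continuous_on T (\<lambda>x. chart_inv C ((snd C \<circ> \<tau>) x))"
      using that Ck_on_imp_continuous_on[OF that(3)]
      by (intro continuous_on_compose2[OF chart_homeo(5)[OF that(1)]]) auto
    moreover have "chart_inv C ((snd C \<circ> \<tau>) x) = \<tau> x" if "x \<in> T" for x
      using that \<open>C \<in> A\<close> \<open>\<tau> ` T \<subseteq> fst C\<close> by (auto simp: chart_inv_f)
    ultimately show ?thesis using continuous_on_cong[of T T] by force
  qed
  have contV: "continuous_on V \<tau>"
  proof (rule continuous_at_imp_continuous_on, rule ballI)
    fix x assume "x \<in> V"
    from loc[OF this] obtain T C where "open T" "x \<in> T" "continuous_on T \<tau>" using cont by blast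
    then show "isCont \<tau> x" by (simp add: continuous_on_eq_continuous_at)
  qed
  moreover have "Ck_on 1 (V \<inter> \<tau> -` fst C') (snd C' \<circ> \<tau>)" if C': "C' \<in> A" for C'
  proof (rule Ck_on_local)
    fix x assume x: "x \<in> V \<inter> \<tau> -` fst C'"
    with loc obtain T C where T: "open T" "x \<in> T" "C \<in> A" "\<tau> ` T \<subseteq> fst C" "Ck_on 1 T (snd C \<circ> \<tau>)" by blast
    define T' where "T' = T \<inter> \<tau> -` fst C'"
    have T': "open T'" "x \<in> T'"
      unfolding T'_def using x T cont[OF T(3-5)] chart_homeo(1)[OF C'] by (auto intro: continuous_open_preimage)
    have "Ck_on 1 T' (\<lambda>x. (snd C' \<circ> chart_inv C) ((snd C \<circ> \<tau>) x))"
    proof (rule Ck_on_compose[OF T'(1) _ _ transition_C1[OF T(3) C']])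
      show "open (snd C ` (fst C \<inter> fst C'))" using open_chart_image[OF T(3)] chart_homeo(1)[OF C'] by blast
      show "Ck_on 1 T' (snd C \<circ> \<tau>)" using T(5) Ck_on_subset unfolding T'_def by blast
      show "(snd C \<circ> \<tau>) ` T' \<subseteq> snd C ` (fst C \<inter> fst C')" using T(4) by (auto simp: T'_def)
    qed
    then have "Ck_on 1 T' (snd C' \<circ> \<tau>)"
      by (rule Ck_on_cong[OF T'(1), rotated]) (use T in \<open>auto simp: T'_def chart_inv_f image_subset_iff\<close>)
    then show "\<exists>T. open T \<and> x \<in> T \<and> Ck_on 1 T (snd C' \<circ> \<tau>)" using T' by blast
  qed
  ultimately show ?thesis by (simp add: C1_map_def del: One_nat_def)
qed

lemma C1_map_has_derivative:
  assumes "C1_map A V \<tau>" "x \<in> V" "C \<in> A" "\<tau> x \<in> fst C"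
  shows "((snd C \<circ> \<tau>) has_derivative frechet_derivative (snd C \<circ> \<tau>) (at x)) (at x)"
proof -
  have "Ck_on 1 (V \<inter> \<tau> -` fst C) (snd C \<circ> \<tau>)" using assms by (simp add: C1_map_def del: One_nat_def)
  from Ck_on_differentiable[OF this, of x] show ?thesis using assms by (simp add: frechet_derivative_works)
qed

text \<open>The chain rule for the transition map; it makes expressions in the chosen chart
  \<open>chart_at\<close> comparable with those in any other chart.\<close>

lemma coord_change:
  assumes "open V" "C1_map A V \<tau>" "x \<in> V" "C \<in> A" "C' \<in> A" "\<tau> x \<in> fst C \<inter> fst C'"
  shows "frechet_derivative (snd C' \<circ> \<tau>) (at x) v
    = transition_diff C C' (\<tau> x) (frechet_derivative (snd C \<circ> \<tau>) (at x) v)"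
proof -
  let ?S = "snd C ` (fst C \<inter> fst C')"
  let ?N = "V \<inter> \<tau> -` (fst C \<inter> fst C')"
  have N: "open ?N" "x \<in> ?N"
    by (intro C1_map_preimage_open assms open_Int chart_homeo(1)) (use assms(3,6) in auto)
  have "(snd C \<circ> \<tau>) x \<in> ?S" using assms(6) by auto
  then have dT: "((snd C' \<circ> chart_inv C) has_derivative frechet_derivative (snd C' \<circ> chart_inv C) (at ((snd C \<circ> \<tau>) x))) (at ((snd C \<circ> \<tau>) x))"
    using Ck_on_differentiable[OF transition_C1[OF assms(4,5)]] by (simp add: frechet_derivative_works)
  have "((snd C \<circ> \<tau>) has_derivative frechet_derivative (snd C \<circ> \<tau>) (at x)) (at x)"
    using assms by (intro C1_map_has_derivative) auto
  from has_derivative_compose[OF this dT]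
  have "((\<lambda>x. (snd C' \<circ> chart_inv C) ((snd C \<circ> \<tau>) x)) has_derivative
      (\<lambda>v. frechet_derivative (snd C' \<circ> chart_inv C) (at ((snd C \<circ> \<tau>) x)) (frechet_derivative (snd C \<circ> \<tau>) (at x) v))) (at x)" .
  then have "((snd C' \<circ> \<tau>) has_derivative
      (\<lambda>v. frechet_derivative (snd C' \<circ> chart_inv C) (at ((snd C \<circ> \<tau>) x)) (frechet_derivative (snd C \<circ> \<tau>) (at x) v))) (at x)"
    by (rule has_derivative_transform_within_open[OF _ N]) (use assms in \<open>auto simp: chart_inv_f\<close>)
  from frechet_derivative_at[OF this, symmetric] show ?thesis by (simp add: transition_diff_def)
qed

lemma smooth_map_cong:
  assumes "open V" "\<And>x. x \<in> V \<Longrightarrow> \<tau> x = \<tau>' x" "smooth_map A V \<tau>"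
  shows "smooth_map A V \<tau>'"
  unfolding smooth_map_iff
proof (intro conjI ballI allI)
  show "continuous_on V \<tau>'" using assms continuous_on_cong[of V V \<tau> \<tau>'] by (auto simp: smooth_map_iff)
  fix C k assume C: "C \<in> A"
  have eq: "V \<inter> \<tau>' -` X = V \<inter> \<tau> -` X" for X using assms(2) by auto
  have o: "open (V \<inter> \<tau> -` fst C)"
    using assms(1,3) chart_homeo(1)[OF C] by (auto simp: smooth_map_iff intro: continuous_open_preimage)
  have "Ck_on k (V \<inter> \<tau> -` fst C) (snd C \<circ> \<tau>)" using assms(3) C by (simp add: smooth_map_iff)
  then show "Ck_on k (V \<inter> \<tau>' -` fst C) (snd C \<circ> \<tau>')"
    unfolding eq by (rule Ck_on_cong[OF o, rotated]) (use assms(2) in auto)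
qed

text \<open>The inverse of a parametrization is given only as a homeomorphism.
  \<open>Ck_on_left_factor\<close> upgrades the continuous lift \<open>g\<close> to a smooth one
  near each point, because \<open>\<tau>\<close> is an immersion and
  \<open>\<tau> (g x) = \<xi> x\<close> is smooth. This yields smooth parameter changes and also
  serves for compositions with diffeomorphisms of \<open>L\<close>.\<close>

lemma param_lift:
  assumes \<tau>: "local_param A L W \<tau>" and V: "open V" and \<xi>: "smooth_map A V \<xi>" "\<xi> ` V \<subseteq> L"
  defines "N \<equiv> V \<inter> \<xi> -` (\<tau> ` W)" and "g \<equiv> inv_into W \<tau> \<circ> \<xi>"
  shows "open N" "continuous_on N g" "g ` N \<subseteq> W" "\<And>x. x \<in> N \<Longrightarrow> \<tau> (g x) = \<xi> x" "\<And>k. Ck_on k N g"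
proof -
  obtain r where r: "homeomorphism W (\<tau> ` W) \<tau> r" using \<tau> by (auto simp: local_param_def)
  have W: "open W" "smooth_map A W \<tau>" and im: "\<And>x. x \<in> W \<Longrightarrow> inj (coord_diff A \<tau> x)"
    using \<tau> by (auto simp: local_param_def smooth_immersion_def)
  have inj: "inj_on \<tau> W" by (rule inj_on_inverseI) (rule homeomorphism_apply1[OF r])
  have "openin (top_of_set L) (\<tau> ` W)" using \<tau> by (simp add: local_param_def)
  then obtain X where X: "open X" "\<tau> ` W = L \<inter> X" unfolding openin_open by blast
  \<comment> \<open>The image of \<open>\<tau>\<close> is only relatively open in \<open>L\<close>;
    openness in the parameter space holds because \<open>\<xi>\<close> has values in
    \<open>L\<close>.\<close>
  have "N = V \<inter> \<xi> -` X" using X(2) \<xi>(2) by (auto simp: N_def)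
  then show N: "open N" using X(1) V \<xi>(1) by (simp add: smooth_map_iff continuous_open_preimage)
  show gN: "g ` N \<subseteq> W" unfolding g_def N_def using inj by (auto simp: inv_into_into)
  show tg: "\<tau> (g x) = \<xi> x" if "x \<in> N" for x using that by (auto simp: g_def N_def f_inv_into_f)
  have rg: "r (\<xi> x) = g x" if "x \<in> N" for x
    using tg[OF that] gN that homeomorphism_apply1[OF r] by (metis image_subset_iff)
  have contx: "continuous_on N \<xi>" using \<xi>(1) continuous_on_subset by (force simp: smooth_map_iff N_def)
  have "continuous_on N (\<lambda>x. r (\<xi> x))"
    using r by (intro continuous_on_compose2[OF _ contx]) (auto simp: homeomorphism_def N_def)
  then show cg: "continuous_on N g" using rg continuous_on_cong[of N N] by force
  show "Ck_on k N g" for k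
  proof (rule Ck_on_local)
    fix x0 assume x0: "x0 \<in> N"
    define C where "C = chart_at A (\<tau> (g x0))"
    have C: "C \<in> A" "\<tau> (g x0) \<in> fst C" using chart_at by (auto simp: C_def)
    define W' where "W' = W \<inter> \<tau> -` fst C"
    define N' where "N' = N \<inter> \<xi> -` fst C"
    have W': "open W'" unfolding W'_def using W chart_homeo(1)[OF C(1)] by (auto simp: smooth_map_iff intro: continuous_open_preimage)
    have N': "open N'" unfolding N'_def using N contx chart_homeo(1)[OF C(1)] by (auto intro: continuous_open_preimage)
    have s: "Ck_on j W' (snd C \<circ> \<tau>)" for j using W(2) C(1) by (simp add: smooth_map_iff W'_def)
    have gN': "g ` N' \<subseteq> W'" using gN tg by (force simp: N'_def W'_def)
    have xN': "x0 \<in> N'" using x0 C(2) tg by (auto simp: N'_def)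
    have "Ck_on j (V \<inter> \<xi> -` fst C) (snd C \<circ> \<xi>)" for j using \<xi>(1) C(1) by (simp add: smooth_map_iff)
    then have "Ck_on j N' (snd C \<circ> \<xi>)" for j by (rule Ck_on_subset) (auto simp: N'_def N_def)
    then have sg: "Ck_on j N' (\<lambda>x. (snd C \<circ> \<tau>) (g x))" for j
      by (rule Ck_on_cong[OF N', rotated]) (auto simp: N'_def tg)
    have i: "inj (frechet_derivative (snd C \<circ> \<tau>) (at (g x0)))"
      using im[of "g x0"] gN x0 by (auto simp: coord_diff_def C_def)
    have cg': "continuous_on N' g" by (rule continuous_on_subset[OF cg]) (simp add: N'_def)
    show "\<exists>T. open T \<and> x0 \<in> T \<and> Ck_on k T g"
      by (rule Ck_on_left_factor[OF W' N' s cg' gN' xN' i sg]) blast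
  qed
qed

end

section \<open>Pullback of the holomorphic volume form\<close>

lemma jac_compose:
  fixes p :: "real^'n::finite \<Rightarrow> complex^'n" and g :: "real^'n \<Rightarrow> real^'n"
  assumes p: "p differentiable (at (g x))" and g: "(g has_derivative T) (at x)"
  shows "jac (\<lambda>x. p (g x)) x = jac p (g x) * of_real (det (matrix T))"
proof -
  let ?D = "frechet_derivative p (at (g x))"
  have dp: "(p has_derivative ?D) (at (g x))" using p by (simp add: frechet_derivative_works)
  have lin: "linear ?D" using has_derivative_linear[OF dp] .
  have D: "frechet_derivative (\<lambda>x. p (g x)) (at x) = (\<lambda>v. ?D (T v))"
    using frechet_derivative_at[OF has_derivative_compose[OF g dp], symmetric] .
  have "(\<chi> i j. ?D (T (axis j 1)) $ i) = (\<chi> i j. ?D (axis j 1) $ i) ** (\<chi> i j. of_real (matrix T $ i $ j))"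
  proof -
    have "?D (T (axis j 1)) $ i = (\<Sum>k\<in>UNIV. ?D (axis k 1) $ i * of_real (T (axis j 1) $ k))" for i j
    proof -
      have "T (axis j 1) = (\<Sum>k\<in>UNIV. T (axis j 1) $ k *\<^sub>R axis k 1)"
        by (simp add: vec_eq_iff axis_def if_distrib sum.delta cong: if_cong)
      then have "?D (T (axis j 1)) = ?D (\<Sum>k\<in>UNIV. T (axis j 1) $ k *\<^sub>R axis k 1)" by (rule arg_cong)
      also have "\<dots> = (\<Sum>k\<in>UNIV. T (axis j 1) $ k *\<^sub>R ?D (axis k 1))"
        by (simp only: linear_sum[OF lin] linear_scale[OF lin])
      finally have "?D (T (axis j 1)) $ i = (\<Sum>k\<in>UNIV. T (axis j 1) $ k *\<^sub>R ?D (axis k 1)) $ i" by (rule arg_cong)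
      then show ?thesis by (simp add: scaleR_conv_of_real[of _ "_::complex"] mult.commute)
    qed
    then show ?thesis by (simp add: matrix_matrix_mult_def matrix_def)
  qed
  then show ?thesis unfolding jac_def D by (simp only: det_mul det_of_real)
qed

text \<open>The coefficient of the pullback of phi by \<open>\<tau>\<close> with respect to dx_1 ...
  dx_n. It stays complex because phi need not be real along modified maps.\<close>

definition pull ::
  "('m, 'n::finite) chart set \<Rightarrow> (('m, 'n) chart \<Rightarrow> 'm \<Rightarrow> ('n \<Rightarrow> complex^'n) \<Rightarrow> complex) \<Rightarrow>
   (real^'n \<Rightarrow> 'm) \<Rightarrow> real^'n \<Rightarrow> complex" where
  "pull A \<phi> \<tau> x = pullback_n A \<phi> \<tau> x (\<lambda>i. axis i 1)"

lemma volume_density_pull: "volume_density A \<phi> \<tau> x = Re (pull A \<phi> \<tau> x)"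
  by (simp add: volume_density_def pull_def)

locale cvolume = catlas A for A :: "('m::{t2_space,second_countable_topology}, 'n::finite) chart set" +
  fixes \<phi> :: "('m, 'n) chart \<Rightarrow> 'm \<Rightarrow> ('n \<Rightarrow> complex^'n) \<Rightarrow> complex"
  assumes vol: "holomorphic_volume_form A \<phi>"
begin

text \<open>In the chart \<open>C\<close>, phi is \<open>coef C\<close> dz_1 ... dz_n.\<close>

definition coef :: "('m, 'n) chart \<Rightarrow> complex^'n \<Rightarrow> complex" where
  "coef C z = \<phi> C (chart_inv C z) (\<lambda>i. axis i 1)"

lemma coef_holomorphic: "C \<in> A \<Longrightarrow> cholomorphic_on (snd C ` fst C) (coef C)"
  using vol by (simp add: holomorphic_volume_form_def coef_def[abs_def])

lemma form_eq_det:
  assumes "C \<in> A" "p \<in> fst C"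
  shows "\<phi> C p v = coef C (snd C p) * det (\<chi> i. v i)"
proof -
  have lin: "Vector_Spaces.linear (*s) (*) (\<lambda>u. \<phi> C p (v(i := u)))" and alt: "i \<noteq> j \<Longrightarrow> v i = v j \<Longrightarrow> \<phi> C p v = 0" for v i j
    using vol assms unfolding holomorphic_volume_form_def by blast+
  have "\<phi> C p v = \<phi> C p (\<lambda>i. axis i 1) * det (\<chi> i. v i)"
    by (rule multilinear_alternating_eq_det) (use clinear_add[OF lin] clinear_scale[OF lin] alt in blast)+
  then show ?thesis using assms by (simp add: coef_def chart_inv_f)
qed

lemma coef_nonzero:
  assumes "C \<in> A" "p \<in> fst C" shows "coef C (snd C p) \<noteq> 0"
proof -
  obtain v where "\<phi> C p v \<noteq> 0" using vol assms unfolding holomorphic_volume_form_def by blast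
  then show ?thesis using form_eq_det[OF assms] by auto
qed

text \<open>Coordinate invariance of phi removes the dependence on \<open>chart_at\<close>.\<close>

lemma pull_chart:
  assumes "open V" "C1_map A V \<tau>" "x \<in> V" "C \<in> A" "\<tau> x \<in> fst C"
  shows "pull A \<phi> \<tau> x = coef C (snd C (\<tau> x)) * jac (snd C \<circ> \<tau>) x"
proof -
  let ?C = "chart_at A (\<tau> x)"
  have c: "\<phi> C' p (\<lambda>i. transition_diff C C' p (v i)) = \<phi> C p v" if "C \<in> A" "C' \<in> A" "p \<in> fst C \<inter> fst C'" for C C' p v
  proof -
    from vol have "\<forall>C\<in>A. \<forall>C'\<in>A. \<forall>p\<in>fst C \<inter> fst C'. \<forall>v.
        \<phi> C' p (\<lambda>i. transition_diff C C' p (v i)) = \<phi> C p v"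
      unfolding holomorphic_volume_form_def by (rule conjunct1)
    from bspec[OF bspec[OF bspec[OF this that(1)] that(2)] that(3)] show ?thesis by (rule spec)
  qed
  have "pull A \<phi> \<tau> x = \<phi> ?C (\<tau> x) (\<lambda>i. frechet_derivative (snd ?C \<circ> \<tau>) (at x) (axis i 1))"
    by (simp add: pull_def pullback_n_def coord_diff_def)
  also have "\<dots> = \<phi> ?C (\<tau> x) (\<lambda>i. transition_diff C ?C (\<tau> x) (frechet_derivative (snd C \<circ> \<tau>) (at x) (axis i 1)))"
    using coord_change[OF assms(1-4) chart_at(1)] chart_at(2)[of "\<tau> x"] assms(5) by simp
  also have "\<dots> = \<phi> C (\<tau> x) (\<lambda>i. frechet_derivative (snd C \<circ> \<tau>) (at x) (axis i 1))"
    by (rule c) (use assms chart_at in auto)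
  also have "\<dots> = coef C (snd C (\<tau> x)) * det (\<chi> i. frechet_derivative (snd C \<circ> \<tau>) (at x) (axis i 1))"
    using form_eq_det assms by simp
  \<comment> \<open>The tangent vectors are rows here and columns in \<open>jac\<close>.\<close>
  also have "det (\<chi> i. frechet_derivative (snd C \<circ> \<tau>) (at x) (axis i 1)) = jac (snd C \<circ> \<tau>) x"
    unfolding jac_def by (subst det_transpose[symmetric]) (simp add: transpose_def)
  finally show ?thesis .
qed

text \<open>A change of parameters contributes a real factor to the complex coefficient. Realness is
  therefore intrinsic, while the sign depends on the orientation.\<close>

lemma pull_compose:
  assumes W: "C1_map A W \<tau>" "g x \<in> W" and g: "(g has_derivative T) (at x)"
    and N: "open N" "x \<in> N" "\<And>z. z \<in> N \<Longrightarrow> \<tau>' z = \<tau> (g z)"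
  shows "pull A \<phi> \<tau>' x = pull A \<phi> \<tau> (g x) * of_real (det (matrix T))"
proof -
  let ?C = "chart_at A (\<tau> (g x))"
  have tx: "\<tau>' x = \<tau> (g x)" using N by auto
  have p: "pull A \<phi> \<tau> y = coef (chart_at A (\<tau> y)) (snd (chart_at A (\<tau> y)) (\<tau> y)) * jac (snd (chart_at A (\<tau> y)) \<circ> \<tau>) y" for \<tau> y
  proof -
    have "pull A \<phi> \<tau> y = coef (chart_at A (\<tau> y)) (snd (chart_at A (\<tau> y)) (\<tau> y)) *
        det (\<chi> i. frechet_derivative (snd (chart_at A (\<tau> y)) \<circ> \<tau>) (at y) (axis i 1))"
      unfolding pull_def pullback_n_def coord_diff_def by (rule form_eq_det) (rule chart_at)+
    then show ?thesis unfolding jac_def by (subst det_transpose[symmetric]) (simp add: transpose_def)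
  qed
  have "jac (snd ?C \<circ> \<tau>') x = jac (\<lambda>z. (snd ?C \<circ> \<tau>) (g z)) x"
    by (rule jac_cong_open[OF N(1,2)]) (simp add: N(3))
  also have "\<dots> = jac (snd ?C \<circ> \<tau>) (g x) * of_real (det (matrix T))"
    using jac_compose[OF differentiableI[OF C1_map_has_derivative[OF W chart_at]] g] .
  finally show ?thesis by (simp add: p tx)
qed

lemma continuous_on_pull:
  assumes "open V" "C1_map A V \<tau>"
  shows "continuous_on V (pull A \<phi> \<tau>)"
proof (rule continuous_at_imp_continuous_on, rule ballI)
  fix x assume x: "x \<in> V"
  define C where "C = chart_at A (\<tau> x)"
  have C: "C \<in> A" "\<tau> x \<in> fst C" using chart_at by (auto simp: C_def)
  define N where "N = V \<inter> \<tau> -` fst C"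
  have N: "open N" "x \<in> N" using C1_map_preimage_open[OF assms(2,1) chart_homeo(1)[OF C(1)]] x C by (auto simp: N_def)
  have k: "Ck_on 1 N (snd C \<circ> \<tau>)" using assms(2) C(1) by (simp add: C1_map_def N_def del: One_nat_def)
  have "continuous_on N (\<lambda>y. coef C ((snd C \<circ> \<tau>) y))"
    by (rule continuous_on_compose2[OF cholomorphic_on_continuous[OF coef_holomorphic[OF C(1)]] Ck_on_imp_continuous_on[OF k]])
      (auto simp: N_def)
  then have "continuous_on N (\<lambda>y. coef C ((snd C \<circ> \<tau>) y) * jac (snd C \<circ> \<tau>) y)"
    by (intro continuous_on_mult continuous_on_jac N k)
  then have "continuous_on N (pull A \<phi> \<tau>)"
    by (rule continuous_on_eq) (use pull_chart[OF assms _ C(1)] in \<open>auto simp: N_def\<close>)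
  then show "isCont (pull A \<phi> \<tau>) x" using N by (simp add: continuous_on_eq_continuous_at)
qed

text \<open>In the chart, f phi becomes h dz_1 ... dz_n with h a product of two holomorphic
  functions, so the claim reduces to the flat case
  \<open>integral_holomorphic_form_diff\<close>.\<close>

lemma integral_pull_diff:
  assumes f: "holomorphic_fun_on A U f" and C: "C \<in> A" and B: "ball z0 R \<subseteq> snd C ` (fst C \<inter> U)"
    and V: "open V" and P: "C1_map A V P" "P ` V \<subseteq> fst C \<inter> snd C -` ball z0 R"
    and Q: "C1_map A V Q" "Q ` V \<subseteq> fst C \<inter> snd C -` ball z0 R"
    and K: "compact K" "K \<subseteq> V" "\<And>x. x \<in> V - K \<Longrightarrow> P x = Q x"
  shows "(LINT x:V|lborel. (f (P x) * pull A \<phi> P x - f (Q x) * pull A \<phi> Q x)) = 0"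
proof -
  let ?h = "\<lambda>z. (f \<circ> chart_inv C) z * coef C z"
  have h: "cholomorphic_on (ball z0 R) ?h"
  proof (rule cholomorphic_on_mult)
    show "cholomorphic_on (ball z0 R) (f \<circ> chart_inv C)"
      using f C B cholomorphic_on_subset unfolding holomorphic_fun_on_def by blast
    show "cholomorphic_on (ball z0 R) (coef C)"
      by (rule cholomorphic_on_subset[OF coef_holomorphic[OF C]]) (use B in auto)
  qed
  have k: "Ck_on 1 V (snd C \<circ> P)" if "C1_map A V P" "P ` V \<subseteq> fst C \<inter> snd C -` ball z0 R" for P
  proof -
    have "V \<inter> P -` fst C = V" using that(2) by auto
    then show ?thesis using that(1) C unfolding C1_map_def by metis
  qed
  have eq: "?h ((snd C \<circ> P) x) * jac (snd C \<circ> P) x = f (P x) * pull A \<phi> P x"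
    if "C1_map A V P" "P ` V \<subseteq> fst C \<inter> snd C -` ball z0 R" "x \<in> V" for P x
  proof -
    have x: "P x \<in> fst C" using that by auto
    show ?thesis using pull_chart[OF V that(1,3) C x] chart_inv_f[OF C x] by simp
  qed
  have "(LINT x:V|lborel. (?h ((snd C \<circ> P) x) * jac (snd C \<circ> P) x - ?h ((snd C \<circ> Q) x) * jac (snd C \<circ> Q) x)) = 0"
    using P Q K by (intro integral_holomorphic_form_diff[OF h V k[OF P] _ k[OF Q]]) auto
  moreover have "(LINT x:V|lborel. (?h ((snd C \<circ> P) x) * jac (snd C \<circ> P) x - ?h ((snd C \<circ> Q) x) * jac (snd C \<circ> Q) x))
      = (LINT x:V|lborel. (f (P x) * pull A \<phi> P x - f (Q x) * pull A \<phi> Q x))"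
    unfolding set_lebesgue_integral_def using eq[OF P] eq[OF Q]
    by (intro Bochner_Integration.integral_cong) (auto split: split_indicator)
  ultimately show ?thesis by simp
qed

text \<open>A Lagrangian tangent space contains no complex line: if w and \<i> w are both tangent,
  then omega (w, \<i> w) = 0, so w = 0 by positivity. Hence a real basis of it is a complex basis,
  and the complex volume form does not vanish on it.\<close>

lemma slag_pull:
  assumes "kaehler_form A \<omega>" "special_lagrangian A \<omega> \<phi> L" "local_param A L V \<sigma>" "x \<in> V"
  shows "Im (pull A \<phi> \<sigma> x) = 0" "pull A \<phi> \<sigma> x \<noteq> 0"
proof -
  have sl: "pullback2 A \<omega> \<sigma> x u v = 0" "Im (pullback_n A \<phi> \<sigma> x w) = 0" for u v w
    using assms(2-4) unfolding special_lagrangian_def by blast+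
  then show "Im (pull A \<phi> \<sigma> x) = 0" by (simp add: pull_def)
  define C where "C = chart_at A (\<sigma> x)"
  have C: "C \<in> A" "\<sigma> x \<in> fst C" using chart_at by (auto simp: C_def)
  define E where "E = coord_diff A \<sigma> x"
  have im: "inj E" and C1: "C1_map A V \<sigma>"
    using assms(3,4) by (auto simp: local_param_def smooth_immersion_def E_def smooth_map_imp_C1)
  have linE: "linear E"
    using C1_map_has_derivative[OF C1 assms(4) C] by (auto simp: E_def coord_diff_def C_def has_derivative_linear)
  have bil: "bilinear (\<omega> C (\<sigma> x))" and pos: "\<And>u. u \<noteq> 0 \<Longrightarrow> \<omega> C (\<sigma> x) u (\<i> *s u) > 0"
    using assms(1) C unfolding kaehler_form_def by blast+
  have lag: "\<omega> C (\<sigma> x) (E u) (E v) = 0" for u v using sl(1) by (simp add: pullback2_def C_def E_def)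
  let ?M = "\<chi> i. E (axis i 1)"
  have "det ?M \<noteq> 0"
  proof
    assume "det ?M = 0"
    then have "det (transpose ?M) = 0" by (simp add: det_transpose)
    then have "\<not> (\<exists>B. B ** transpose ?M = mat 1)"
      using invertible_det_nz invertible_left_inverse by blast
    then obtain c where c: "transpose ?M *v c = 0" "c \<noteq> 0"
      using matrix_left_invertible_ker by blast
    \<comment> \<open>Real and imaginary parts of a complex relation among the tangent vectors. The
      relation reads \<open>E a + \<i> *s E b = 0\<close>, so \<open>\<i> *s E a = E b\<close> is
      again tangent.\<close>
    define a b where "a = (\<chi> i. Re (c $ i))" and "b = (\<chi> i. Im (c $ i))"
    have repr: "E u = (\<Sum>i\<in>UNIV. u $ i *\<^sub>R E (axis i 1))" for u
    proof -
      have "u = (\<Sum>i\<in>UNIV. u $ i *\<^sub>R axis i 1)"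
        by (simp add: vec_eq_iff axis_def if_distrib sum.delta cong: if_cong)
      then have "E u = E (\<Sum>i\<in>UNIV. u $ i *\<^sub>R axis i 1)" by (rule arg_cong)
      then show ?thesis by (simp only: linear_sum[OF linE] linear_scale[OF linE])
    qed
    have "E a + \<i> *s E b = transpose ?M *v c"
    proof -
      have "(E a + \<i> *s E b) $ j = (transpose ?M *v c) $ j" for j
      proof -
        have "(E a + \<i> *s E b) $ j = (\<Sum>i\<in>UNIV. (complex_of_real (Re (c $ i)) + \<i> * complex_of_real (Im (c $ i))) * E (axis i 1) $ j)"
          unfolding repr[of a] repr[of b]
          by (simp add: a_def b_def scaleR_conv_of_real[of _ "_::complex"] sum_distrib_left sum.distrib[symmetric] algebra_simps)
        also have "\<dots> = (\<Sum>i\<in>UNIV. c $ i * E (axis i 1) $ j)" by (simp flip: complex_eq)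
        finally show ?thesis by (simp add: matrix_vector_mult_def transpose_def mult.commute)
      qed
      then show ?thesis by (simp add: vec_eq_iff)
    qed
    then have "E a = - (\<i> *s E b)" using c(1) by (simp add: eq_neg_iff_add_eq_0)
    then have "\<i> *s E a = E b" by (simp add: vec_eq_iff)
    then have "E a = 0" using pos[of "E a"] lag[of a b] by force
    then have "E b = 0" using \<open>\<i> *s E a = E b\<close> by (metis vector_smult_rzero)
    have "E 0 = 0" using linear_0[OF linE] .
    then have "a = 0" "b = 0" using \<open>E a = 0\<close> \<open>E b = 0\<close> im by (metis injD)+
    then have "c = 0" unfolding vec_eq_iff by (simp add: a_def b_def vec_eq_iff complex_eq_iff)
    then show False using c(2) by simp
  qed
  moreover have "pull A \<phi> \<sigma> x = coef C (snd C (\<sigma> x)) * det ?M"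
    unfolding pull_def pullback_n_def using form_eq_det[OF C] by (simp add: C_def E_def)
  ultimately show "pull A \<phi> \<sigma> x \<noteq> 0" using coef_nonzero[OF C] by simp
qed

end

section \<open>The volume measure\<close>

context catlas
begin

lemma local_paramD:
  assumes "local_param A L V \<sigma>"
  shows "open V" "smooth_map A V \<sigma>" "C1_map A V \<sigma>" "\<sigma> ` V \<subseteq> L" "inj_on \<sigma> V" "continuous_on V \<sigma>"
proof -
  show "open V" "smooth_map A V \<sigma>" using assms by (auto simp: local_param_def smooth_immersion_def)
  then show "C1_map A V \<sigma>" by (simp add: smooth_map_imp_C1)
  then show "continuous_on V \<sigma>" by (simp add: C1_map_def)
  have "openin (top_of_set L) (\<sigma> ` V)" using assms by (simp add: local_param_def)
  then show "\<sigma> ` V \<subseteq> L" using openin_imp_subset by blast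
  obtain r where r: "homeomorphism V (\<sigma> ` V) \<sigma> r" using assms by (auto simp: local_param_def)
  show "inj_on \<sigma> V" by (rule inj_on_inverseI) (rule homeomorphism_apply1[OF r])
qed

end

context cvolume
begin

text \<open>Since \<open>\<sigma>\<close> has a continuous inverse on its relatively open image,
  images of Borel sets are preimages under a Borel map.\<close>

lemma param_image_sets:
  assumes "local_param A L V \<sigma>" "B \<in> sets borel" "B \<subseteq> V"
  shows "\<sigma> ` B \<in> sets (restrict_space borel L)"
proof -
  obtain r where r: "homeomorphism V (\<sigma> ` V) \<sigma> r" using assms(1) by (auto simp: local_param_def)
  have "openin (top_of_set L) (\<sigma> ` V)" using assms(1) by (simp add: local_param_def)
  then obtain X where X: "open X" "\<sigma> ` V = L \<inter> X" unfolding openin_open by blast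
  have "r \<in> borel_measurable (restrict_space borel (\<sigma> ` V))"
    using r by (intro borel_measurable_continuous_on_restrict) (simp add: homeomorphism_def)
  from measurable_sets[OF this assms(2)] have "r -` B \<inter> \<sigma> ` V \<in> sets (restrict_space borel (\<sigma> ` V))"
    by (simp add: space_restrict_space)
  then obtain Y where Y: "Y \<in> sets borel" "r -` B \<inter> \<sigma> ` V = \<sigma> ` V \<inter> Y" by (auto simp: sets_restrict_space)
  have "\<sigma> ` B = r -` B \<inter> \<sigma> ` V"
    using assms(3) homeomorphism_apply1[OF r] by force
  also have "\<dots> = L \<inter> (X \<inter> Y)" using X Y by blast
  finally show ?thesis using X(1) Y(1) by (auto simp: sets_restrict_space)
qed

lemma param_vimage_sets:
  assumes "local_param A L V \<sigma>" "X \<in> sets (restrict_space borel L)"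
  shows "V \<inter> \<sigma> -` X \<in> sets borel"
proof -
  obtain Y where Y: "Y \<in> sets borel" "X = L \<inter> Y" using assms(2) by (auto simp: sets_restrict_space)
  have "\<sigma> \<in> borel_measurable (restrict_space borel V)"
    using local_paramD[OF assms(1)] by (intro borel_measurable_continuous_on_restrict)
  from measurable_sets[OF this Y(1)] have "\<sigma> -` Y \<inter> V \<in> sets (restrict_space borel V)" by (simp add: space_restrict_space)
  moreover have "\<sigma> -` Y \<inter> V = V \<inter> \<sigma> -` X" using local_paramD(4)[OF assms(1)] Y(2) by auto
  ultimately show ?thesis using local_paramD(1)[OF assms(1)] by (auto simp: sets_restrict_space)
qed

lemma param_measurable:
  assumes "local_param A L V \<sigma>"
  shows "\<sigma> \<in> measurable (restrict_space lborel V) (restrict_space borel L)"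
proof (rule measurable_restrict_space2)
  show "\<sigma> \<in> space (restrict_space lborel V) \<rightarrow> L"
    using local_paramD(4)[OF assms] by (auto simp: space_restrict_space)
  have "\<sigma> \<in> borel_measurable (restrict_space borel V)"
    using local_paramD[OF assms] by (intro borel_measurable_continuous_on_restrict)
  then show "\<sigma> \<in> borel_measurable (restrict_space lborel V)"
    by (simp add: measurable_cong_sets sets_restrict_space)
qed

lemma continuous_on_volume_density:
  assumes "local_param A L V \<sigma>"
  shows "continuous_on V (volume_density A \<phi> \<sigma>)"
  using continuous_on_pull[OF local_paramD(1,3)[OF assms]]
  by (simp add: volume_density_pull continuous_on_Re)

lemma set_measurable_volume_density:
  assumes "local_param A L V \<sigma>" "B \<in> sets borel" "B \<subseteq> V"
  shows "set_borel_measurable borel B (volume_density A \<phi> \<sigma>)"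
  unfolding set_borel_measurable_def
  using assms continuous_on_volume_density continuous_on_subset
  by (intro borel_measurable_continuous_on_indicator) blast+

lemma measurable_volume_density:
  assumes "local_param A L V \<sigma>"
  shows "volume_density A \<phi> \<sigma> \<in> borel_measurable (restrict_space lborel V)"
proof -
  have "volume_density A \<phi> \<sigma> \<in> borel_measurable (restrict_space borel V)"
    by (intro borel_measurable_continuous_on_restrict continuous_on_volume_density[OF assms])
  then show ?thesis by (simp add: measurable_cong_sets sets_restrict_space)
qed

lemma oriented_paramD:
  assumes "oriented_param A \<phi> L V \<sigma>"
  shows "local_param A L V \<sigma>" "\<And>x. x \<in> V \<Longrightarrow> volume_density A \<phi> \<sigma> x > 0"
  using assms by (auto simp: oriented_param_def)

text \<open>The same Jacobian \<open>T\<close> serves for every \<open>P\<close>, so that quotients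
  of two pulled back densities do not depend on the parametrization. With \<open>P = id\<close> it
  is the usual transformation of the volume density.\<close>

lemma param_change_density:
  assumes \<sigma>: "local_param A L V \<sigma>" and \<tau>: "local_param A L W \<tau>"
  defines "g \<equiv> inv_into W \<tau> \<circ> \<sigma>"
  assumes x: "x \<in> V" "\<sigma> x \<in> \<tau> ` W"
  shows "\<exists>T. (g has_derivative T) (at x) \<and> g x \<in> W \<and> \<tau> (g x) = \<sigma> x \<and>
    (\<forall>P. C1_map A W (P \<circ> \<tau>) \<longrightarrow> pull A \<phi> (P \<circ> \<sigma>) x = pull A \<phi> (P \<circ> \<tau>) (g x) * of_real (det (matrix T)))"
proof -
  note lift = param_lift[OF \<tau> local_paramD(1,2,4)[OF \<sigma>], folded g_def]
  let ?N = "V \<inter> \<sigma> -` (\<tau> ` W)"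
  have xN: "x \<in> ?N" using x by simp
  define T where "T = frechet_derivative g (at x)"
  have T: "(g has_derivative T) (at x)"
    using Ck_on_differentiable[OF lift(5)[of 1] _ xN] by (simp add: T_def frechet_derivative_works)
  have gx: "g x \<in> W" using lift(3) xN by blast
  show ?thesis
  proof (intro exI[of _ T] conjI allI impI T gx lift(4)[OF xN])
    fix P assume P: "C1_map A W (P \<circ> \<tau>)"
    show "pull A \<phi> (P \<circ> \<sigma>) x = pull A \<phi> (P \<circ> \<tau>) (g x) * of_real (det (matrix T))"
      by (rule pull_compose[OF P gx T lift(1) xN]) (simp add: lift(4))
  qed
qed

lemma density_change_of_variables:
  assumes \<sigma>: "oriented_param A \<phi> L V \<sigma>" and \<tau>: "oriented_param A \<phi> L W \<tau>"
    and B: "B \<in> sets borel" "B \<subseteq> V" "\<sigma> ` B \<subseteq> \<tau> ` W"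
  shows "(\<integral>\<^sup>+x\<in>B. ennreal (volume_density A \<phi> \<sigma> x) \<partial>lborel)
    = (\<integral>\<^sup>+x\<in>(W \<inter> \<tau> -` (\<sigma> ` B)). ennreal (volume_density A \<phi> \<tau> x) \<partial>lborel)"
proof -
  note s = oriented_paramD(1)[OF \<sigma>] and t = oriented_paramD(1)[OF \<tau>]
  define g where "g = inv_into W \<tau> \<circ> \<sigma>"
  have "\<exists>T. (g has_derivative T) (at x) \<and> g x \<in> W \<and> \<tau> (g x) = \<sigma> x \<and>
      pull A \<phi> \<sigma> x = pull A \<phi> \<tau> (g x) * of_real (det (matrix T))" if x: "x \<in> B" for x
  proof -
    have x': "x \<in> V" "\<sigma> x \<in> \<tau> ` W" using B x by auto
    obtain T where T: "(g has_derivative T) (at x)" "g x \<in> W" "\<tau> (g x) = \<sigma> x"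
      and P: "\<forall>P. C1_map A W (P \<circ> \<tau>) \<longrightarrow> pull A \<phi> (P \<circ> \<sigma>) x = pull A \<phi> (P \<circ> \<tau>) (g x) * of_real (det (matrix T))"
      using param_change_density[OF s t x', folded g_def] by blast
    from P local_paramD(3)[OF t] have "pull A \<phi> (id \<circ> \<sigma>) x = pull A \<phi> (id \<circ> \<tau>) (g x) * of_real (det (matrix T))"
      by (metis id_comp)
    then show ?thesis using T by auto
  qed
  then obtain T where T: "\<And>x. x \<in> B \<Longrightarrow> (g has_derivative T x) (at x)" "\<And>x. x \<in> B \<Longrightarrow> g x \<in> W"
    "\<And>x. x \<in> B \<Longrightarrow> \<tau> (g x) = \<sigma> x"
    "\<And>x. x \<in> B \<Longrightarrow> pull A \<phi> \<sigma> x = pull A \<phi> \<tau> (g x) * of_real (det (matrix (T x)))" by metis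
  \<comment> \<open>Both densities are positive, so the Jacobian is positive and the absolute value
    in the change of variables disappears.\<close>
  have eq: "\<bar>det (matrix (T x))\<bar> * volume_density A \<phi> \<tau> (g x) = volume_density A \<phi> \<sigma> x" if x: "x \<in> B" for x
  proof -
    have v: "volume_density A \<phi> \<sigma> x = volume_density A \<phi> \<tau> (g x) * det (matrix (T x))"
      using T(4)[OF x] by (simp add: volume_density_pull)
    moreover have "volume_density A \<phi> \<sigma> x > 0" "volume_density A \<phi> \<tau> (g x) > 0"
      using oriented_paramD(2)[OF \<sigma>] oriented_paramD(2)[OF \<tau>] T(2)[OF x] x B(2) by auto
    ultimately have "det (matrix (T x)) > 0" by (simp add: zero_less_mult_iff)
    then show ?thesis using v by simp
  qed
  have gB: "g ` B = W \<inter> \<tau> -` (\<sigma> ` B)"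
  proof (intro equalityI subsetI)
    show "y \<in> W \<inter> \<tau> -` (\<sigma> ` B)" if "y \<in> g ` B" for y using that T(2,3) by auto
    show "y \<in> g ` B" if y: "y \<in> W \<inter> \<tau> -` (\<sigma> ` B)" for y
    proof -
      from y obtain x where x: "x \<in> B" "\<tau> y = \<sigma> x" by auto
      then have "g x = y" using T(2,3)[OF x(1)] y local_paramD(5)[OF t] by (auto simp: inj_on_def)
      then show ?thesis using x by blast
    qed
  qed
  have gBm: "g ` B \<in> sets borel" "g ` B \<subseteq> W"
    unfolding gB using param_vimage_sets[OF t param_image_sets[OF s B(1,2)]] by auto
  have "(\<integral>\<^sup>+y\<in>g ` B. ennreal (volume_density A \<phi> \<tau> y) \<partial>lborel)
    = (\<integral>\<^sup>+x\<in>B. ennreal (\<bar>det (matrix (T x))\<bar> * volume_density A \<phi> \<tau> (g x)) \<partial>lborel)"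
  proof (rule nn_integral_change_of_variables[OF B(1) gBm(1)])
    show "(g has_derivative T x) (at x within B)" if "x \<in> B" for x using T(1)[OF that] by (rule has_derivative_at_withinI)
    show "inj_on g B"
    proof (rule inj_onI)
      fix x y assume xy: "x \<in> B" "y \<in> B" "g x = g y"
      then have "\<sigma> x = \<sigma> y" using T(3) by metis
      then show "x = y" using xy B(2) local_paramD(5)[OF s] by (auto simp: inj_on_def)
    qed
    show "0 \<le> volume_density A \<phi> \<tau> y" if "y \<in> g ` B" for y
      using oriented_paramD(2)[OF \<tau>] gBm(2) that by (auto intro: less_imp_le)
    show "set_borel_measurable borel (g ` B) (volume_density A \<phi> \<tau>)"
      by (rule set_measurable_volume_density[OF t gBm])
    have "(\<lambda>x. indicator B x *\<^sub>R (\<bar>det (matrix (T x))\<bar> * volume_density A \<phi> \<tau> (g x))) = (\<lambda>x. indicator B x *\<^sub>R volume_density A \<phi> \<sigma> x)"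
      using eq by (auto split: split_indicator)
    then show "set_borel_measurable borel B (\<lambda>x. \<bar>det (matrix (T x))\<bar> * volume_density A \<phi> \<tau> (g x))"
      using set_measurable_volume_density[OF s B(1,2)] by (simp only: set_borel_measurable_def)
  qed
  also have "\<dots> = (\<integral>\<^sup>+x\<in>B. ennreal (volume_density A \<phi> \<sigma> x) \<partial>lborel)"
    using eq by (intro nn_integral_cong) (auto split: split_indicator)
  finally show ?thesis by (simp add: gB)
qed

definition represents_volume :: "'m measure \<Rightarrow> (real^'n) set \<Rightarrow> (real^'n \<Rightarrow> 'm) \<Rightarrow> bool" where
  "represents_volume \<mu> V \<sigma> \<longleftrightarrow> (\<forall>B\<in>sets borel. B \<subseteq> V \<longrightarrow>
     emeasure \<mu> (\<sigma> ` B) = (\<integral>\<^sup>+x\<in>B. ennreal (volume_density A \<phi> \<sigma> x) \<partial>lborel))"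

lemma slag_volume_eq: "slag_volume A \<phi> L =
   (THE \<mu>. sets \<mu> = sets (restrict_space borel L) \<and>
        (\<forall>V \<sigma>. oriented_param A \<phi> L V \<sigma> \<longrightarrow> represents_volume \<mu> V \<sigma>))"
  by (simp add: slag_volume_def represents_volume_def)

text \<open>The part of the volume measure seen by a single parametrization, regarded as a measure
  on all of \<open>L\<close>.\<close>

definition param_measure :: "'m set \<Rightarrow> (real^'n) set \<Rightarrow> (real^'n \<Rightarrow> 'm) \<Rightarrow> 'm measure" where
  "param_measure L V \<sigma> = distr (density (restrict_space lborel V) (\<lambda>x. ennreal (volume_density A \<phi> \<sigma> x)))
     (restrict_space borel L) \<sigma>"

lemma sets_param_measure: "sets (param_measure L V \<sigma>) = sets (restrict_space borel L)"
  by (simp add: param_measure_def)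

lemma emeasure_param_measure:
  assumes "local_param A L V \<sigma>" "X \<in> sets (restrict_space borel L)"
  shows "emeasure (param_measure L V \<sigma>) X = (\<integral>\<^sup>+x\<in>(V \<inter> \<sigma> -` X). ennreal (volume_density A \<phi> \<sigma> x) \<partial>lborel)"
proof -
  have V: "V \<in> sets borel" using local_paramD(1)[OF assms(1)] by simp
  have m: "\<sigma> \<in> measurable (density (restrict_space lborel V) (\<lambda>x. ennreal (volume_density A \<phi> \<sigma> x))) (restrict_space borel L)"
    using param_measurable[OF assms(1)] by (simp add: measurable_cong_sets[OF sets_density refl])
  have s: "V \<inter> \<sigma> -` X \<in> sets (restrict_space lborel V)"
    using param_vimage_sets[OF assms] V by (auto simp: sets_restrict_space_iff)
  have "emeasure (param_measure L V \<sigma>) X = emeasure (density (restrict_space lborel V) (\<lambda>x. ennreal (volume_density A \<phi> \<sigma> x))) (V \<inter> \<sigma> -` X)"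
    unfolding param_measure_def using m assms(2) by (subst emeasure_distr) (auto simp: space_restrict_space Int_commute)
  also have "\<dots> = (\<integral>\<^sup>+x. ennreal (volume_density A \<phi> \<sigma> x) * indicator (V \<inter> \<sigma> -` X) x \<partial>restrict_space lborel V)"
    using s measurable_volume_density[OF assms(1)] by (intro emeasure_density) auto
  also have "\<dots> = (\<integral>\<^sup>+x\<in>V. (ennreal (volume_density A \<phi> \<sigma> x) * indicator (V \<inter> \<sigma> -` X) x) \<partial>lborel)"
    using V by (intro nn_integral_restrict_space) auto
  also have "\<dots> = (\<integral>\<^sup>+x\<in>(V \<inter> \<sigma> -` X). ennreal (volume_density A \<phi> \<sigma> x) \<partial>lborel)"
    by (intro nn_integral_cong) (auto split: split_indicator)
  finally show ?thesis .
qed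

end

section \<open>Existence and uniqueness of the volume measure\<close>

locale oriented_cover = cvolume A \<phi> for A :: "('m::{t2_space,second_countable_topology}, 'n::finite) chart set" and \<phi> +
  fixes L :: "'m set" and N :: nat and V :: "nat \<Rightarrow> (real^'n) set" and \<sigma> :: "nat \<Rightarrow> real^'n \<Rightarrow> 'm"
  assumes param: "i < N \<Longrightarrow> oriented_param A \<phi> L (V i) (\<sigma> i)"
    and cover: "L \<subseteq> (\<Union>i<N. \<sigma> i ` V i)"
begin

text \<open>Disjoint pieces, each inside one parametrized patch: the order of the indices decides
  which patch owns a point.\<close>

definition piece :: "nat \<Rightarrow> 'm set" where
  "piece i = \<sigma> i ` V i - (\<Union>j<i. \<sigma> j ` V j)"

lemma image_sets: "i < N \<Longrightarrow> \<sigma> i ` V i \<in> sets (restrict_space borel L)"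
  using param_image_sets[OF oriented_paramD(1)[OF param], of i "V i"] local_paramD(1)[OF oriented_paramD(1)[OF param]] by auto

lemma piece_sets: "i < N \<Longrightarrow> piece i \<in> sets (restrict_space borel L)"
  unfolding piece_def by (intro sets.Diff image_sets sets.finite_UN) auto

lemma piece_disjoint: "i \<noteq> j \<Longrightarrow> piece i \<inter> piece j = {}"
  by (cases i j rule: linorder_cases) (auto simp: piece_def)

lemma piece_cover: assumes "p \<in> L" obtains i where "i < N" "p \<in> piece i"
proof -
  define i where "i = (LEAST i. i < N \<and> p \<in> \<sigma> i ` V i)"
  have ex: "\<exists>i. i < N \<and> p \<in> \<sigma> i ` V i" using subsetD[OF cover assms] by blast
  have i: "i < N" "p \<in> \<sigma> i ` V i" using LeastI_ex[OF ex] by (auto simp: i_def)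
  have "p \<notin> \<sigma> j ` V j" if "j < i" for j
    using not_less_Least[of j "\<lambda>i. i < N \<and> p \<in> \<sigma> i ` V i"] that i(1) by (auto simp: i_def[symmetric])
  then show thesis using i that by (auto simp: piece_def)
qed

lemma sum_piece: "p \<in> L \<Longrightarrow> (\<Sum>i<N. indicator (piece i) p) = (1::ennreal)"
proof -
  assume "p \<in> L"
  then obtain i where i: "i < N" "p \<in> piece i" by (rule piece_cover)
  have "(\<Sum>j<N. indicator (piece j) p) = (\<Sum>j<N. if j = i then 1 else (0::ennreal))"
    using i piece_disjoint by (intro sum.cong) (auto split: split_indicator)
  then show ?thesis using i by simp
qed

text \<open>Gluing along disjoint pieces: on each of them the measure of the owning patch is used.
  By \<open>density_change_of_variables\<close> every other oriented parametrization sees the same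
  measure.\<close>

definition vol_measure :: "'m measure" where
  "vol_measure = measure_of L (sets (restrict_space borel L))
     (\<lambda>X. \<Sum>i<N. emeasure (param_measure L (V i) (\<sigma> i)) (X \<inter> piece i))"

lemma sets_vol_measure: "sets vol_measure = sets (restrict_space borel L)"
proof -
  have "sets (restrict_space borel L) \<subseteq> Pow L" using sets.space_closed[of "restrict_space borel L"] by (simp add: space_restrict_space)
  then show ?thesis unfolding vol_measure_def
    using sets.sigma_sets_eq[of "restrict_space borel L"] by (simp add: space_restrict_space)
qed

lemma emeasure_vol_measure:
  assumes "X \<in> sets (restrict_space borel L)"
  shows "emeasure vol_measure X = (\<Sum>i<N. emeasure (param_measure L (V i) (\<sigma> i)) (X \<inter> piece i))"
proof (rule emeasure_measure_of[OF vol_measure_def])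
  show "sets (restrict_space borel L) \<subseteq> Pow L" using sets.space_closed[of "restrict_space borel L"] by (simp add: space_restrict_space)
  show "X \<in> sets vol_measure" using assms by (simp add: sets_vol_measure)
  show "positive (sets vol_measure) (\<lambda>X. \<Sum>i<N. emeasure (param_measure L (V i) (\<sigma> i)) (X \<inter> piece i))"
    by (simp add: positive_def)
  show "countably_additive (sets vol_measure) (\<lambda>X. \<Sum>i<N. emeasure (param_measure L (V i) (\<sigma> i)) (X \<inter> piece i))"
    unfolding countably_additive_def sets_vol_measure
  proof (intro allI impI)
    fix X :: "nat \<Rightarrow> 'm set" assume X: "range X \<subseteq> sets (restrict_space borel L)" "disjoint_family X"
    have "(\<Sum>n. emeasure (param_measure L (V i) (\<sigma> i)) (X n \<inter> piece i)) = emeasure (param_measure L (V i) (\<sigma> i)) (\<Union> (range X) \<inter> piece i)"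
      if "i < N" for i
    proof -
      have "(\<Sum>n. emeasure (param_measure L (V i) (\<sigma> i)) (X n \<inter> piece i)) = emeasure (param_measure L (V i) (\<sigma> i)) (\<Union>n. X n \<inter> piece i)"
        using X piece_sets[OF that] by (intro suminf_emeasure) (auto simp: sets_param_measure disjoint_family_on_def)
      then show ?thesis by (simp add: Int_UN_distrib2)
    qed
    then show "(\<Sum>n. \<Sum>i<N. emeasure (param_measure L (V i) (\<sigma> i)) (X n \<inter> piece i))
      = (\<Sum>i<N. emeasure (param_measure L (V i) (\<sigma> i)) (\<Union> (range X) \<inter> piece i))"
      by (subst suminf_sum) auto
  qed
qed

lemma vol_measure_represents:
  assumes \<tau>: "oriented_param A \<phi> L W \<tau>"
  shows "represents_volume vol_measure W \<tau>"
  unfolding represents_volume_def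
proof (intro ballI impI)
  note t = oriented_paramD(1)[OF \<tau>]
  fix B :: "(real^'n) set" assume B: "B \<in> sets borel" "B \<subseteq> W"
  \<comment> \<open>The part of \<open>B\<close> that \<open>\<tau>\<close> sends into the
    \<open>i\<close>-th piece, where \<open>\<tau>\<close> can be compared with
    \<open>\<sigma> i\<close>.\<close>
  define D where "D = (\<lambda>i. B \<inter> (W \<inter> \<tau> -` piece i))"
  have D: "D i \<in> sets borel" "D i \<subseteq> W" "\<tau> ` D i = \<tau> ` B \<inter> piece i" "\<tau> ` D i \<subseteq> \<sigma> i ` V i" if "i < N" for i
    using B param_vimage_sets[OF t piece_sets[OF that]] by (auto simp: D_def piece_def)
  have "emeasure vol_measure (\<tau> ` B) = (\<Sum>i<N. emeasure (param_measure L (V i) (\<sigma> i)) (\<tau> ` D i))"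
    using emeasure_vol_measure[OF param_image_sets[OF t B]] D(3) by simp
  also have "\<dots> = (\<Sum>i<N. \<integral>\<^sup>+x\<in>D i. ennreal (volume_density A \<phi> \<tau> x) \<partial>lborel)"
  proof (rule sum.cong[OF refl])
    fix i assume i: "i \<in> {..<N}"
    then have iN: "i < N" by simp
    have "emeasure (param_measure L (V i) (\<sigma> i)) (\<tau> ` D i)
      = (\<integral>\<^sup>+x\<in>(V i \<inter> \<sigma> i -` (\<tau> ` D i)). ennreal (volume_density A \<phi> (\<sigma> i) x) \<partial>lborel)"
      by (rule emeasure_param_measure[OF oriented_paramD(1)[OF param[OF iN]] param_image_sets[OF t D(1,2)[OF iN]]])
    then show "emeasure (param_measure L (V i) (\<sigma> i)) (\<tau> ` D i) = (\<integral>\<^sup>+x\<in>D i. ennreal (volume_density A \<phi> \<tau> x) \<partial>lborel)"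
      using density_change_of_variables[OF \<tau> param[OF iN] D(1,2,4)[OF iN]] by simp
  qed
  also have "\<dots> = (\<integral>\<^sup>+x. (\<Sum>i<N. ennreal (volume_density A \<phi> \<tau> x) * indicator (D i) x) \<partial>lborel)"
  proof (rule nn_integral_sum[symmetric])
    fix i assume "i \<in> {..<N}"
    then have "set_borel_measurable borel (D i) (volume_density A \<phi> \<tau>)"
      using D by (intro set_measurable_volume_density[OF t]) auto
    then have "(\<lambda>x. ennreal (indicator (D i) x *\<^sub>R volume_density A \<phi> \<tau> x)) \<in> borel_measurable lborel"
      by (simp add: set_borel_measurable_def)
    moreover have "ennreal (indicator (D i) x *\<^sub>R volume_density A \<phi> \<tau> x) = ennreal (volume_density A \<phi> \<tau> x) * indicator (D i) x" for x
      by (auto split: split_indicator)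
    ultimately show "(\<lambda>x. ennreal (volume_density A \<phi> \<tau> x) * indicator (D i) x) \<in> borel_measurable lborel" by simp
  qed
  also have "\<dots> = (\<integral>\<^sup>+x\<in>B. ennreal (volume_density A \<phi> \<tau> x) \<partial>lborel)"
  proof (rule nn_integral_cong)
    fix x
    have "(\<Sum>i<N. indicator (D i) x) = (indicator B x :: ennreal)"
    proof (cases "x \<in> B")
      case True
      then have "indicator (D i) x = (indicator (piece i) (\<tau> x) :: ennreal)" for i
        using B(2) by (auto simp: D_def split: split_indicator)
      moreover have "\<tau> x \<in> L" using True B(2) local_paramD(4)[OF t] by auto
      ultimately show ?thesis using sum_piece True by simp
    qed (simp add: D_def)
    then show "(\<Sum>i<N. ennreal (volume_density A \<phi> \<tau> x) * indicator (D i) x) = ennreal (volume_density A \<phi> \<tau> x) * indicator B x"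
      by (simp flip: sum_distrib_left)
  qed
  finally show "emeasure vol_measure (\<tau> ` B) = (\<integral>\<^sup>+x\<in>B. ennreal (volume_density A \<phi> \<tau> x) \<partial>lborel)" .
qed

text \<open>The trace of a measurable set on a piece is the image of a Borel set of parameters, so a
  finite cover already determines the measure. This reduces the condition on all oriented
  parametrizations in \<open>slag_volume\<close> to finitely many.\<close>

lemma represents_volume_unique:
  assumes \<mu>: "sets \<mu> = sets (restrict_space borel L)" "\<And>i. i < N \<Longrightarrow> represents_volume \<mu> (V i) (\<sigma> i)"
  shows "\<mu> = vol_measure"
proof (rule measure_eqI)
  show "sets \<mu> = sets vol_measure" by (simp add: \<mu>(1) sets_vol_measure)
  fix X assume "X \<in> sets \<mu>"
  then have X: "X \<in> sets (restrict_space borel L)" using \<mu>(1) by simp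
  then have XL: "X \<subseteq> L" using sets.sets_into_space[OF X] by (simp add: space_restrict_space)
  have Xeq: "X = (\<Union>i<N. X \<inter> piece i)" using XL piece_cover by blast
  have "emeasure \<nu> X = (\<Sum>i<N. \<integral>\<^sup>+x\<in>(V i \<inter> \<sigma> i -` (X \<inter> piece i)). ennreal (volume_density A \<phi> (\<sigma> i) x) \<partial>lborel)"
    if \<nu>: "sets \<nu> = sets (restrict_space borel L)" "\<And>i. i < N \<Longrightarrow> represents_volume \<nu> (V i) (\<sigma> i)" for \<nu>
  proof -
    have "emeasure \<nu> X = emeasure \<nu> (\<Union>i<N. X \<inter> piece i)" using Xeq by simp
    also have "\<dots> = (\<Sum>i<N. emeasure \<nu> (X \<inter> piece i))"
      using X piece_sets piece_disjoint \<nu>(1) by (intro sum_emeasure[symmetric]) (auto simp: disjoint_family_on_def)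
    also have "\<dots> = (\<Sum>i<N. \<integral>\<^sup>+x\<in>(V i \<inter> \<sigma> i -` (X \<inter> piece i)). ennreal (volume_density A \<phi> (\<sigma> i) x) \<partial>lborel)"
    proof (rule sum.cong[OF refl])
      fix i assume "i \<in> {..<N}"
      then have i: "i < N" by simp
      have "X \<inter> piece i = \<sigma> i ` (V i \<inter> \<sigma> i -` (X \<inter> piece i))" by (auto simp: piece_def)
      moreover have "V i \<inter> \<sigma> i -` (X \<inter> piece i) \<in> sets borel"
        using X piece_sets[OF i] by (intro param_vimage_sets[OF oriented_paramD(1)[OF param[OF i]]] sets.Int)
      ultimately show "emeasure \<nu> (X \<inter> piece i) = (\<integral>\<^sup>+x\<in>(V i \<inter> \<sigma> i -` (X \<inter> piece i)). ennreal (volume_density A \<phi> (\<sigma> i) x) \<partial>lborel)"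
        using \<nu>(2)[OF i] unfolding represents_volume_def by (metis Int_lower1)
    qed
    finally show ?thesis .
  qed
  from this[OF \<mu>] this[OF sets_vol_measure vol_measure_represents[OF param]]
  show "emeasure \<mu> X = emeasure vol_measure X" by simp
qed

lemma slag_volume_vol_measure: "slag_volume A \<phi> L = vol_measure"
  unfolding slag_volume_eq
proof (rule the_equality)
  fix \<mu> assume "sets \<mu> = sets (restrict_space borel L) \<and>
    (\<forall>V \<sigma>. oriented_param A \<phi> L V \<sigma> \<longrightarrow> represents_volume \<mu> V \<sigma>)"
  then show "\<mu> = vol_measure" using param by (intro represents_volume_unique) blast+
qed (simp add: sets_vol_measure vol_measure_represents)

lemma sets_slag_volume: "sets (slag_volume A \<phi> L) = sets (restrict_space borel L)"
  by (simp add: slag_volume_vol_measure sets_vol_measure)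

lemma space_slag_volume: "space (slag_volume A \<phi> L) = L"
  using sets_eq_imp_space_eq[OF sets_slag_volume] by (simp add: space_restrict_space)

lemma slag_volume_represents:
  "oriented_param A \<phi> L W \<tau> \<Longrightarrow> represents_volume (slag_volume A \<phi> L) W \<tau>"
  by (simp add: slag_volume_vol_measure vol_measure_represents)

lemma slag_volume_unique:
  "sets \<mu> = sets (restrict_space borel L) \<Longrightarrow> (\<And>i. i < N \<Longrightarrow> represents_volume \<mu> (V i) (\<sigma> i)) \<Longrightarrow> slag_volume A \<phi> L = \<mu>"
  using represents_volume_unique slag_volume_vol_measure by simp

text \<open>Identifies the volume measure on a patch with a pushforward from the parameter space;
  the nonnegative and the complex integral formula both follow from it.\<close>

lemma density_slag_volume:
  assumes \<tau>: "oriented_param A \<phi> L W \<tau>"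
  shows "density (slag_volume A \<phi> L) (indicator (\<tau> ` W)) = param_measure L W \<tau>"
proof (rule measure_eqI)
  note t = oriented_paramD(1)[OF \<tau>]
  have W: "W \<in> sets borel" using local_paramD(1)[OF t] by simp
  have m: "\<tau> ` W \<in> sets (slag_volume A \<phi> L)" using param_image_sets[OF t W] by (simp add: sets_slag_volume)
  show "sets (density (slag_volume A \<phi> L) (indicator (\<tau> ` W))) = sets (param_measure L W \<tau>)"
    by (simp add: sets_slag_volume sets_param_measure)
  fix X assume "X \<in> sets (density (slag_volume A \<phi> L) (indicator (\<tau> ` W)))"
  then have X: "X \<in> sets (slag_volume A \<phi> L)" "X \<in> sets (restrict_space borel L)" by (simp_all add: sets_slag_volume)
  have "emeasure (density (slag_volume A \<phi> L) (indicator (\<tau> ` W))) X = emeasure (slag_volume A \<phi> L) (\<tau> ` W \<inter> X)"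
    using X m by (subst emeasure_density) (auto simp flip: indicator_inter_arith)
  also have "\<tau> ` W \<inter> X = \<tau> ` (W \<inter> \<tau> -` X)" by auto
  also have "emeasure (slag_volume A \<phi> L) (\<tau> ` (W \<inter> \<tau> -` X)) = emeasure (param_measure L W \<tau>) X"
    using slag_volume_represents[OF \<tau>] param_vimage_sets[OF t X(2)] emeasure_param_measure[OF t X(2)]
    unfolding represents_volume_def by simp
  finally show "emeasure (density (slag_volume A \<phi> L) (indicator (\<tau> ` W))) X = emeasure (param_measure L W \<tau>) X" .
qed

lemma nn_integral_slag_volume:
  assumes \<tau>: "oriented_param A \<phi> L W \<tau>" and h: "h \<in> borel_measurable (restrict_space borel L)"
  shows "(\<integral>\<^sup>+p\<in>\<tau> ` W. h p \<partial>slag_volume A \<phi> L) = (\<integral>\<^sup>+x\<in>W. (ennreal (volume_density A \<phi> \<tau> x) * h (\<tau> x)) \<partial>lborel)"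
proof -
  note t = oriented_paramD(1)[OF \<tau>]
  have W: "W \<in> sets borel" using local_paramD(1)[OF t] by simp
  have m: "\<tau> ` W \<in> sets (slag_volume A \<phi> L)" using param_image_sets[OF t W] by (simp add: sets_slag_volume)
  have h': "h \<in> borel_measurable (slag_volume A \<phi> L)" using h by (simp add: measurable_cong_sets[OF sets_slag_volume refl])
  have ht: "(\<lambda>x. h (\<tau> x)) \<in> borel_measurable (restrict_space lborel W)"
    using measurable_compose[OF param_measurable[OF t] h] .
  have "(\<integral>\<^sup>+p\<in>\<tau> ` W. h p \<partial>slag_volume A \<phi> L) = integral\<^sup>N (density (slag_volume A \<phi> L) (indicator (\<tau> ` W))) h"
    using m h' by (subst nn_integral_density) (auto simp: mult.commute)
  also have "\<dots> = integral\<^sup>N (param_measure L W \<tau>) h" by (simp add: density_slag_volume[OF \<tau>])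
  also have "\<dots> = (\<integral>\<^sup>+x. h (\<tau> x) \<partial>density (restrict_space lborel W) (\<lambda>x. ennreal (volume_density A \<phi> \<tau> x)))"
    unfolding param_measure_def using h param_measurable[OF t] by (intro nn_integral_distr) (simp_all add: measurable_cong_sets[OF sets_density refl])
  also have "\<dots> = (\<integral>\<^sup>+x. ennreal (volume_density A \<phi> \<tau> x) * h (\<tau> x) \<partial>restrict_space lborel W)"
    using ht measurable_volume_density[OF t] by (intro nn_integral_density) auto
  also have "\<dots> = (\<integral>\<^sup>+x\<in>W. (ennreal (volume_density A \<phi> \<tau> x) * h (\<tau> x)) \<partial>lborel)"
    using W by (intro nn_integral_restrict_space) auto
  finally show ?thesis .
qed

lemma integral_slag_volume:
  fixes h :: "'m \<Rightarrow> complex"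
  assumes \<tau>: "oriented_param A \<phi> L W \<tau>" and h: "h \<in> borel_measurable (restrict_space borel L)"
  shows "(LINT p:\<tau> ` W|slag_volume A \<phi> L. h p) = (LINT x:W|lborel. volume_density A \<phi> \<tau> x *\<^sub>R h (\<tau> x))"
proof -
  note t = oriented_paramD(1)[OF \<tau>]
  have W: "W \<in> sets borel" using local_paramD(1)[OF t] by simp
  have m: "\<tau> ` W \<in> sets (slag_volume A \<phi> L)" using param_image_sets[OF t W] by (simp add: sets_slag_volume)
  have h': "h \<in> borel_measurable (slag_volume A \<phi> L)" using h by (simp add: measurable_cong_sets[OF sets_slag_volume refl])
  have ht: "(\<lambda>x. h (\<tau> x)) \<in> borel_measurable (restrict_space lborel W)"
    using measurable_compose[OF param_measurable[OF t] h] .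
  have ind: "(indicator (\<tau> ` W) :: 'm \<Rightarrow> ennreal) = (\<lambda>p. ennreal (indicator (\<tau> ` W) p))" by (simp add: ennreal_indicator)
  have "(LINT p:\<tau> ` W|slag_volume A \<phi> L. h p) = integral\<^sup>L (density (slag_volume A \<phi> L) (indicator (\<tau> ` W))) h"
    unfolding set_lebesgue_integral_def ind using m h' by (subst integral_density) auto
  also have "\<dots> = integral\<^sup>L (param_measure L W \<tau>) h" by (simp add: density_slag_volume[OF \<tau>])
  also have "\<dots> = (LINT x|density (restrict_space lborel W) (\<lambda>x. ennreal (volume_density A \<phi> \<tau> x)). h (\<tau> x))"
    unfolding param_measure_def using h param_measurable[OF t] by (intro integral_distr) (simp_all add: measurable_cong_sets[OF sets_density refl])
  also have "\<dots> = (LINT x|restrict_space lborel W. volume_density A \<phi> \<tau> x *\<^sub>R h (\<tau> x))"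
    using ht measurable_volume_density[OF t] oriented_paramD(2)[OF \<tau>]
    by (intro integral_density) (auto simp: space_restrict_space intro!: AE_I2 less_imp_le)
  also have "\<dots> = (LINT x:W|lborel. volume_density A \<phi> \<tau> x *\<^sub>R h (\<tau> x))"
    using W unfolding set_lebesgue_integral_def by (intro integral_restrict_space) auto
  finally show ?thesis .
qed

lemma finite_slag_volume:
  assumes "\<And>i. i < N \<Longrightarrow> (\<integral>\<^sup>+x\<in>V i. ennreal (volume_density A \<phi> (\<sigma> i) x) \<partial>lborel) < \<infinity>"
  shows "finite_measure (slag_volume A \<phi> L)"
proof
  have "emeasure (slag_volume A \<phi> L) (space (slag_volume A \<phi> L)) \<le> emeasure (slag_volume A \<phi> L) (\<Union>i<N. \<sigma> i ` V i)"
    using cover image_sets by (intro emeasure_mono) (auto simp: space_slag_volume sets_slag_volume)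
  also have "\<dots> \<le> (\<Sum>i<N. emeasure (slag_volume A \<phi> L) (\<sigma> i ` V i))"
    using image_sets by (intro emeasure_subadditive_finite) (auto simp: sets_slag_volume)
  also have "\<dots> = (\<Sum>i<N. \<integral>\<^sup>+x\<in>V i. ennreal (volume_density A \<phi> (\<sigma> i) x) \<partial>lborel)"
  proof (rule sum.cong[OF refl])
    fix i assume "i \<in> {..<N}"
    then have i: "i < N" by simp
    show "emeasure (slag_volume A \<phi> L) (\<sigma> i ` V i) = (\<integral>\<^sup>+x\<in>V i. ennreal (volume_density A \<phi> (\<sigma> i) x) \<partial>lborel)"
      using slag_volume_represents[OF param[OF i]] local_paramD(1)[OF oriented_paramD(1)[OF param[OF i]]]
      unfolding represents_volume_def by simp
  qed
  also have "\<dots> < \<infinity>" using assms by simp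
  finally show "emeasure (slag_volume A \<phi> L) (space (slag_volume A \<phi> L)) \<noteq> \<infinity>" by simp
qed

end

section \<open>Deformation chart by chart\<close>

context cvolume
begin

lemma local_param_subset:
  assumes "local_param A L V \<sigma>" "open V'" "V' \<subseteq> V"
  shows "local_param A L V' \<sigma>"
proof -
  note lp = local_paramD[OF assms(1)]
  obtain r where r: "homeomorphism V (\<sigma> ` V) \<sigma> r" using assms(1) by (auto simp: local_param_def)
  have "openin (top_of_set V) V'" using assms(2,3) by (simp add: openin_open_eq lp(1))
  then have "openin (top_of_set (\<sigma> ` V)) (\<sigma> ` V')" by (rule homeomorphism_imp_open_map[OF r])
  moreover have "openin (top_of_set L) (\<sigma> ` V)" using assms(1) by (simp add: local_param_def)
  ultimately have o: "openin (top_of_set L) (\<sigma> ` V')" using openin_trans by blast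
  have h: "homeomorphism V' (\<sigma> ` V') \<sigma> r"
    using r assms(3) by (rule homeomorphism_of_subsets) auto
  have "smooth_map A V' \<sigma>"
    unfolding smooth_map_iff
  proof (intro conjI ballI allI)
    show "continuous_on V' \<sigma>" using lp(6) assms(3) by (rule continuous_on_subset)
    fix C k assume "C \<in> A"
    then have "Ck_on k (V \<inter> \<sigma> -` fst C) (snd C \<circ> \<sigma>)" using lp(2) by (simp add: smooth_map_iff)
    then show "Ck_on k (V' \<inter> \<sigma> -` fst C) (snd C \<circ> \<sigma>)" by (rule Ck_on_subset) (use assms(3) in auto)
  qed
  then show ?thesis using assms o h by (auto simp: local_param_def smooth_immersion_def)
qed

lemma pull_cong:
  assumes "open N" "x \<in> N" "\<And>y. y \<in> N \<Longrightarrow> \<tau> y = \<tau>' y"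
  shows "pull A \<phi> \<tau> x = pull A \<phi> \<tau>' x"
proof -
  have "coord_diff A \<tau> x = coord_diff A \<tau>' x"
    unfolding coord_diff_def assms(3)[OF assms(2)]
    by (rule frechet_derivative_cong_open[OF assms(1,2)]) (simp add: assms(3))
  then show ?thesis by (simp add: pull_def pullback_n_def assms(3)[OF assms(2)])
qed

lemma holomorphic_fun_continuous:
  assumes "holomorphic_fun_on A U f" "open U"
  shows "continuous_on U f"
proof (rule continuous_at_imp_continuous_on, rule ballI)
  fix p assume p: "p \<in> U"
  obtain C where C: "C \<in> A" "p \<in> fst C" by (rule chart_cover)
  have o: "open (fst C \<inter> U)" using chart_homeo(1)[OF C(1)] assms(2) by blast
  have "cholomorphic_on (snd C ` (fst C \<inter> U)) (f \<circ> chart_inv C)"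
    using assms(1) C(1) unfolding holomorphic_fun_on_def by (rule bspec)
  then have "continuous_on (snd C ` (fst C \<inter> U)) (f \<circ> chart_inv C)" by (rule cholomorphic_on_continuous)
  then have "continuous_on (fst C \<inter> U) (\<lambda>p. (f \<circ> chart_inv C) (snd C p))"
    by (rule continuous_on_compose2[OF _ continuous_on_subset[OF chart_homeo(4)[OF C(1)]]]) auto
  then have "continuous_on (fst C \<inter> U) f"
    by (rule continuous_on_eq) (simp add: chart_inv_f[OF C(1)])
  then show "isCont f p" using o p C by (simp add: continuous_on_eq_continuous_at)
qed

section \<open>Coordinate balls and convex modification of maps\<close>

definition cball_in :: "('m, 'n) chart \<Rightarrow> complex^'n \<Rightarrow> real \<Rightarrow> 'm set" where
  "cball_in C z r = fst C \<inter> snd C -` cball z r"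

definition ball_in :: "('m, 'n) chart \<Rightarrow> complex^'n \<Rightarrow> real \<Rightarrow> 'm set" where
  "ball_in C z r = fst C \<inter> snd C -` ball z r"

lemma open_ball_in: "C \<in> A \<Longrightarrow> open (ball_in C z r)"
  unfolding ball_in_def by (rule open_chart_preimage) auto

lemma compact_cball_in:
  assumes "C \<in> A" "cball z r \<subseteq> snd C ` fst C"
  shows "compact (cball_in C z r)"
proof -
  have "cball_in C z r = chart_inv C ` cball z r"
  proof (intro equalityI subsetI)
    fix p assume "p \<in> cball_in C z r"
    then show "p \<in> chart_inv C ` cball z r"
      using chart_inv_f[OF assms(1), of p] by (auto simp: cball_in_def intro!: image_eqI[of p _ "snd C p"])
  next
    fix p assume "p \<in> chart_inv C ` cball z r"
    then show "p \<in> cball_in C z r" using assms(2) f_chart_inv[OF assms(1)] by (auto simp: cball_in_def)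
  qed
  then show ?thesis
    using continuous_on_subset[OF chart_homeo(5)[OF assms(1)] assms(2)] by (auto intro: compact_continuous_image)
qed

definition mbump :: "('m, 'n) chart \<Rightarrow> complex^'n \<Rightarrow> real \<Rightarrow> 'm \<Rightarrow> real" where
  "mbump C z r q = (if q \<in> fst C then bump z r (snd C q) else 0)"

lemma mbump_eq_0: "r > 0 \<Longrightarrow> q \<notin> cball_in C z r \<Longrightarrow> mbump C z r q = 0"
  by (auto simp: mbump_def cball_in_def intro!: bump_eq_0)

lemma mbump_eq_1: "r > 0 \<Longrightarrow> q \<in> ball_in C z (r / 2) \<Longrightarrow> mbump C z r q = 1"
  by (auto simp: mbump_def ball_in_def intro!: bump_eq_1)

lemma mbump_range: "0 \<le> mbump C z r q" "mbump C z r q \<le> 1"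
  by (auto simp: mbump_def bump_range)

text \<open>Extension by zero is harmless because the closed coordinate ball is compact, hence
  closed in the Hausdorff space \<open>'m\<close>; compactness comes from the ball lying in the
  image of the chart.\<close>

lemma Ck_on_mbump:
  assumes "C \<in> A" "cball z r \<subseteq> snd C ` fst C" "r > 0" and V: "open V" "C1_map A V \<tau>"
  shows "Ck_on 1 V (\<lambda>x. mbump C z r (\<tau> x))"
proof (rule Ck_on_local)
  fix x assume x: "x \<in> V"
  show "\<exists>T. open T \<and> x \<in> T \<and> Ck_on 1 T (\<lambda>x. mbump C z r (\<tau> x))"
  proof (cases "\<tau> x \<in> fst C")
    case True
    let ?T = "V \<inter> \<tau> -` fst C"
    have T: "open ?T" by (rule C1_map_preimage_open[OF V(2,1) chart_homeo(1)[OF assms(1)]])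
    have "Ck_on 1 ?T (snd C \<circ> \<tau>)" using V(2) assms(1) by (simp add: C1_map_def del: One_nat_def)
    then have "Ck_on 1 ?T (\<lambda>x. bump z r ((snd C \<circ> \<tau>) x))"
      by (rule Ck_on_compose[OF T open_UNIV _ Ck_on_bump]) simp
    then have "Ck_on 1 ?T (\<lambda>x. mbump C z r (\<tau> x))"
      by (rule Ck_on_cong[OF T, rotated]) (simp add: mbump_def)
    then show ?thesis using T x True by blast
  next
    case False
    let ?T = "V \<inter> \<tau> -` (- cball_in C z r)"
    have T: "open ?T"
      using compact_cball_in[OF assms(1,2)] compact_imp_closed by (intro C1_map_preimage_open[OF V(2,1)]) auto
    have "Ck_on 1 ?T (\<lambda>x. mbump C z r (\<tau> x))"
      by (rule Ck_on_cong[OF T _ Ck_on_const[of _ _ 0]]) (auto simp: mbump_eq_0[OF assms(3)])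
    moreover have "x \<in> ?T" using False x by (auto simp: cball_in_def)
    ultimately show ?thesis using T by blast
  qed
qed

text \<open>Interpolates in the chart between \<open>P\<close>, where the bump is 0, and
  \<open>Q\<close>, where it is 1. The first branch keeps the value \<open>P q\<close> where it lies
  outside the chart.\<close>

definition move :: "('m, 'n) chart \<Rightarrow> complex^'n \<Rightarrow> real \<Rightarrow> ('m \<Rightarrow> 'm) \<Rightarrow> ('m \<Rightarrow> 'm) \<Rightarrow> 'm \<Rightarrow> 'm" where
  "move C z r P Q q = (if mbump C z r q = 0 then P q else
     chart_inv C ((1 - mbump C z r q) *\<^sub>R snd C (P q) + mbump C z r q *\<^sub>R snd C (Q q)))"

lemma move_outside: "r > 0 \<Longrightarrow> q \<notin> cball_in C z r \<Longrightarrow> move C z r P Q q = P q"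
  by (simp add: move_def mbump_eq_0)

lemma move_formula:
  assumes "C \<in> A" "P q \<in> fst C"
  shows "move C z r P Q q = chart_inv C ((1 - mbump C z r q) *\<^sub>R snd C (P q) + mbump C z r q *\<^sub>R snd C (Q q))"
  using assms by (simp add: move_def chart_inv_f)

text \<open>The second alternative matters for successive modifications: a point that already has
  its target value keeps it.\<close>

lemma move_target:
  assumes "C \<in> A" "P q \<in> fst C" "Q q \<in> fst C" "mbump C z r q = 1 \<or> P q = Q q"
  shows "move C z r P Q q = Q q"
  using assms(4) by (auto simp: move_formula[where P=P and q=q, OF assms(1,2)] chart_inv_f[OF assms(1,3)] simp flip: scaleR_left_distrib)

text \<open>Convexity of the coordinate ball. The set \<open>X\<close> records a part of the
  manifold that the interpolated value must not leave.\<close>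

lemma move_in:
  assumes C: "C \<in> A" and B: "ball y e \<subseteq> snd C ` (fst C \<inter> X)"
    and "P q \<in> ball_in C y e" "Q q \<in> ball_in C y e"
  shows "(1 - mbump C z r q) *\<^sub>R snd C (P q) + mbump C z r q *\<^sub>R snd C (Q q) \<in> ball y e"
    "move C z r P Q q \<in> fst C \<inter> X"
    "snd C (move C z r P Q q) = (1 - mbump C z r q) *\<^sub>R snd C (P q) + mbump C z r q *\<^sub>R snd C (Q q)"
proof -
  let ?w = "(1 - mbump C z r q) *\<^sub>R snd C (P q) + mbump C z r q *\<^sub>R snd C (Q q)"
  show w: "?w \<in> ball y e"
    using assms(3,4) mbump_range[of C z r q] by (intro convexD convex_ball) (auto simp: ball_in_def)
  have m: "move C z r P Q q = chart_inv C ?w"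
    using assms(3) by (intro move_formula[OF C]) (simp add: ball_in_def)
  obtain p where p: "p \<in> fst C" "p \<in> X" "?w = snd C p" using w B by blast
  then have "chart_inv C ?w = p" using chart_inv_f[OF C p(1)] by simp
  then show "move C z r P Q q \<in> fst C \<inter> X" "snd C (move C z r P Q q) = ?w" using m p by auto
qed

text \<open>Near the support both maps lie in one ball and the chart formula applies; away from it
  the result equals \<open>P\<close>, which is read in a chart of its own.\<close>

lemma C1_map_move:
  assumes C: "C \<in> A" "ball z R \<subseteq> snd C ` fst C" and r: "0 < r" "r < R"
    and V: "open V" "C1_map A V \<tau>" "C1_map A V (P \<circ> \<tau>)" "C1_map A V (Q \<circ> \<tau>)"
    and PQ: "\<And>x. x \<in> V \<Longrightarrow> \<tau> x \<in> cball_in C z r \<Longrightarrow> P (\<tau> x) \<in> ball_in C z R \<and> Q (\<tau> x) \<in> ball_in C z R"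
  shows "C1_map A V (move C z r P Q \<circ> \<tau>)"
proof (rule C1_map_localI[OF V(1)])
  fix x assume x: "x \<in> V"
  have cb: "cball z r \<subseteq> snd C ` fst C" using C(2) r by auto
  show "\<exists>T C'. open T \<and> x \<in> T \<and> C' \<in> A \<and> (move C z r P Q \<circ> \<tau>) ` T \<subseteq> fst C' \<and> Ck_on 1 T (snd C' \<circ> (move C z r P Q \<circ> \<tau>))"
  proof (cases "\<tau> x \<in> cball_in C z r")
    case True
    define T where "T = (V \<inter> (P \<circ> \<tau>) -` ball_in C z R) \<inter> (V \<inter> (Q \<circ> \<tau>) -` ball_in C z R)"
    have T: "open T" unfolding T_def
      by (intro open_Int[OF C1_map_preimage_open[OF V(3,1)] C1_map_preimage_open[OF V(4,1)]] open_ball_in C)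
    have xT: "x \<in> T" using PQ[OF x True] x by (simp add: T_def)
    have B: "ball z R \<subseteq> snd C ` (fst C \<inter> UNIV)" using C(2) by simp
    have inT: "P (\<tau> y) \<in> ball_in C z R" "Q (\<tau> y) \<in> ball_in C z R" if "y \<in> T" for y using that by (auto simp: T_def)
    have mv: "move C z r P Q (\<tau> y) \<in> fst C"
      "snd C (move C z r P Q (\<tau> y)) = (1 - mbump C z r (\<tau> y)) *\<^sub>R snd C (P (\<tau> y)) + mbump C z r (\<tau> y) *\<^sub>R snd C (Q (\<tau> y))"
      if "y \<in> T" for y
      using move_in[where P=P and Q=Q and q="\<tau> y", OF C(1) B inT(1)[OF that] inT(2)[OF that]] by auto
    have k: "Ck_on 1 T (snd C \<circ> (P \<circ> \<tau>))" if "C1_map A V (P \<circ> \<tau>)" "\<And>y. y \<in> T \<Longrightarrow> P (\<tau> y) \<in> ball_in C z R" for P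
    proof -
      have "Ck_on 1 (V \<inter> (P \<circ> \<tau>) -` fst C) (snd C \<circ> (P \<circ> \<tau>))" using that(1) C(1) by (simp add: C1_map_def del: One_nat_def)
      then show ?thesis by (rule Ck_on_subset) (use that(2) in \<open>auto simp: T_def ball_in_def\<close>)
    qed
    have \<rho>: "Ck_on 1 T (\<lambda>x. mbump C z r (\<tau> x))"
      by (rule Ck_on_mbump[OF C(1) cb r(1) T C1_map_subset[OF V(2)]]) (auto simp: T_def)
    have "Ck_on 1 T (\<lambda>x. (1 - mbump C z r (\<tau> x)) *\<^sub>R (snd C \<circ> (P \<circ> \<tau>)) x + mbump C z r (\<tau> x) *\<^sub>R (snd C \<circ> (Q \<circ> \<tau>)) x)"
      by (intro Ck_on_add Ck_on_scaleR Ck_on_diff Ck_on_const T \<rho> k V inT)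
    then have "Ck_on 1 T (snd C \<circ> (move C z r P Q \<circ> \<tau>))"
      by (rule Ck_on_cong[OF T, rotated]) (simp add: mv(2))
    moreover have "(move C z r P Q \<circ> \<tau>) ` T \<subseteq> fst C"
      using mv(1) by auto
    ultimately show ?thesis using T xT C(1) by blast
  next
    case False
    define C' where "C' = chart_at A (P (\<tau> x))"
    have C': "C' \<in> A" "P (\<tau> x) \<in> fst C'" using chart_at by (auto simp: C'_def)
    define T where "T = (V \<inter> \<tau> -` (- cball_in C z r)) \<inter> (V \<inter> (P \<circ> \<tau>) -` fst C')"
    have T: "open T" unfolding T_def
      using compact_imp_closed[OF compact_cball_in[OF C(1) cb]]
      by (intro open_Int[OF C1_map_preimage_open[OF V(2,1)] C1_map_preimage_open[OF V(3,1) chart_homeo(1)[OF C'(1)]]]) auto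
    have eq: "move C z r P Q (\<tau> y) = P (\<tau> y)" if "y \<in> T" for y
      using that by (intro move_outside r) (auto simp: T_def)
    have "Ck_on 1 (V \<inter> (P \<circ> \<tau>) -` fst C') (snd C' \<circ> (P \<circ> \<tau>))" using V(3) C'(1) by (simp add: C1_map_def del: One_nat_def)
    then have "Ck_on 1 T (snd C' \<circ> (P \<circ> \<tau>))" by (rule Ck_on_subset) (auto simp: T_def)
    then have "Ck_on 1 T (snd C' \<circ> (move C z r P Q \<circ> \<tau>))"
      by (rule Ck_on_cong[OF T, rotated]) (simp add: eq)
    moreover have "(move C z r P Q \<circ> \<tau>) ` T \<subseteq> fst C'" using eq by (auto simp: T_def)
    moreover have "x \<in> T" using x False C' by (auto simp: T_def)
    ultimately show ?thesis using T C'(1) by blast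
  qed
qed

end

section \<open>The integral of f phi pulled back by C^1 maps\<close>

locale slag_cover = oriented_cover A \<phi> L N V \<sigma>
  for A :: "('m::{t2_space,second_countable_topology}, 'n::finite) chart set" and \<phi> L N V \<sigma> +
  fixes U :: "'m set" and f :: "'m \<Rightarrow> complex"
  assumes compact: "compact L" and U: "open U" "L \<subseteq> U" and f: "holomorphic_fun_on A U f"
    and pull_real: "\<And>i x. i < N \<Longrightarrow> x \<in> V i \<Longrightarrow> Im (pull A \<phi> (\<sigma> i) x) = 0"
    and finite_volume: "\<And>i. i < N \<Longrightarrow> (\<integral>\<^sup>+x\<in>V i. ennreal (volume_density A \<phi> (\<sigma> i) x) \<partial>lborel) < \<infinity>"
begin

lemma lp: "i < N \<Longrightarrow> local_param A L (V i) (\<sigma> i)"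
  using param oriented_paramD(1) by blast

text \<open>Neither injectivity nor an immersion is asked for, because the intermediate maps may be
  neither.\<close>

definition C1L :: "('m \<Rightarrow> 'm) \<Rightarrow> bool" where
  "C1L P \<longleftrightarrow> (\<forall>i<N. C1_map A (V i) (P \<circ> \<sigma> i)) \<and> P ` L \<subseteq> U"

lemma C1L_id: "C1L id"
  using U(2) local_paramD(3)[OF lp] by (simp add: C1L_def)

text \<open>The density of \<open>P\<^sup>*\<phi>\<close> with respect to the volume element of \<open>L\<close>.\<close>

definition ratio :: "('m \<Rightarrow> 'm) \<Rightarrow> 'm \<Rightarrow> complex" where
  "ratio P p = (let i = LEAST i. i < N \<and> p \<in> \<sigma> i ` V i; x = inv_into (V i) (\<sigma> i) p
     in pull A \<phi> (P \<circ> \<sigma> i) x / of_real (volume_density A \<phi> (\<sigma> i) x))"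

text \<open>Numerator and denominator of \<open>ratio\<close> acquire the same Jacobian factor under
  a change of parameters, so the choice of the least index is immaterial.\<close>

lemma ratio_param:
  assumes P: "\<And>i. i < N \<Longrightarrow> C1_map A (V i) (P \<circ> \<sigma> i)" and i: "i < N" "x \<in> V i"
  shows "pull A \<phi> (P \<circ> \<sigma> i) x = of_real (volume_density A \<phi> (\<sigma> i) x) * ratio P (\<sigma> i x)"
proof -
  define j where "j = (LEAST j. j < N \<and> \<sigma> i x \<in> \<sigma> j ` V j)"
  define y where "y = inv_into (V j) (\<sigma> j) (\<sigma> i x)"
  have ex: "\<exists>j. j < N \<and> \<sigma> i x \<in> \<sigma> j ` V j" using i by blast
  have j: "j < N" "\<sigma> i x \<in> \<sigma> j ` V j" using LeastI_ex[OF ex] by (auto simp: j_def)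
  have ratio: "ratio P (\<sigma> i x) = pull A \<phi> (P \<circ> \<sigma> j) y / of_real (volume_density A \<phi> (\<sigma> j) y)"
    by (simp add: ratio_def Let_def j_def y_def)
  from param_change_density[OF lp[OF i(1)] lp[OF j(1)] i(2) j(2)]
  obtain T :: "real^'n \<Rightarrow> real^'n" where T: "y \<in> V j" "\<forall>P. C1_map A (V j) (P \<circ> \<sigma> j) \<longrightarrow> pull A \<phi> (P \<circ> \<sigma> i) x = pull A \<phi> (P \<circ> \<sigma> j) y * of_real (det (matrix T))"
    unfolding o_apply y_def[symmetric] by blast
  have 1: "pull A \<phi> (P \<circ> \<sigma> i) x = pull A \<phi> (P \<circ> \<sigma> j) y * of_real (det (matrix T))" using T(2) P[OF j(1)] by blast
  have "pull A \<phi> (id \<circ> \<sigma> i) x = pull A \<phi> (id \<circ> \<sigma> j) y * of_real (det (matrix T))"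
    using T(2) local_paramD(3)[OF lp[OF j(1)]] by (metis id_comp)
  then have 2: "volume_density A \<phi> (\<sigma> i) x = volume_density A \<phi> (\<sigma> j) y * det (matrix T)"
    by (simp add: volume_density_pull)
  have "volume_density A \<phi> (\<sigma> j) y > 0" using oriented_paramD(2)[OF param[OF j(1)] T(1)] .
  then show ?thesis unfolding 1 2 ratio by simp
qed

lemma continuous_on_cover:
  fixes h :: "'m \<Rightarrow> 'b::topological_space"
  assumes "\<And>i. i < N \<Longrightarrow> continuous_on (V i) (\<lambda>x. h (\<sigma> i x))"
  shows "continuous_on L h"
  unfolding continuous_on_eq_continuous_within
proof
  fix p assume p: "p \<in> L"
  then obtain i where i: "i < N" "p \<in> \<sigma> i ` V i" using cover by blast
  obtain r where r: "homeomorphism (V i) (\<sigma> i ` V i) (\<sigma> i) r" using lp[OF i(1)] by (auto simp: local_param_def)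
  have "openin (top_of_set L) (\<sigma> i ` V i)" using lp[OF i(1)] by (simp add: local_param_def)
  then obtain X where X: "open X" "\<sigma> i ` V i = L \<inter> X" unfolding openin_open by blast
  have "continuous_on (\<sigma> i ` V i) (\<lambda>q. h (\<sigma> i (r q)))"
    using r by (intro continuous_on_compose2[OF assms[OF i(1)]]) (auto simp: homeomorphism_def)
  then have "continuous_on (L \<inter> X) h"
    unfolding X(2)[symmetric] by (rule continuous_on_eq) (simp add: homeomorphism_apply2[OF r])
  then have "continuous (at p within (L \<inter> X)) h"
    using i(2) X(2) by (simp add: continuous_on_eq_continuous_within)
  moreover have "at p within L = at p within (L \<inter> X)"
    using X i(2) by (intro at_within_nhd[of p X]) auto
  ultimately show "continuous (at p within L) h" by simp
qed

definition integrand :: "('m \<Rightarrow> 'm) \<Rightarrow> 'm \<Rightarrow> complex" where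
  "integrand P p = f (P p) * ratio P p"

lemma integrand_param:
  assumes "C1L P" "i < N" "x \<in> V i"
  shows "volume_density A \<phi> (\<sigma> i) x *\<^sub>R integrand P (\<sigma> i x) = f (P (\<sigma> i x)) * pull A \<phi> (P \<circ> \<sigma> i) x"
proof -
  have "pull A \<phi> (P \<circ> \<sigma> i) x = of_real (volume_density A \<phi> (\<sigma> i) x) * ratio P (\<sigma> i x)"
    using assms by (intro ratio_param) (auto simp: C1L_def)
  then show ?thesis by (simp add: integrand_def scaleR_conv_of_real[of _ "_::complex"] mult.left_commute)
qed

lemma continuous_on_integrand:
  assumes "C1L P" shows "continuous_on L (integrand P)"
proof (rule continuous_on_cover)
  fix i assume i: "i < N"
  have P: "C1_map A (V i) (P \<circ> \<sigma> i)" using assms i by (simp add: C1L_def)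
  have "(P \<circ> \<sigma> i) ` V i \<subseteq> U" using assms local_paramD(4)[OF lp[OF i]] by (auto simp: C1L_def)
  then have "continuous_on (V i) (\<lambda>x. f ((P \<circ> \<sigma> i) x))"
    using P by (intro continuous_on_compose2[OF holomorphic_fun_continuous[OF f U(1)]]) (auto simp: C1_map_def)
  then have "continuous_on (V i) (\<lambda>x. inverse (volume_density A \<phi> (\<sigma> i) x) *\<^sub>R (f ((P \<circ> \<sigma> i) x) * pull A \<phi> (P \<circ> \<sigma> i) x))"
    using oriented_paramD(2)[OF param[OF i]]
    by (intro continuous_on_scaleR continuous_on_inverse continuous_on_mult continuous_on_volume_density[OF lp[OF i]]
        continuous_on_pull[OF local_paramD(1)[OF lp[OF i]] P]) (auto simp: less_imp_neq[symmetric])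
  then show "continuous_on (V i) (\<lambda>x. integrand P (\<sigma> i x))"
  proof (rule continuous_on_eq)
    fix x assume x: "x \<in> V i"
    show "inverse (volume_density A \<phi> (\<sigma> i) x) *\<^sub>R (f ((P \<circ> \<sigma> i) x) * pull A \<phi> (P \<circ> \<sigma> i) x) = integrand P (\<sigma> i x)"
      using integrand_param[OF assms i x] oriented_paramD(2)[OF param[OF i] x] by (simp flip: integrand_param[OF assms i x])
  qed
qed

lemma measurable_integrand: "C1L P \<Longrightarrow> integrand P \<in> borel_measurable (restrict_space borel L)"
  by (intro borel_measurable_continuous_on_restrict continuous_on_integrand)

lemma integrable_integrand:
  assumes "C1L P" shows "integrable (slag_volume A \<phi> L) (integrand P)"
proof -
  interpret finite_measure "slag_volume A \<phi> L" by (rule finite_slag_volume[OF finite_volume])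
  have "bounded (integrand P ` L)"
    using compact_continuous_image[OF continuous_on_integrand[OF assms] compact] compact_imp_bounded by blast
  then obtain B where "\<And>p. p \<in> L \<Longrightarrow> norm (integrand P p) \<le> B" by (auto simp: bounded_iff)
  then show ?thesis
    using measurable_integrand[OF assms]
    by (intro integrable_const_bound[of _ B]) (auto simp: space_slag_volume measurable_cong_sets[OF sets_slag_volume refl] intro!: AE_I2)
qed

text \<open>The integral over \<open>L\<close> of the pullback of f phi by \<open>P\<close>.\<close>

definition J :: "('m \<Rightarrow> 'm) \<Rightarrow> complex" where
  "J P = (LINT p|slag_volume A \<phi> L. integrand P p)"

text \<open>The integrand involves derivatives, so agreement at \<open>p\<close> alone is not
  enough. That \<open>S\<close> is closed leaves an open set of parameters on which the maps
  agree.\<close>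

lemma integrand_cong:
  assumes "C1L P" "C1L Q" "closed S" "\<And>q. q \<in> L - S \<Longrightarrow> P q = Q q" "p \<in> L - S"
  shows "integrand P p = integrand Q p"
proof -
  obtain i x where i: "i < N" "x \<in> V i" "p = \<sigma> i x" using cover assms(5) by blast
  let ?T = "V i \<inter> \<sigma> i -` (- S)"
  have T: "open ?T" using assms(3) C1_map_preimage_open[OF local_paramD(3,1)[OF lp[OF i(1)]]] by blast
  have "pull A \<phi> (P \<circ> \<sigma> i) x = pull A \<phi> (Q \<circ> \<sigma> i) x"
    using i assms(4,5) local_paramD(4)[OF lp[OF i(1)]] by (intro pull_cong[OF T]) auto
  then have "volume_density A \<phi> (\<sigma> i) x *\<^sub>R integrand P p = volume_density A \<phi> (\<sigma> i) x *\<^sub>R integrand Q p"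
    using assms(4,5) i integrand_param[OF assms(1) i(1,2)] integrand_param[OF assms(2) i(1,2)] by simp
  then show ?thesis using oriented_paramD(2)[OF param[OF i(1)] i(2)] by simp
qed

lemma J_cong:
  assumes "C1L P" "C1L Q" "\<And>q. q \<in> L \<Longrightarrow> P q = Q q"
  shows "J P = J Q"
  unfolding J_def
  by (rule Bochner_Integration.integral_cong[OF refl])
    (use integrand_cong[OF assms(1,2) closed_empty] assms(3) in \<open>auto simp: space_slag_volume\<close>)

text \<open>The effect of one modification: off the compact set \<open>S\<close> nothing changes,
  and around \<open>S\<close> both maps run in one coordinate ball, where
  \<open>integral_pull_diff\<close> applies.\<close>

lemma J_eq:
  assumes P: "C1L P" and Q: "C1L Q" and i: "i < N" and C: "C \<in> A" and B: "ball z R \<subseteq> snd C ` (fst C \<inter> U)"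
    and S: "compact S" "S \<subseteq> \<sigma> i ` V i" "\<And>q. q \<in> S \<Longrightarrow> P q \<in> ball_in C z R \<and> Q q \<in> ball_in C z R"
    and eq: "\<And>q. q \<in> L - S \<Longrightarrow> P q = Q q"
  shows "J P = J Q"
proof -
  note lpi = lp[OF i]
  have Pi: "C1_map A (V i) (P \<circ> \<sigma> i)" and Qi: "C1_map A (V i) (Q \<circ> \<sigma> i)" using P Q i by (auto simp: C1L_def)
  \<comment> \<open>On the shrunken patch both maps take values in the ball throughout; it still
    contains the parameters of \<open>S\<close>.\<close>
  define V' where "V' = (V i \<inter> (P \<circ> \<sigma> i) -` ball_in C z R) \<inter> (V i \<inter> (Q \<circ> \<sigma> i) -` ball_in C z R)"
  have V': "open V'" "V' \<subseteq> V i"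
    unfolding V'_def
    using open_Int[OF C1_map_preimage_open[OF Pi local_paramD(1)[OF lpi] open_ball_in[OF C]]
        C1_map_preimage_open[OF Qi local_paramD(1)[OF lpi] open_ball_in[OF C]]] by auto
  obtain r where r: "homeomorphism (V i) (\<sigma> i ` V i) (\<sigma> i) r" using lpi by (auto simp: local_param_def)
  define K where "K = r ` S"
  have K: "compact K" unfolding K_def
    using r S(1,2) continuous_on_subset by (intro compact_continuous_image) (auto simp: homeomorphism_def)
  have KS: "x \<in> K \<longleftrightarrow> \<sigma> i x \<in> S" if "x \<in> V i" for x
    using that S(2) homeomorphism_apply1[OF r] homeomorphism_apply2[OF r] unfolding K_def by force
  have KV: "K \<subseteq> V'"
  proof
    fix x assume x: "x \<in> K"
    then have xV: "x \<in> V i" using S(2) homeomorphism_apply1[OF r] unfolding K_def by force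
    then show "x \<in> V'" using KS[OF xV] x S(3) by (auto simp: V'_def)
  qed
  have op: "oriented_param A \<phi> L V' (\<sigma> i)"
    using local_param_subset[OF lpi V'] oriented_paramD(2)[OF param[OF i]] V'(2) by (auto simp: oriented_param_def)
  have SV: "S \<subseteq> \<sigma> i ` V'"
  proof
    fix q assume q: "q \<in> S"
    then have "\<sigma> i (r q) = q" using S(2) homeomorphism_apply2[OF r] by blast
    moreover have "r q \<in> V'" using q KV by (auto simp: K_def)
    ultimately show "q \<in> \<sigma> i ` V'" by force
  qed
  have clS: "closed S" using S(1) compact_imp_closed by blast
  let ?h = "\<lambda>p. integrand P p - integrand Q p"
  have "J P - J Q = (LINT p|slag_volume A \<phi> L. ?h p)"
    unfolding J_def using integrable_integrand[OF P] integrable_integrand[OF Q] by simp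
  also have "\<dots> = (LINT p:\<sigma> i ` V'|slag_volume A \<phi> L. ?h p)"
    unfolding set_lebesgue_integral_def
  proof (rule Bochner_Integration.integral_cong[OF refl])
    fix p assume "p \<in> space (slag_volume A \<phi> L)"
    then have pL: "p \<in> L" by (simp add: space_slag_volume)
    show "?h p = indicator (\<sigma> i ` V') p *\<^sub>R ?h p"
    proof (cases "p \<in> \<sigma> i ` V'")
      case False
      then have "integrand P p = integrand Q p" using SV pL by (intro integrand_cong[OF P Q clS eq]) auto
      then show ?thesis by simp
    qed simp
  qed
  also have "\<dots> = (LINT x:V'|lborel. volume_density A \<phi> (\<sigma> i) x *\<^sub>R ?h (\<sigma> i x))"
    using measurable_integrand[OF P] measurable_integrand[OF Q] by (intro integral_slag_volume[OF op]) auto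
  also have "\<dots> = (LINT x:V'|lborel. (f ((P \<circ> \<sigma> i) x) * pull A \<phi> (P \<circ> \<sigma> i) x - f ((Q \<circ> \<sigma> i) x) * pull A \<phi> (Q \<circ> \<sigma> i) x))"
    unfolding set_lebesgue_integral_def
    by (intro Bochner_Integration.integral_cong refl)
      (use V'(2) integrand_param[OF P i] integrand_param[OF Q i] in \<open>auto simp: scaleR_diff_right split: split_indicator\<close>)
  also have "\<dots> = 0"
  proof (rule integral_pull_diff[OF f C B V'(1)])
    show "C1_map A V' (P \<circ> \<sigma> i)" "C1_map A V' (Q \<circ> \<sigma> i)" using C1_map_subset[OF Pi V'(2)] C1_map_subset[OF Qi V'(2)] .
    show "(P \<circ> \<sigma> i) ` V' \<subseteq> fst C \<inter> snd C -` ball z R" "(Q \<circ> \<sigma> i) ` V' \<subseteq> fst C \<inter> snd C -` ball z R"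
      by (auto simp: V'_def ball_in_def)
    show "(P \<circ> \<sigma> i) x = (Q \<circ> \<sigma> i) x" if "x \<in> V' - K" for x
      using that KS[of x] V'(2) local_paramD(4)[OF lpi] by (auto intro!: eq)
  qed (use K KV in auto)
  finally show ?thesis by simp
qed

text \<open>Neighbourhoods of the identity in the compact-open topology.\<close>

definition near_id :: "('m \<Rightarrow> 'm) filter" where
  "near_id = (INF (K, X)\<in>{(K, X). compact K \<and> K \<subseteq> L \<and> open X \<and> K \<subseteq> X}. principal {Q. Q ` K \<subseteq> X})"

lemma eventually_near_id:
  assumes "compact K" "K \<subseteq> L" "open X" "K \<subseteq> X"
  shows "eventually (\<lambda>Q. Q ` K \<subseteq> X) near_id"
  unfolding near_id_def
  by (rule eventually_INF1[of "(K, X)"]) (use assms in \<open>auto simp: eventually_principal\<close>)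

lemma filterlim_near_id:
  assumes "\<And>K X. compact K \<Longrightarrow> K \<subseteq> L \<Longrightarrow> open X \<Longrightarrow> K \<subseteq> X \<Longrightarrow> eventually (\<lambda>Q. T Q ` K \<subseteq> X) F"
  shows "filterlim T near_id F"
  unfolding near_id_def filterlim_INF using assms by (auto simp: filterlim_principal)

lemma chart_ball:
  assumes C: "C \<in> A" and p: "p \<in> fst C" "p \<in> X" "open X"
  obtains e where "e > 0" "ball (snd C p) e \<subseteq> snd C ` (fst C \<inter> X)"
  using openE[OF open_chart_image[OF C p(3)], of "snd C p"] p by auto

text \<open>Small compact pieces on which staying in a convex coordinate ball keeps a map inside \<open>X\<close>.\<close>

lemma convex_refinement:
  assumes C: "C \<in> A" and K: "compact K" "K \<subseteq> fst C" "K \<subseteq> X" and X: "open X"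
  obtains I :: "'m set" and T e where "finite I" "\<And>p. p \<in> I \<Longrightarrow> compact (T p)" "\<And>p. p \<in> I \<Longrightarrow> T p \<subseteq> K"
    "\<And>p. p \<in> I \<Longrightarrow> T p \<subseteq> ball_in C (snd C p) (e p)"
    "\<And>p. p \<in> I \<Longrightarrow> ball (snd C p) (e p) \<subseteq> snd C ` (fst C \<inter> X)" "K \<subseteq> (\<Union>p\<in>I. T p)"
proof -
  have "\<exists>e>0. ball (snd C p) e \<subseteq> snd C ` (fst C \<inter> X)" if "p \<in> K" for p
  proof -
    have p: "p \<in> fst C" "p \<in> X" using that K by auto
    obtain e where "e > 0" "ball (snd C p) e \<subseteq> snd C ` (fst C \<inter> X)" by (rule chart_ball[OF C p X])
    then show ?thesis by blast
  qed
  then obtain e where e: "\<And>p. p \<in> K \<Longrightarrow> e p > 0" "\<And>p. p \<in> K \<Longrightarrow> ball (snd C p) (e p) \<subseteq> snd C ` (fst C \<inter> X)" by metis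
  have o: "\<And>p. p \<in> K \<Longrightarrow> open (ball_in C (snd C p) (e p / 2))" by (rule open_ball_in[OF C])
  have cov: "K \<subseteq> (\<Union>p\<in>K. ball_in C (snd C p) (e p / 2))"
  proof
    fix p assume p: "p \<in> K"
    then have "p \<in> ball_in C (snd C p) (e p / 2)" using e(1)[OF p] K by (auto simp: ball_in_def)
    then show "p \<in> (\<Union>p\<in>K. ball_in C (snd C p) (e p / 2))" using p by blast
  qed
  obtain I where I: "I \<subseteq> K" "finite I" "K \<subseteq> (\<Union>p\<in>I. ball_in C (snd C p) (e p / 2))"
    by (rule compactE_image[OF K(1) o cov])
  define T where "T = (\<lambda>p. K \<inter> cball_in C (snd C p) (e p / 2))"
  have c1: "compact (T p)" if "p \<in> I" for p
  proof -
    have pK: "p \<in> K" using that I by blast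
    have "cball (snd C p) (e p / 2) \<subseteq> snd C ` fst C" using e[OF pK] by force
    from compact_cball_in[OF C this] show ?thesis unfolding T_def using K(1) by (intro compact_Int)
  qed
  have c2: "T p \<subseteq> ball_in C (snd C p) (e p)" if "p \<in> I" for p
    using e(1)[of p] that I by (auto simp: T_def ball_in_def cball_in_def)
  have c3: "K \<subseteq> (\<Union>p\<in>I. T p)"
  proof
    fix q assume q: "q \<in> K"
    then obtain p where "p \<in> I" "q \<in> ball_in C (snd C p) (e p / 2)" using I(3) by blast
    then have "q \<in> T p" using q by (auto simp: T_def ball_in_def cball_in_def)
    then show "q \<in> (\<Union>p\<in>I. T p)" using \<open>p \<in> I\<close> by blast
  qed
  show thesis
    by (rule that[OF I(2) c1 _ c2 _ c3]) (use I(1) e(2) in \<open>auto simp: T_def\<close>)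
qed

text \<open>The part of \<open>L\<close> in the ball of half radius lies in a single patch, so that
  a modification supported there can be computed in one parameter domain.\<close>

lemma good_chart:
  assumes "p \<in> L"
  obtains C R i where "C \<in> A" "R > 0" "i < N" "p \<in> fst C" "ball (snd C p) R \<subseteq> snd C ` (fst C \<inter> U)"
    "L \<inter> cball_in C (snd C p) (R / 2) \<subseteq> \<sigma> i ` V i"
proof -
  obtain i where i: "i < N" "p \<in> \<sigma> i ` V i" using assms cover by blast
  have "openin (top_of_set L) (\<sigma> i ` V i)" using lp[OF i(1)] by (simp add: local_param_def)
  then obtain X where X: "open X" "\<sigma> i ` V i = L \<inter> X" unfolding openin_open by blast
  obtain C where C: "C \<in> A" "p \<in> fst C" by (rule chart_cover)
  have pX: "p \<in> U \<inter> X" "open (U \<inter> X)" using assms U X i by auto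
  obtain R where R: "R > 0" "ball (snd C p) R \<subseteq> snd C ` (fst C \<inter> (U \<inter> X))"
    by (rule chart_ball[OF C pX])
  show thesis
  proof (rule that[OF C(1) R(1) i(1) C(2)])
    show "ball (snd C p) R \<subseteq> snd C ` (fst C \<inter> U)" using R(2) by blast
    show "L \<inter> cball_in C (snd C p) (R / 2) \<subseteq> \<sigma> i ` V i"
    proof
      fix q assume q: "q \<in> L \<inter> cball_in C (snd C p) (R / 2)"
      then have "snd C q \<in> ball (snd C p) R" using R(1) by (auto simp: cball_in_def)
      then obtain q' where q': "q' \<in> fst C" "q' \<in> X" "snd C q = snd C q'" using R(2) by blast
      then have "q = q'" using q chart_homeo(3)[OF C(1)] by (auto simp: cball_in_def inj_on_def)
      then show "q \<in> \<sigma> i ` V i" using q q' X(2) by auto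
    qed
  qed
qed

text \<open>Induction over a finite cover by balls. The operator \<open>T\<close> sends
  \<open>Q\<close> to a map obtained from the identity by moving it towards \<open>Q\<close> on the
  balls treated so far. Continuity of \<open>T\<close> at the identity has to be carried along: the
  next move needs both \<open>T Q\<close> and \<open>Q\<close> to send its support into one
  coordinate ball.\<close>

lemma J_near_id: "eventually (\<lambda>Q. C1L Q \<longrightarrow> J Q = J id) near_id"
proof -
  have "\<exists>C R i. C \<in> A \<and> R > 0 \<and> i < N \<and> p \<in> fst C \<and> ball (snd C p) R \<subseteq> snd C ` (fst C \<inter> U) \<and>
    L \<inter> cball_in C (snd C p) (R / 2) \<subseteq> \<sigma> i ` V i" if "p \<in> L" for p
    using good_chart[OF that] by metis
  then obtain C R i where c: "\<And>p. p \<in> L \<Longrightarrow> C p \<in> A \<and> R p > (0::real) \<and> i p < N \<and> p \<in> fst (C p) \<and>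
    ball (snd (C p) p) (R p) \<subseteq> snd (C p) ` (fst (C p) \<inter> U) \<and> L \<inter> cball_in (C p) (snd (C p) p) (R p / 2) \<subseteq> \<sigma> (i p) ` V (i p)"
    by metis
  \<comment> \<open>The bump of radius R / 2 is 1 on the ball of radius R / 4. These quarter balls
    are where a move attains its target, so they are the ones that must cover
    \<open>L\<close>.\<close>
  define B where "B = (\<lambda>p. ball_in (C p) (snd (C p) p) (R p / 2 / 2))"
  have cov: "L \<subseteq> (\<Union>p\<in>L. B p)"
  proof
    fix p assume p: "p \<in> L"
    then have "p \<in> B p" using c[OF p] by (simp add: B_def ball_in_def)
    then show "p \<in> (\<Union>p\<in>L. B p)" using p by blast
  qed
  have o: "open (B p)" if "p \<in> L" for p using c[OF that] by (simp add: B_def open_ball_in)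
  obtain F where F: "F \<subseteq> L" "finite F" "L \<subseteq> (\<Union>p\<in>F. B p)"
    by (rule compactE_image[OF compact o cov])
  have "\<exists>T. filterlim T near_id near_id \<and>
      eventually (\<lambda>Q. C1L Q \<longrightarrow> C1L (T Q) \<and> J (T Q) = J id \<and> (\<forall>q\<in>L \<inter> (\<Union>p\<in>F. B p). T Q q = Q q)) near_id"
    using F(2,1)
  proof (induction F rule: finite_induct)
    case empty
    have "filterlim (\<lambda>_. id) near_id near_id" by (rule filterlim_near_id) simp
    moreover have "eventually (\<lambda>Q. C1L Q \<longrightarrow> C1L id \<and> J id = J id \<and> (\<forall>q\<in>L \<inter> (\<Union>p\<in>{}. B p). id q = Q q)) near_id"
      using C1L_id by (intro always_eventually) blast
    ultimately show ?case by blast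
  next
    case (insert p F)
    have FL: "F \<subseteq> L" using insert.prems by simp
    obtain T where T: "filterlim T near_id near_id"
      "eventually (\<lambda>Q. C1L Q \<longrightarrow> C1L (T Q) \<and> J (T Q) = J id \<and> (\<forall>q\<in>L \<inter> (\<Union>p\<in>F. B p). T Q q = Q q)) near_id"
      using insert.IH[OF FL] by blast
    define C' z R' where "C' = C p" and "z = snd (C p) p" and "R' = R p"
    define r where "r = R' / 2"
    define S where "S = L \<inter> cball_in C' z r"
    have pL: "p \<in> L" using insert.prems by simp
    have C': "C' \<in> A" "R' > 0" "i p < N" "ball z R' \<subseteq> snd C' ` (fst C' \<inter> U)" "S \<subseteq> \<sigma> (i p) ` V (i p)"
      using c[OF pL] by (auto simp: C'_def z_def R'_def S_def r_def)
    have r: "0 < r" "r < R'" using C'(2) by (auto simp: r_def)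
    have ballC: "ball z R' \<subseteq> snd C' ` fst C'" using C'(4) by blast
    have cb: "cball z r \<subseteq> snd C' ` fst C'" using ballC r by auto
    have S: "compact S" unfolding S_def using compact compact_cball_in[OF C'(1) cb] by (rule compact_Int)
    have SL: "S \<subseteq> L" "S \<subseteq> fst C'" "S \<subseteq> ball_in C' z R'" using r by (auto simp: S_def cball_in_def ball_in_def)
    define T' where "T' = (\<lambda>Q. move C' z r (T Q) Q)"
    have ev_T: "eventually (\<lambda>Q. T Q ` K \<subseteq> X \<and> Q ` K \<subseteq> X) near_id"
      if "compact K" "K \<subseteq> L" "open X" "K \<subseteq> X" for K X
      using eventually_conj[OF filterlim_iff[THEN iffD1, OF T(1), rule_format, OF eventually_near_id[OF that]] eventually_near_id[OF that]] .
    have ev_S: "eventually (\<lambda>Q. T Q ` S \<subseteq> ball_in C' z R' \<and> Q ` S \<subseteq> ball_in C' z R') near_id"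
      by (rule ev_T[OF S SL(1) open_ball_in[OF C'(1)] SL(3)])
    \<comment> \<open>On the support, \<open>K\<close> is cut into small compact pieces whose
      coordinate balls lie over \<open>X\<close>. If \<open>T Q\<close> and \<open>Q\<close> both
      send a piece into its ball, so does the convex combination.\<close>
    have lim: "filterlim T' near_id near_id"
    proof (rule filterlim_near_id)
      fix K X assume K: "compact K" "K \<subseteq> L" "open X" "K \<subseteq> X"
      have KS: "compact (K \<inter> S)" "K \<inter> S \<subseteq> fst C'" "K \<inter> S \<subseteq> X" using K S SL by auto
      obtain I :: "'m set" and D e where I: "finite I" "\<And>p. p \<in> I \<Longrightarrow> compact (D p)" "\<And>p. p \<in> I \<Longrightarrow> D p \<subseteq> K \<inter> S"
        "\<And>p. p \<in> I \<Longrightarrow> D p \<subseteq> ball_in C' (snd C' p) (e p)"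
        "\<And>p. p \<in> I \<Longrightarrow> ball (snd C' p) (e p) \<subseteq> snd C' ` (fst C' \<inter> X)" "K \<inter> S \<subseteq> (\<Union>p\<in>I. D p)"
        using convex_refinement[OF C'(1) KS K(3)] by metis
      have "eventually (\<lambda>Q. \<forall>p\<in>I. T Q ` D p \<subseteq> ball_in C' (snd C' p) (e p) \<and> Q ` D p \<subseteq> ball_in C' (snd C' p) (e p)) near_id"
      proof (rule eventually_ball_finite[OF I(1)], rule ballI)
        fix p assume p: "p \<in> I"
        have "D p \<subseteq> L" using I(3)[OF p] K(2) by blast
        then show "eventually (\<lambda>Q. T Q ` D p \<subseteq> ball_in C' (snd C' p) (e p) \<and> Q ` D p \<subseteq> ball_in C' (snd C' p) (e p)) near_id"
          by (intro ev_T I(2,4)[OF p] open_ball_in C')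
      qed
      with ev_T[OF K] show "eventually (\<lambda>Q. T' Q ` K \<subseteq> X) near_id"
      proof eventually_elim
        case (elim Q)
        show ?case
        proof (intro image_subsetI)
          fix q assume q: "q \<in> K"
          show "T' Q q \<in> X"
          proof (cases "q \<in> S")
            case True
            then obtain p' where p': "p' \<in> I" "q \<in> D p'" using I(6) q by blast
            then have "T Q q \<in> ball_in C' (snd C' p') (e p')" "Q q \<in> ball_in C' (snd C' p') (e p')" using elim by auto
            from move_in(2)[where P="T Q" and Q=Q and q=q, OF C'(1) I(5)[OF p'(1)] this]
            show ?thesis by (simp add: T'_def)
          next
            case False
            then have "T' Q q = T Q q" unfolding T'_def using q K(2) by (intro move_outside r) (auto simp: S_def)
            then show ?thesis using elim q by auto
          qed
        qed
      qed
    qed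
    moreover have "eventually (\<lambda>Q. C1L Q \<longrightarrow> C1L (T' Q) \<and> J (T' Q) = J id \<and>
        (\<forall>q\<in>L \<inter> (\<Union>p\<in>insert p F. B p). T' Q q = Q q)) near_id"
      using T(2) ev_S
    proof eventually_elim
      case (elim Q)
      show ?case
      proof (intro impI)
        assume Q: "C1L Q"
        then have TQ: "C1L (T Q)" "J (T Q) = J id" "\<And>q. q \<in> L \<inter> (\<Union>p\<in>F. B p) \<Longrightarrow> T Q q = Q q" using elim by auto
        have inb: "T Q q \<in> ball_in C' z R'" "Q q \<in> ball_in C' z R'" if "q \<in> S" for q using elim that by auto
        have out: "T' Q q = T Q q" if "q \<in> L - S" for q
          unfolding T'_def using that by (intro move_outside r) (auto simp: S_def)
        have inS: "T' Q q \<in> ball_in C' z R'" "T' Q q \<in> U" if "q \<in> S" for q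
        proof -
          note m = move_in[where P="T Q" and Q=Q and q=q and z=z and r=r, OF C'(1,4) inb(1)[OF that] inb(2)[OF that]]
          show "T' Q q \<in> ball_in C' z R'" "T' Q q \<in> U"
            unfolding T'_def ball_in_def using m(1) m(2) m(3) by auto
        qed
        have "C1L (T' Q)"
          unfolding C1L_def
        proof (intro conjI allI impI)
          fix j assume j: "j < N"
          show "C1_map A (V j) (T' Q \<circ> \<sigma> j)"
            unfolding T'_def
          proof (rule C1_map_move[OF C'(1) ballC r local_paramD(1,3)[OF lp[OF j]]])
            show "C1_map A (V j) (T Q \<circ> \<sigma> j)" "C1_map A (V j) (Q \<circ> \<sigma> j)" using TQ(1) Q j by (auto simp: C1L_def)
            fix x assume "x \<in> V j" "\<sigma> j x \<in> cball_in C' z r"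
            then have "\<sigma> j x \<in> S" using local_paramD(4)[OF lp[OF j]] by (auto simp: S_def)
            then show "T Q (\<sigma> j x) \<in> ball_in C' z R' \<and> Q (\<sigma> j x) \<in> ball_in C' z R'" using inb by blast
          qed
        next
          show "T' Q ` L \<subseteq> U" using inS(2) out TQ(1) by (force simp: C1L_def)
        qed
        moreover have "J (T' Q) = J (T Q)"
          using calculation TQ(1) inS inb out by (intro J_eq[OF _ _ C'(3,1,4) S C'(5)]) auto
        moreover have "T' Q q = Q q" if q: "q \<in> L" "q \<in> (\<Union>p\<in>insert p F. B p)" for q
        proof (cases "q \<in> S")
          case True
          \<comment> \<open>Either the bump is 1 at \<open>q\<close>, or \<open>q\<close> belongs to
            an earlier ball and was already moved to \<open>Q q\<close>; interpolation between equal
            points changes nothing.\<close>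
          have "q \<in> B p \<or> T Q q = Q q" using q TQ(3) by auto
          then have "mbump C' z r q = 1 \<or> T Q q = Q q"
            using mbump_eq_1[OF r(1), where C=C' and z=z and q=q] by (auto simp: B_def C'_def z_def R'_def r_def)
          then show ?thesis unfolding T'_def using inb[OF True] by (intro move_target C') (auto simp: ball_in_def)
        next
          case False
          then have "q \<notin> B p" using q r C'(2) by (auto simp: S_def B_def C'_def z_def R'_def r_def ball_in_def cball_in_def)
          then show ?thesis using q TQ(3) out[of q] False by auto
        qed
        ultimately show "C1L (T' Q) \<and> J (T' Q) = J id \<and> (\<forall>q\<in>L \<inter> (\<Union>p\<in>insert p F. B p). T' Q q = Q q)"
          using TQ(2) by auto
      qed
    qed
    ultimately show ?case by blast
  qed
  then obtain T where "eventually (\<lambda>Q. C1L Q \<longrightarrow> C1L (T Q) \<and> J (T Q) = J id \<and> (\<forall>q\<in>L \<inter> (\<Union>p\<in>F. B p). T Q q = Q q)) near_id" by blast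
  then show ?thesis
  proof eventually_elim
    case (elim Q)
    show ?case
    proof
      assume Q: "C1L Q"
      \<comment> \<open>The balls cover \<open>L\<close>, so at the end \<open>T Q\<close> and
        \<open>Q\<close> agree on all of it.\<close>
      then have "J (T Q) = J Q" using elim F(3) by (intro J_cong) auto
      then show "J Q = J id" using elim Q by simp
    qed
  qed
qed

text \<open>The volume measure of the image is the pushforward under \<open>Q\<close> of the volume
  measure of \<open>L\<close> weighted by \<open>ratio Q\<close>; by uniqueness this only has to be
  checked on the given patches. Realness and orientation make the weight a nonnegative real
  number.\<close>

lemma slag_integral_image:
  assumes Q: "C1L Q" and inj: "inj_on Q L" and op: "\<And>i. i < N \<Longrightarrow> oriented_param A \<phi> (Q ` L) (V i) (Q \<circ> \<sigma> i)"
    and real: "\<And>i x. i < N \<Longrightarrow> x \<in> V i \<Longrightarrow> Im (pull A \<phi> (Q \<circ> \<sigma> i) x) = 0"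
    and cont: "continuous_on L Q"
  shows "slag_integral A \<phi> f (Q ` L) = J Q"
proof -
  interpret Q: oriented_cover A \<phi> "Q ` L" N V "\<lambda>i. Q \<circ> \<sigma> i"
  proof (unfold_locales, rule op)
    show "Q ` L \<subseteq> (\<Union>i<N. (Q \<circ> \<sigma> i) ` V i)"
      unfolding image_comp[symmetric] image_UN[symmetric] using cover by (rule image_mono)
  qed
  define a where "a = (\<lambda>p. Re (ratio Q p))"
  have ra: "ratio Q p = of_real (a p)" "a p \<ge> 0"
    "\<And>i x. i < N \<Longrightarrow> x \<in> V i \<Longrightarrow> p = \<sigma> i x \<Longrightarrow> volume_density A \<phi> (\<sigma> i) x * a p = volume_density A \<phi> (Q \<circ> \<sigma> i) x"
    if p: "p \<in> L" for p
  proof -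
    have *: "volume_density A \<phi> (\<sigma> i) x * a p = volume_density A \<phi> (Q \<circ> \<sigma> i) x \<and> Im (ratio Q p) = 0 \<and> a p \<ge> 0"
      if i: "i < N" "x \<in> V i" "p = \<sigma> i x" for i x
    proof -
      have eq: "pull A \<phi> (Q \<circ> \<sigma> i) x = of_real (volume_density A \<phi> (\<sigma> i) x) * ratio Q p"
        unfolding i(3) using Q i by (intro ratio_param) (auto simp: C1L_def)
      have pos: "volume_density A \<phi> (\<sigma> i) x > 0" "volume_density A \<phi> (Q \<circ> \<sigma> i) x > 0"
        using oriented_paramD(2)[OF param[OF i(1)] i(2)] oriented_paramD(2)[OF op[OF i(1)] i(2)] .
      have 1: "volume_density A \<phi> (\<sigma> i) x * a p = volume_density A \<phi> (Q \<circ> \<sigma> i) x"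
        unfolding volume_density_pull[of A \<phi> "Q \<circ> \<sigma> i"] eq a_def by simp
      have 2: "Im (ratio Q p) = 0" using real[OF i(1,2)] eq pos(1) by simp
      have "a p > 0" using 1 pos by (metis zero_less_mult_pos)
      then show ?thesis using 1 2 by simp
    qed
    obtain i x where "i < N" "x \<in> V i" "p = \<sigma> i x" using cover p by blast
    from *[OF this] show "ratio Q p = of_real (a p)" "a p \<ge> 0" by (simp_all add: a_def complex_eq_iff)
    show "\<And>i x. i < N \<Longrightarrow> x \<in> V i \<Longrightarrow> p = \<sigma> i x \<Longrightarrow> volume_density A \<phi> (\<sigma> i) x * a p = volume_density A \<phi> (Q \<circ> \<sigma> i) x"
      using * by blast
  qed
  have conta: "continuous_on L a"
  proof (rule continuous_on_cover)
    fix i assume i: "i < N"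
    have "continuous_on (V i) (\<lambda>x. volume_density A \<phi> (Q \<circ> \<sigma> i) x / volume_density A \<phi> (\<sigma> i) x)"
      using oriented_paramD(2)[OF param[OF i]]
      by (intro continuous_on_divide continuous_on_volume_density[OF lp[OF i]]
          continuous_on_volume_density[OF oriented_paramD(1)[OF op[OF i]]]) (auto simp: less_imp_neq[symmetric])
    then show "continuous_on (V i) (\<lambda>x. a (\<sigma> i x))"
    proof (rule continuous_on_eq)
      fix x assume x: "x \<in> V i"
      have "\<sigma> i x \<in> L" using local_paramD(4)[OF lp[OF i]] x by blast
      from ra(3)[OF this i x refl] oriented_paramD(2)[OF param[OF i] x]
      show "volume_density A \<phi> (Q \<circ> \<sigma> i) x / volume_density A \<phi> (\<sigma> i) x = a (\<sigma> i x)"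
        by (simp add: field_simps)
    qed
  qed
  have ma: "a \<in> borel_measurable (restrict_space borel L)" using conta by (rule borel_measurable_continuous_on_restrict)
  let ?M = "slag_volume A \<phi> L"
  let ?D = "density ?M (\<lambda>p. ennreal (a p))"
  have mQ: "Q \<in> measurable (restrict_space borel L) (restrict_space borel (Q ` L))"
    using cont by (intro measurable_restrict_space2 borel_measurable_continuous_on_restrict) (auto simp: space_restrict_space)
  have mQD: "Q \<in> measurable ?D (restrict_space borel (Q ` L))"
    using mQ by (simp add: measurable_cong_sets[OF sets_density refl] measurable_cong_sets[OF sets_slag_volume refl])
  have ma': "a \<in> borel_measurable ?M" using ma by (simp add: measurable_cong_sets[OF sets_slag_volume refl])
  have "slag_volume A \<phi> (Q ` L) = distr ?D (restrict_space borel (Q ` L)) Q"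
  proof (rule Q.slag_volume_unique)
    fix i assume i: "i < N"
    show "represents_volume (distr ?D (restrict_space borel (Q ` L)) Q) (V i) (Q \<circ> \<sigma> i)"
      unfolding represents_volume_def
    proof (intro ballI impI)
      fix B :: "(real^'n) set" assume B: "B \<in> sets borel" "B \<subseteq> V i"
      have s: "(Q \<circ> \<sigma> i) ` B \<in> sets (restrict_space borel (Q ` L))"
        by (rule param_image_sets[OF oriented_paramD(1)[OF op[OF i]] B])
      have sB: "\<sigma> i ` B \<in> sets (restrict_space borel L)" by (rule param_image_sets[OF lp[OF i] B])
      have sBL: "\<sigma> i ` B \<subseteq> L" using B(2) local_paramD(4)[OF lp[OF i]] by blast
      \<comment> \<open>Injectivity of \<open>Q\<close> on \<open>L\<close> enters here.\<close>
      have "Q -` ((Q \<circ> \<sigma> i) ` B) \<inter> space ?D = \<sigma> i ` B"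
        unfolding image_comp[symmetric] space_density space_slag_volume
        using inj_on_image_mem_iff[OF inj _ sBL] sBL by blast
      then have "emeasure (distr ?D (restrict_space borel (Q ` L)) Q) ((Q \<circ> \<sigma> i) ` B) = emeasure ?D (\<sigma> i ` B)"
        using mQD s by (subst emeasure_distr) auto
      also have "\<dots> = (\<integral>\<^sup>+p\<in>\<sigma> i ` B. ennreal (a p) \<partial>?M)"
        using ma' sB by (intro emeasure_density) (auto simp: sets_slag_volume)
      also have "\<dots> = (\<integral>\<^sup>+p\<in>\<sigma> i ` V i. (ennreal (a p) * indicator (\<sigma> i ` B) p) \<partial>?M)"
        using B(2) by (intro nn_integral_cong) (auto split: split_indicator)
      also have "\<dots> = (\<integral>\<^sup>+x\<in>V i. (ennreal (volume_density A \<phi> (\<sigma> i) x) * (ennreal (a (\<sigma> i x)) * indicator (\<sigma> i ` B) (\<sigma> i x))) \<partial>lborel)"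
        using ma sB by (intro nn_integral_slag_volume[OF param[OF i]]) auto
      also have "\<dots> = (\<integral>\<^sup>+x\<in>B. ennreal (volume_density A \<phi> (Q \<circ> \<sigma> i) x) \<partial>lborel)"
      proof (rule nn_integral_cong)
        fix x
        show "ennreal (volume_density A \<phi> (\<sigma> i) x) * (ennreal (a (\<sigma> i x)) * indicator (\<sigma> i ` B) (\<sigma> i x)) * indicator (V i) x
          = ennreal (volume_density A \<phi> (Q \<circ> \<sigma> i) x) * indicator B x"
        proof (cases "x \<in> V i")
          case True
          have "\<sigma> i x \<in> \<sigma> i ` B \<longleftrightarrow> x \<in> B" using True B(2) local_paramD(5)[OF lp[OF i]] by (auto simp: inj_on_def)
          moreover have "\<sigma> i x \<in> L" using local_paramD(4)[OF lp[OF i]] True by blast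
          note ra(3)[OF this i True refl] ra(2)[OF this]
          moreover have "volume_density A \<phi> (\<sigma> i) x \<ge> 0" using oriented_paramD(2)[OF param[OF i] True] by simp
          ultimately show ?thesis using True by (auto simp: ennreal_mult[symmetric] split: split_indicator)
        next
          case False
          then show ?thesis using B(2) by (auto split: split_indicator)
        qed
      qed
      finally show "emeasure (distr ?D (restrict_space borel (Q ` L)) Q) ((Q \<circ> \<sigma> i) ` B)
        = (\<integral>\<^sup>+x\<in>B. ennreal (volume_density A \<phi> (Q \<circ> \<sigma> i) x) \<partial>lborel)" .
    qed
  qed simp
  then have "slag_integral A \<phi> f (Q ` L) = (LINT q|distr ?D (restrict_space borel (Q ` L)) Q. f q)"
    by (simp add: slag_integral_def)
  also have "\<dots> = (LINT p|?D. f (Q p))"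
  proof (rule integral_distr[OF mQD])
    show "f \<in> borel_measurable (restrict_space borel (Q ` L))"
      using holomorphic_fun_continuous[OF f U(1)] Q continuous_on_subset
      by (intro borel_measurable_continuous_on_restrict) (auto simp: C1L_def)
  qed
  also have "\<dots> = (LINT p|?M. a p *\<^sub>R f (Q p))"
  proof (rule integral_density)
    have "continuous_on L (\<lambda>p. f (Q p))"
      using Q by (intro continuous_on_compose2[OF holomorphic_fun_continuous[OF f U(1)] cont]) (auto simp: C1L_def)
    then show "(\<lambda>p. f (Q p)) \<in> borel_measurable ?M"
      by (simp add: measurable_cong_sets[OF sets_slag_volume refl] borel_measurable_continuous_on_restrict)
  qed (use ma' ra(2) in \<open>auto simp: space_slag_volume intro!: AE_I2\<close>)
  also have "\<dots> = J Q"
    unfolding J_def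
    by (rule Bochner_Integration.integral_cong)
      (auto simp: space_slag_volume integrand_def ra(1) scaleR_conv_of_real[of _ "_::complex"])
  finally show ?thesis .
qed

end

section \<open>Reparametrizations\<close>

context catlas
begin

text \<open>Smoothness of \<open>\<psi>\<close> is known only along local parametrizations, and
  \<open>\<xi>\<close> need not be one. By \<open>param_lift\<close>, locally \<open>\<xi>\<close>
  is a parametrization preceded by a smooth map of parameters.\<close>

lemma smooth_map_compose_submanifold:
  assumes L: "submanifold A L" and \<psi>: "\<And>V \<sigma>. local_param A L V \<sigma> \<Longrightarrow> smooth_map A V (\<psi> \<circ> \<sigma>)"
    and V: "open V" and \<xi>: "smooth_map A V \<xi>" "\<xi> ` V \<subseteq> L"
  shows "smooth_map A V (\<psi> \<circ> \<xi>)"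
proof -
  have loc: "\<exists>T. open T \<and> x \<in> T \<and> T \<subseteq> V \<and> continuous_on T (\<psi> \<circ> \<xi>) \<and>
      (\<forall>C\<in>A. \<forall>k. Ck_on k (T \<inter> (\<psi> \<circ> \<xi>) -` fst C) (snd C \<circ> (\<psi> \<circ> \<xi>)))" if x: "x \<in> V" for x
  proof -
    have "\<xi> x \<in> L" using x \<xi>(2) by blast
    then obtain W \<tau> where \<tau>: "local_param A L W \<tau>" "\<xi> x \<in> \<tau> ` W" using L unfolding submanifold_def by blast
    define T where "T = V \<inter> \<xi> -` (\<tau> ` W)"
    define g where "g = inv_into W \<tau> \<circ> \<xi>"
    note lift = param_lift[OF \<tau>(1) V \<xi>, folded T_def g_def]
    have W: "open W" using \<tau>(1) by (simp add: local_param_def)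
    have sm: "smooth_map A W (\<psi> \<circ> \<tau>)" by (rule \<psi>[OF \<tau>(1)])
    have eq: "(\<psi> \<circ> \<tau>) (g y) = (\<psi> \<circ> \<xi>) y" if "y \<in> T" for y using lift(4)[OF that] by simp
    have "continuous_on T (\<lambda>y. (\<psi> \<circ> \<tau>) (g y))"
      using sm by (intro continuous_on_compose2[OF _ lift(2,3)]) (simp add: smooth_map_iff)
    then have c: "continuous_on T (\<psi> \<circ> \<xi>)" by (rule continuous_on_eq) (rule eq)
    have "Ck_on k (T \<inter> (\<psi> \<circ> \<xi>) -` fst C) (snd C \<circ> (\<psi> \<circ> \<xi>))" if C: "C \<in> A" for C k
    proof -
      let ?T = "T \<inter> (\<psi> \<circ> \<xi>) -` fst C" and ?W = "W \<inter> (\<psi> \<circ> \<tau>) -` fst C"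
      have oT: "open ?T" using c lift(1) chart_homeo(1)[OF C] by (intro continuous_open_preimage)
      have oW: "open ?W" using sm W chart_homeo(1)[OF C] by (intro continuous_open_preimage) (auto simp: smooth_map_iff)
      have kW: "Ck_on k ?W (snd C \<circ> (\<psi> \<circ> \<tau>))" using sm C by (simp add: smooth_map_iff)
      have kg: "Ck_on k ?T g" by (rule Ck_on_subset[OF lift(5)]) simp
      have "g ` ?T \<subseteq> ?W" using lift(3) eq by auto
      from Ck_on_compose[OF oT oW kg kW this]
      show ?thesis by (rule Ck_on_cong[OF oT, rotated]) (use eq in auto)
    qed
    then show ?thesis using lift(1) c x \<tau>(2) by (intro exI[of _ T]) (auto simp: T_def)
  qed
  have cont: "continuous_on V (\<psi> \<circ> \<xi>)"
  proof (rule continuous_at_imp_continuous_on, rule ballI)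
    fix x assume "x \<in> V"
    from loc[OF this] obtain T where "open T" "x \<in> T" "continuous_on T (\<psi> \<circ> \<xi>)" by blast
    then show "isCont (\<psi> \<circ> \<xi>) x" using continuous_on_eq_continuous_at by blast
  qed
  moreover have "Ck_on k (V \<inter> (\<psi> \<circ> \<xi>) -` fst C) (snd C \<circ> (\<psi> \<circ> \<xi>))" if C: "C \<in> A" for C k
  proof (rule Ck_on_local)
    fix x assume x: "x \<in> V \<inter> (\<psi> \<circ> \<xi>) -` fst C"
    then obtain T where T: "open T" "x \<in> T" "continuous_on T (\<psi> \<circ> \<xi>)"
      "Ck_on k (T \<inter> (\<psi> \<circ> \<xi>) -` fst C) (snd C \<circ> (\<psi> \<circ> \<xi>))" using loc[of x] C by blast
    have "open (T \<inter> (\<psi> \<circ> \<xi>) -` fst C)" using T chart_homeo(1)[OF C] by (intro continuous_open_preimage)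
    moreover have "x \<in> T \<inter> (\<psi> \<circ> \<xi>) -` fst C" using x T(2) by blast
    ultimately show "\<exists>T. open T \<and> x \<in> T \<and> Ck_on k T (snd C \<circ> (\<psi> \<circ> \<xi>))" using T(4) by blast
  qed
  ultimately show ?thesis by (simp add: smooth_map_iff)
qed

lemma diffeomorphism_id: "diffeomorphism_of A L id"
  unfolding diffeomorphism_of_def
proof (intro conjI allI impI)
  fix V \<sigma> assume lp: "local_param A L V \<sigma>"
  note b = local_paramD(1,2,4)[OF lp]
  show "smooth_map A V (id \<circ> \<sigma>)" using b(2) by simp
  show "smooth_map A V (inv_into L id \<circ> \<sigma>)"
    by (rule smooth_map_cong[OF b(1) _ b(2)]) (use b(3) in \<open>auto simp: inv_into_f_f[of id L, simplified]\<close>)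
qed simp

lemma diffeomorphism_inv:
  assumes "diffeomorphism_of A L \<psi>"
  shows "diffeomorphism_of A L (inv_into L \<psi>)"
  unfolding diffeomorphism_of_def
proof (intro conjI allI impI)
  have bij: "bij_betw \<psi> L L" using assms by (simp add: diffeomorphism_of_def)
  show "bij_betw (inv_into L \<psi>) L L" by (rule bij_betw_inv_into[OF bij])
  fix V \<sigma> assume lp: "local_param A L V \<sigma>"
  note b = local_paramD(1,2,4)[OF lp]
  have sm: "smooth_map A V (\<psi> \<circ> \<sigma>)" "smooth_map A V (inv_into L \<psi> \<circ> \<sigma>)"
    using assms lp by (simp_all add: diffeomorphism_of_def)
  show "smooth_map A V (inv_into L \<psi> \<circ> \<sigma>)" by (rule sm(2))
  show "smooth_map A V (inv_into L (inv_into L \<psi>) \<circ> \<sigma>)"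
  proof (rule smooth_map_cong[OF b(1) _ sm(1)])
    fix x assume "x \<in> V"
    then have "\<sigma> x \<in> L" using b(3) by blast
    from inv_into_inv_into_eq[OF bij this] show "(\<psi> \<circ> \<sigma>) x = (inv_into L (inv_into L \<psi>) \<circ> \<sigma>) x" by simp
  qed
qed

lemma diffeomorphism_comp:
  assumes L: "submanifold A L" and 1: "diffeomorphism_of A L \<psi>" and 2: "diffeomorphism_of A L \<theta>"
  shows "diffeomorphism_of A L (\<psi> \<circ> \<theta>)"
  unfolding diffeomorphism_of_def
proof (intro conjI allI impI)
  have b1: "bij_betw \<psi> L L" and b2: "bij_betw \<theta> L L" using 1 2 by (simp_all add: diffeomorphism_of_def)
  show bij: "bij_betw (\<psi> \<circ> \<theta>) L L" by (rule bij_betw_trans[OF b2 b1])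
  fix V \<sigma> assume lp: "local_param A L V \<sigma>"
  note b = local_paramD(1,2,4)[OF lp]
  have s: "smooth_map A V (\<psi> \<circ> \<sigma>)" "smooth_map A V (inv_into L \<psi> \<circ> \<sigma>)"
    "smooth_map A V (\<theta> \<circ> \<sigma>)" "smooth_map A V (inv_into L \<theta> \<circ> \<sigma>)"
    if "local_param A L V \<sigma>" for V \<sigma> using 1 2 that by (simp_all add: diffeomorphism_of_def)
  have im: "(\<theta> \<circ> \<sigma>) ` V \<subseteq> L" "(inv_into L \<psi> \<circ> \<sigma>) ` V \<subseteq> L"
    using b(3) bij_betw_imp_surj_on[OF b2] bij_betw_imp_surj_on[OF bij_betw_inv_into[OF b1]] by fastforce+
  show "smooth_map A V (\<psi> \<circ> \<theta> \<circ> \<sigma>)"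
    using smooth_map_compose_submanifold[OF L s(1) b(1) s(3)[OF lp] im(1)] by (simp add: comp_assoc)
  have "smooth_map A V (inv_into L \<theta> \<circ> (inv_into L \<psi> \<circ> \<sigma>))"
    by (rule smooth_map_compose_submanifold[OF L s(4) b(1) s(2)[OF lp] im(2)])
  then show "smooth_map A V (inv_into L (\<psi> \<circ> \<theta>) \<circ> \<sigma>)"
  proof (rule smooth_map_cong[OF b(1), rotated])
    fix x assume "x \<in> V"
    then have p: "\<sigma> x \<in> L" using b(3) by blast
    let ?q = "inv_into L \<theta> (inv_into L \<psi> (\<sigma> x))"
    have 1: "inv_into L \<psi> (\<sigma> x) \<in> L" using p b1 by (simp add: bij_betw_apply[OF bij_betw_inv_into])
    have 2: "?q \<in> L" using 1 b2 by (simp add: bij_betw_apply[OF bij_betw_inv_into])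
    have "(\<psi> \<circ> \<theta>) ?q = \<sigma> x"
      using bij_betw_inv_into_right[OF b1 p] bij_betw_inv_into_right[OF b2 1] by simp
    then have "inv_into L (\<psi> \<circ> \<theta>) (\<sigma> x) = ?q" using bij_betw_inv_into_left[OF bij 2] by metis
    then show "(inv_into L \<theta> \<circ> (inv_into L \<psi> \<circ> \<sigma>)) x = (inv_into L (\<psi> \<circ> \<theta>) \<circ> \<sigma>) x" by simp
  qed
qed

text \<open>Diffeomorphisms are closed under inverse and composition; for composition it matters
  that \<open>L0\<close> is a submanifold.\<close>

lemma equiv_reparam_rel:
  assumes L: "submanifold A L0"
  shows "equiv (slag_embeddings A \<omega> \<phi> L0 U) (reparam_rel A \<omega> \<phi> L0 U)"
proof (rule equivI)
  let ?E = "slag_embeddings A \<omega> \<phi> L0 U" and ?r = "reparam_rel A \<omega> \<phi> L0 U"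
  show "?r \<subseteq> ?E \<times> ?E" by (auto simp: reparam_rel_def)
  show "refl_on ?E ?r"
  proof (rule refl_onI)
    fix F assume "F \<in> ?E"
    then show "(F, F) \<in> ?r"
      using diffeomorphism_id[of L0] by (auto simp: reparam_rel_def intro!: exI[of _ id])
  qed
  show "sym ?r"
  proof (rule symI)
    fix F G assume "(F, G) \<in> ?r"
    then obtain \<psi> where FG: "F \<in> ?E" "G \<in> ?E" and \<psi>: "diffeomorphism_of A L0 \<psi>" "\<And>p. p \<in> L0 \<Longrightarrow> G p = F (\<psi> p)"
      by (auto simp: reparam_rel_def)
    have bij: "bij_betw \<psi> L0 L0" using \<psi>(1) by (simp add: diffeomorphism_of_def)
    have "F p = G (inv_into L0 \<psi> p)" if "p \<in> L0" for p
      using \<psi>(2)[of "inv_into L0 \<psi> p"] bij_betw_inv_into_right[OF bij that] bij_betw_apply[OF bij_betw_inv_into[OF bij] that] by simp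
    then show "(G, F) \<in> ?r" using FG diffeomorphism_inv[OF \<psi>(1)] by (auto simp: reparam_rel_def)
  qed
  show "trans ?r"
  proof (rule transI)
    fix F G H assume "(F, G) \<in> ?r" "(G, H) \<in> ?r"
    then obtain \<psi> \<theta> where FG: "F \<in> ?E" "H \<in> ?E" and \<psi>: "diffeomorphism_of A L0 \<psi>" "\<And>p. p \<in> L0 \<Longrightarrow> G p = F (\<psi> p)"
      and \<theta>: "diffeomorphism_of A L0 \<theta>" "\<And>p. p \<in> L0 \<Longrightarrow> H p = G (\<theta> p)"
      by (auto simp: reparam_rel_def)
    have bij: "bij_betw \<theta> L0 L0" using \<theta>(1) by (simp add: diffeomorphism_of_def)
    have "H p = F ((\<psi> \<circ> \<theta>) p)" if "p \<in> L0" for p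
      using \<theta>(2)[OF that] \<psi>(2)[OF bij_betw_apply[OF bij that]] by simp
    then show "(F, H) \<in> ?r" using FG diffeomorphism_comp[OF L \<psi>(1) \<theta>(1)] by (auto simp: reparam_rel_def)
  qed
qed

text \<open>The function \<open>topology\<close> yields the intended open sets once the family
  satisfies \<open>istopology\<close>. Intersections are the critical case: \<open>\<Union>\<close>
  commutes with them because distinct classes are disjoint.\<close>

lemma openin_moduli_space:
  assumes "submanifold A L0"
  shows "openin (moduli_space A \<omega> \<phi> L0 U) W \<longleftrightarrow>
    W \<subseteq> slag_embeddings A \<omega> \<phi> L0 U // reparam_rel A \<omega> \<phi> L0 U \<and>
    openin (embedding_topology A \<omega> \<phi> L0 U) (\<Union>W)"
proof -
  let ?Q = "slag_embeddings A \<omega> \<phi> L0 U // reparam_rel A \<omega> \<phi> L0 U"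
  let ?X = "embedding_topology A \<omega> \<phi> L0 U"
  have "istopology (\<lambda>W. W \<subseteq> ?Q \<and> openin ?X (\<Union>W))"
    unfolding istopology_def
  proof (intro conjI allI impI)
    fix S T assume S: "S \<subseteq> ?Q \<and> openin ?X (\<Union>S)" and T: "T \<subseteq> ?Q \<and> openin ?X (\<Union>T)"
    have "\<Union>(S \<inter> T) = \<Union>S \<inter> \<Union>T"
    proof (intro equalityI subsetI)
      fix F assume "F \<in> \<Union>S \<inter> \<Union>T"
      then obtain X Y where XY: "X \<in> S" "Y \<in> T" "F \<in> X" "F \<in> Y" by blast
      then have "X = Y" using quotient_disj[OF equiv_reparam_rel[OF assms], of X \<omega> \<phi> U Y] S T by blast
      then show "F \<in> \<Union>(S \<inter> T)" using XY by blast
    qed blast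
    then show "openin ?X (\<Union>(S \<inter> T))" using S T by (simp add: openin_Int)
    show "S \<inter> T \<subseteq> ?Q" using S by blast
  next
    fix K assume K: "\<forall>S\<in>K. S \<subseteq> ?Q \<and> openin ?X (\<Union>S)"
    have "\<Union>(\<Union>K) = \<Union>((\<lambda>S. \<Union>S) ` K)" by blast
    moreover have "openin ?X (\<Union>((\<lambda>S. \<Union>S) ` K))" using K by (intro openin_Union) blast
    ultimately show "openin ?X (\<Union>(\<Union>K))" by simp
    show "\<Union>K \<subseteq> ?Q" using K by blast
  qed
  then show ?thesis by (simp add: moduli_space_def)
qed

lemma local_param_cong:
  assumes "local_param A L V \<sigma>" "\<And>x. x \<in> V \<Longrightarrow> \<sigma> x = \<sigma>' x"
  shows "local_param A L V \<sigma>'"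
proof -
  have V: "open V" "smooth_map A V \<sigma>" using local_paramD(1,2,4)[OF assms(1)] by auto
  have im: "\<sigma>' ` V = \<sigma> ` V" using assms(2) by force
  have "coord_diff A \<sigma>' x = coord_diff A \<sigma> x" if "x \<in> V" for x
    unfolding coord_diff_def assms(2)[OF that]
    by (rule frechet_derivative_cong_open[OF V(1) that]) (simp add: assms(2))
  moreover obtain r where "homeomorphism V (\<sigma> ` V) \<sigma> r" using assms(1) by (auto simp: local_param_def)
  then have "homeomorphism V (\<sigma>' ` V) \<sigma>' r"
    by (rule homeomorphism_cong[OF _ refl im]) (simp_all add: assms(2))
  ultimately show ?thesis
    using assms(1) smooth_map_cong[OF V(1) assms(2) V(2)] im by (auto simp: local_param_def smooth_immersion_def)
qed

lemma local_param_embedding: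
  assumes F: "smooth_embedding A L0 F" and \<sigma>: "local_param A L0 V \<sigma>"
  shows "local_param A (F ` L0) V (F \<circ> \<sigma>)"
proof -
  obtain G where G: "homeomorphism L0 (F ` L0) F G" using F by (auto simp: smooth_embedding_def)
  obtain r where r: "homeomorphism V (\<sigma> ` V) \<sigma> r" using \<sigma> by (auto simp: local_param_def)
  note b = local_paramD(1,2,4)[OF \<sigma>]
  have "openin (top_of_set L0) (\<sigma> ` V)" using \<sigma> by (simp add: local_param_def)
  then have o: "openin (top_of_set (F ` L0)) (F ` \<sigma> ` V)" by (rule homeomorphism_imp_open_map[OF G])
  have "homeomorphism (\<sigma> ` V) (F ` \<sigma> ` V) F G"
    by (rule homeomorphism_of_subsets[OF G b(3)]) auto
  from homeomorphism_compose[OF r this] have h: "homeomorphism V ((F \<circ> \<sigma>) ` V) (F \<circ> \<sigma>) (r \<circ> G)" by (simp add: image_comp)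
  have "smooth_immersion A V (F \<circ> \<sigma>)" using F \<sigma> by (simp add: smooth_embedding_def)
  then show ?thesis using b(1) o h by (auto simp: local_param_def image_comp)
qed

text \<open>Meant for a reflection \<open>R\<close> of the parameter space, which turns a negatively
  oriented parametrization into a positive one.\<close>

lemma local_param_linear:
  assumes \<sigma>: "local_param A L V \<sigma>" and R: "bounded_linear R" "\<And>x. R (R x) = x"
  shows "local_param A L (R -` V) (\<sigma> \<circ> R)"
proof -
  note b = local_paramD(1,2,4)[OF \<sigma>]
  have contR: "continuous_on X R" for X using R(1) linear_continuous_on by blast
  have oV: "open (R -` X)" if "open X" for X using that contR[of UNIV] by (simp add: continuous_on_open_vimage)
  have surj: "R ` (R -` X) = X" for X using R(2) by (auto simp: image_iff) metis
  have im: "(\<sigma> \<circ> R) ` (R -` V) = \<sigma> ` V" using surj[of V] by (metis image_comp)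
  have C1: "C1_map A V \<sigma>" by (rule smooth_map_imp_C1[OF b(2)])
  obtain r where r: "homeomorphism V (\<sigma> ` V) \<sigma> r" using \<sigma> by (auto simp: local_param_def)
  have "homeomorphism (R -` V) V R R"
    unfolding homeomorphism_def using R(2) surj contR by (auto simp: image_iff) metis
  from homeomorphism_compose[OF this r] have h: "homeomorphism (R -` V) ((\<sigma> \<circ> R) ` (R -` V)) (\<sigma> \<circ> R) (R \<circ> r)"
    by (simp only: im)
  have "smooth_map A (R -` V) (\<sigma> \<circ> R)"
    unfolding smooth_map_iff
  proof (intro conjI ballI allI)
    show "continuous_on (R -` V) (\<sigma> \<circ> R)" using h by (simp add: homeomorphism_def)
    fix C k assume C: "C \<in> A"
    have o: "open (V \<inter> \<sigma> -` fst C)" using b chart_homeo(1)[OF C] by (intro continuous_open_preimage) (auto simp: smooth_map_iff)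
    have "Ck_on k (V \<inter> \<sigma> -` fst C) (snd C \<circ> \<sigma>)" using b(2) C by (simp add: smooth_map_iff)
    then have "Ck_on k (R -` (V \<inter> \<sigma> -` fst C)) (\<lambda>x. (snd C \<circ> \<sigma>) (R x))"
      by (rule Ck_on_compose[OF oV[OF o] o Ck_on_linear[OF R(1) oV[OF o]]]) auto
    moreover have "R -` (V \<inter> \<sigma> -` fst C) = R -` V \<inter> (\<sigma> \<circ> R) -` fst C" by auto
    ultimately show "Ck_on k (R -` V \<inter> (\<sigma> \<circ> R) -` fst C) (snd C \<circ> (\<sigma> \<circ> R))" by (simp add: o_def)
  qed
  moreover have "inj (coord_diff A (\<sigma> \<circ> R) x)" if x: "x \<in> R -` V" for x
  proof -
    let ?C = "chart_at A (\<sigma> (R x))"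
    have "((snd ?C \<circ> \<sigma>) has_derivative coord_diff A \<sigma> (R x)) (at (R x))"
      unfolding coord_diff_def using x by (intro C1_map_has_derivative[OF C1] chart_at) auto
    from has_derivative_compose[OF bounded_linear_imp_has_derivative[OF R(1)] this]
    have "((snd ?C \<circ> (\<sigma> \<circ> R)) has_derivative (\<lambda>v. coord_diff A \<sigma> (R x) (R v))) (at x)" by (simp add: o_def)
    from frechet_derivative_at[OF this] have "coord_diff A (\<sigma> \<circ> R) x = (\<lambda>v. coord_diff A \<sigma> (R x) (R v))"
      by (simp add: coord_diff_def)
    moreover have "inj (coord_diff A \<sigma> (R x))" using \<sigma> x by (auto simp: local_param_def smooth_immersion_def)
    moreover have "inj R" using R(2) by (metis injI)
    ultimately show ?thesis by (simp add: inj_def)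
  qed
  ultimately show ?thesis
    using \<sigma> oV[OF b(1)] h im by (auto simp: local_param_def smooth_immersion_def)
qed

end

section \<open>Local constancy of the integral\<close>

locale slag_moduli = cvolume A \<phi>
  for A :: "('m::{t2_space,second_countable_topology}, 'n::finite) chart set" and \<phi> +
  fixes \<omega> :: "('m, 'n) chart \<Rightarrow> 'm \<Rightarrow> complex^'n \<Rightarrow> complex^'n \<Rightarrow> real"
    and L0 U :: "'m set" and f :: "'m \<Rightarrow> complex"
  assumes kaehler: "kaehler_form A \<omega>" and compact0: "compact L0" and slag0: "special_lagrangian A \<omega> \<phi> L0"
    and openU: "open U" and L0U: "L0 \<subseteq> U" and holf: "holomorphic_fun_on A U f"
begin

abbreviation "E \<equiv> slag_embeddings A \<omega> \<phi> L0 U"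
abbreviation "ETop \<equiv> embedding_topology A \<omega> \<phi> L0 U"

lemma submanifold0: "submanifold A L0"
  using slag0 by (simp add: special_lagrangian_def)

lemma embeddingD:
  assumes "F \<in> E"
  shows "smooth_embedding A L0 F" "F ` L0 \<subseteq> U" "special_lagrangian A \<omega> \<phi> (F ` L0)"
    "local_param A L0 V \<sigma> \<Longrightarrow> local_param A (F ` L0) V (F \<circ> \<sigma>)"
    "inj_on F L0" "continuous_on L0 F"
proof -
  show F: "smooth_embedding A L0 F" and "F ` L0 \<subseteq> U" "special_lagrangian A \<omega> \<phi> (F ` L0)"
    using assms by (auto simp: slag_embeddings_def)
  show "local_param A L0 V \<sigma> \<Longrightarrow> local_param A (F ` L0) V (F \<circ> \<sigma>)" by (rule local_param_embedding[OF F])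
  obtain G where G: "homeomorphism L0 (F ` L0) F G" using F by (auto simp: smooth_embedding_def)
  show "inj_on F L0" by (rule inj_on_inverseI) (rule homeomorphism_apply1[OF G])
  show "continuous_on L0 F" using G by (simp add: homeomorphism_def)
qed

text \<open>With the empty parameter domain and \<open>K = {}\<close> a subbasic neighbourhood is
  all of \<open>E\<close>; this shows that \<open>E\<close> is the whole space of
  \<open>ETop\<close>.\<close>

lemma local_param_empty: "local_param A L0 {} \<sigma>"
  by (auto simp: local_param_def smooth_immersion_def smooth_map_def smooth_on_def)

lemma openin_generator:
  assumes "C \<in> A" "local_param A L0 V \<sigma>" "compact K" "K \<subseteq> V" "\<epsilon> > 0" "F \<in> E" "F ` \<sigma> ` K \<subseteq> fst C"
  shows "openin ETop (E \<inter> smooth_nbhd C \<sigma> K k \<epsilon> F)"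
  unfolding embedding_topology_def
  by (rule topology_generated_by_Basis) (use assms in blast)

lemma topspace_ETop: "topspace ETop = E"
proof
  show "topspace ETop \<subseteq> E" unfolding embedding_topology_def topology_generated_by_topspace by blast
  show "E \<subseteq> topspace ETop"
  proof
    fix F assume F: "F \<in> E"
    obtain C where C: "C \<in> A" using chart_cover by metis
    have "openin ETop (E \<inter> smooth_nbhd C undefined {} 0 1 F)"
      using F by (intro openin_generator[OF C local_param_empty]) auto
    moreover have "F \<in> E \<inter> smooth_nbhd C undefined {} 0 1 F" using F by (simp add: smooth_nbhd_def)
    ultimately show "F \<in> topspace ETop" using openin_subset by blast
  qed
qed

lemma eventually_smooth_nbhd:
  assumes "C \<in> A" "local_param A L0 V \<sigma>" "compact K" "K \<subseteq> V" "\<epsilon> > 0" "F \<in> E" "F ` \<sigma> ` K \<subseteq> fst C"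
  shows "eventually (\<lambda>G. G \<in> smooth_nbhd C \<sigma> K k \<epsilon> F) (nhdsin ETop F)"
proof -
  have "F \<in> E \<inter> smooth_nbhd C \<sigma> K k \<epsilon> F" using assms by (simp add: smooth_nbhd_def)
  then show ?thesis using openin_generator[OF assms, of k] by (auto simp: eventually_nhdsin)
qed

lemma eventually_in_E: "eventually (\<lambda>G. G \<in> E) (nhdsin ETop F)"
  unfolding eventually_nhdsin using openin_topspace[of ETop] topspace_ETop by auto

lemma param_cball:
  assumes "p \<in> L0" "open Y" "continuous_on L0 F" "F p \<in> Y"
  obtains V \<sigma> x d where "local_param A L0 V \<sigma>" "d > 0" "cball x d \<subseteq> V" "\<sigma> x = p" "F ` \<sigma> ` cball x d \<subseteq> Y"
proof -
  obtain V \<sigma> where \<sigma>: "local_param A L0 V \<sigma>" "p \<in> \<sigma> ` V" using submanifold0 assms(1) unfolding submanifold_def by blast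
  note lp = local_paramD[OF \<sigma>(1)]
  obtain x where x: "x \<in> V" "\<sigma> x = p" using \<sigma>(2) by blast
  have "continuous_on V (\<lambda>x. F (\<sigma> x))"
    by (rule continuous_on_compose2[OF assms(3) lp(6,4)])
  then have "open (V \<inter> (\<lambda>x. F (\<sigma> x)) -` Y)" using lp(1) assms(2) by (rule continuous_open_preimage)
  moreover have "x \<in> V \<inter> (\<lambda>x. F (\<sigma> x)) -` Y" using x assms(4) by simp
  ultimately obtain d where "d > 0" "cball x d \<subseteq> V \<inter> (\<lambda>x. F (\<sigma> x)) -` Y" by (meson open_contains_cball)
  then show thesis using that[OF \<sigma>(1), of d x] x by blast
qed

text \<open>The topology of embeddings is finer than the compact-open one; neighbourhoods of order
  \<open>k = 0\<close> suffice for this.\<close>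

lemma eventually_compact_open:
  assumes F: "F \<in> E" and S: "compact S" "S \<subseteq> L0" and X: "open X" "F ` S \<subseteq> X"
  shows "eventually (\<lambda>G. G ` S \<subseteq> X) (nhdsin ETop F)"
proof -
  have "\<exists>Y. open Y \<and> p \<in> Y \<and> eventually (\<lambda>G. G ` (L0 \<inter> Y) \<subseteq> X) (nhdsin ETop F)" if p: "p \<in> S" for p
  proof -
    have pL: "p \<in> L0" and Fp: "F p \<in> X" using p S X by auto
    obtain C where C: "C \<in> A" "F p \<in> fst C" by (rule chart_cover)
    have "open (snd C ` (fst C \<inter> X))" "snd C (F p) \<in> snd C ` (fst C \<inter> X)"
      using open_chart_image[OF C(1) X(1)] C(2) Fp by auto
    \<comment> \<open>The radius is halved below: on a parameter ball \<open>F\<close> stays within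
      e / 2 of its value at \<open>p\<close>, and \<open>G\<close> within e / 2 of
      \<open>F\<close>.\<close>
    then obtain e where e: "e > 0" "ball (snd C (F p)) e \<subseteq> snd C ` (fst C \<inter> X)" by (meson open_contains_ball)
    have "F p \<in> ball_in C (snd C (F p)) (e / 2)" using C e by (simp add: ball_in_def)
    from param_cball[OF pL open_ball_in[OF C(1)] embeddingD(6)[OF F] this]
    obtain V \<sigma> x d where \<sigma>: "local_param A L0 V \<sigma>" "d > 0" "cball x d \<subseteq> V" "\<sigma> x = p"
      "F ` \<sigma> ` cball x d \<subseteq> ball_in C (snd C (F p)) (e / 2)" by metis
    have "openin (top_of_set L0) (\<sigma> ` ball x d)"
      using local_param_subset[OF \<sigma>(1), of "ball x d"] \<sigma>(3) ball_subset_cball[of x d]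
      unfolding local_param_def by blast
    then obtain Y where Y: "open Y" "\<sigma> ` ball x d = L0 \<inter> Y" unfolding openin_open by blast
    have "p \<in> Y" using Y(2) \<sigma>(2,4) by (metis IntE centre_in_ball imageI)
    moreover have "eventually (\<lambda>G. G \<in> smooth_nbhd C \<sigma> (cball x d) 0 (e / 2) F) (nhdsin ETop F)"
      by (rule eventually_smooth_nbhd[OF C(1) \<sigma>(1) compact_cball \<sigma>(3) _ F]) (use e \<sigma>(5) in \<open>auto simp: ball_in_def\<close>)
    then have "eventually (\<lambda>G. G ` (L0 \<inter> Y) \<subseteq> X) (nhdsin ETop F)"
    proof eventually_elim
      case (elim G)
      show ?case
      proof (intro image_subsetI)
        fix q assume "q \<in> L0 \<inter> Y"
        then obtain y where y: "y \<in> ball x d" "q = \<sigma> y" using Y(2) by blast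
        then have yc: "y \<in> cball x d" by simp
        have Gq: "G q \<in> fst C" using elim yc y(2) by (auto simp: smooth_nbhd_def)
        have "norm (iter_deriv [] (snd C \<circ> G \<circ> \<sigma>) y - iter_deriv [] (snd C \<circ> F \<circ> \<sigma>) y) < e / 2"
          using elim yc unfolding smooth_nbhd_def by (metis (no_types, lifting) CollectD empty_set empty_subsetI le_numeral_extra(3) list.size(3))
        then have 1: "dist (snd C (G q)) (snd C (F q)) < e / 2" by (simp add: dist_norm y(2))
        have "F q \<in> ball_in C (snd C (F p)) (e / 2)" using \<sigma>(5) yc y(2) by blast
        then have 2: "dist (snd C (F p)) (snd C (F q)) < e / 2" by (simp add: ball_in_def)
        have "dist (snd C (F p)) (snd C (G q)) < e" by (rule dist_triangle_half_l[OF 2 1])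
        then have "snd C (G q) \<in> snd C ` (fst C \<inter> X)" using e(2) by auto
        then obtain q' where "q' \<in> fst C" "q' \<in> X" "snd C (G q) = snd C q'" by blast
        then show "G q \<in> X" using chart_homeo(3)[OF C(1)] Gq by (metis inj_onD)
      qed
    qed
    ultimately show ?thesis using Y(1) by blast
  qed
  then obtain Y where Y: "\<And>p. p \<in> S \<Longrightarrow> open (Y p)" "\<And>p. p \<in> S \<Longrightarrow> p \<in> Y p"
    "\<And>p. p \<in> S \<Longrightarrow> eventually (\<lambda>G. G ` (L0 \<inter> Y p) \<subseteq> X) (nhdsin ETop F)" by metis
  have cov: "S \<subseteq> (\<Union>p\<in>S. Y p)" using Y(2) by blast
  obtain I where I: "I \<subseteq> S" "finite I" "S \<subseteq> (\<Union>p\<in>I. Y p)" by (rule compactE_image[OF S(1) Y(1) cov])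
  have "eventually (\<lambda>G. \<forall>p\<in>I. G ` (L0 \<inter> Y p) \<subseteq> X) (nhdsin ETop F)"
    using I Y(3) by (intro eventually_ball_finite) auto
  then show ?thesis
  proof eventually_elim
    case (elim G)
    show ?case
    proof (intro image_subsetI)
      fix q assume q: "q \<in> S"
      then obtain p where "p \<in> I" "q \<in> Y p" using I(3) by blast
      then show "G q \<in> X" using elim q S(2) by blast
    qed
  qed
qed

lemma density_chart:
  assumes G: "G \<in> E" and \<sigma>: "local_param A L0 V \<sigma>" and x: "x \<in> V" and C: "C \<in> A" "G (\<sigma> x) \<in> fst C"
  shows "volume_density A \<phi> (G \<circ> \<sigma>) x
    = Re (coef C (snd C (G (\<sigma> x))) * det (\<chi> j. frechet_derivative (snd C \<circ> G \<circ> \<sigma>) (at x) (axis j 1)))"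
proof -
  note lp = local_paramD[OF embeddingD(4)[OF G \<sigma>]]
  have "pull A \<phi> (G \<circ> \<sigma>) x = coef C (snd C ((G \<circ> \<sigma>) x)) * jac (snd C \<circ> (G \<circ> \<sigma>)) x"
    using C by (intro pull_chart[OF lp(1,3) x]) auto
  moreover have "jac (snd C \<circ> (G \<circ> \<sigma>)) x = det (\<chi> j. frechet_derivative (snd C \<circ> G \<circ> \<sigma>) (at x) (axis j 1))"
    unfolding jac_def comp_assoc by (subst det_transpose[symmetric]) (simp add: transpose_def)
  ultimately show ?thesis by (simp add: volume_density_pull)
qed

lemma norm_matrix_le:
  fixes M :: "complex^'n^'n"
  assumes "\<And>j. norm (M $ j) \<le> e"
  shows "norm M \<le> real CARD('n) * e"
proof -
  have "norm M \<le> (\<Sum>j\<in>UNIV. norm (M $ j))" unfolding norm_vec_def[of M] by (rule L2_set_le_sum) simp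
  also have "\<dots> \<le> real CARD('n) * e" using assms by (intro sum_bounded_above) auto
  finally show ?thesis .
qed

text \<open>Positivity of the density is an open condition on values and first derivatives, so order
  \<open>k = 1\<close> suffices; compactness of \<open>K\<close> makes it uniform.\<close>

lemma eventually_density_pos:
  assumes F: "F \<in> E" and \<sigma>: "local_param A L0 V \<sigma>" and K: "compact K" "K \<subseteq> V"
    and pos: "\<And>x. x \<in> K \<Longrightarrow> volume_density A \<phi> (F \<circ> \<sigma>) x > 0"
  shows "eventually (\<lambda>G. \<forall>x\<in>K. volume_density A \<phi> (G \<circ> \<sigma>) x > 0) (nhdsin ETop F)"
proof -
  note lp = local_paramD[OF \<sigma>] and lpF = local_paramD[OF embeddingD(4)[OF F \<sigma>]]
  have ex: "\<exists>d>0. eventually (\<lambda>G. \<forall>x\<in>K \<inter> cball y d. volume_density A \<phi> (G \<circ> \<sigma>) x > 0) (nhdsin ETop F)" if y: "y \<in> K" for y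
  proof -
    obtain C where C: "C \<in> A" "F (\<sigma> y) \<in> fst C" by (rule chart_cover)
    have o: "open (V \<inter> (F \<circ> \<sigma>) -` fst C)" by (rule C1_map_preimage_open[OF lpF(3,1) chart_homeo(1)[OF C(1)]])
    moreover have "y \<in> V \<inter> (F \<circ> \<sigma>) -` fst C" using y K(2) C(2) by auto
    ultimately obtain d where d: "d > 0" "cball y d \<subseteq> V \<inter> (F \<circ> \<sigma>) -` fst C" by (meson open_contains_cball)
    define K' where "K' = K \<inter> cball y d"
    have K': "compact K'" "K' \<subseteq> V" "F ` \<sigma> ` K' \<subseteq> fst C" "K' \<subseteq> K"
      using K d(2) by (auto simp: K'_def intro: compact_Int)
    \<comment> \<open>The density is a continuous function \<open>\<Theta>\<close> of the point
      \<open>\<Gamma> G x\<close>, which collects the value and the partial derivatives of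
      \<open>G\<close> in the chart.\<close>
    define \<Theta> where "\<Theta> = (\<lambda>w. Re (coef C (fst w) * det (snd w :: complex^'n^'n)))"
    define D where "D = (\<lambda>G x. \<chi> j. frechet_derivative (snd C \<circ> G \<circ> \<sigma>) (at x) (axis j 1) :: complex^'n^'n)"
    define \<Gamma> where "\<Gamma> = (\<lambda>G x. (snd C (G (\<sigma> x)), D G x))"
    have dens: "volume_density A \<phi> (G \<circ> \<sigma>) x = \<Theta> (\<Gamma> G x)" if "G \<in> E" "x \<in> K'" "G (\<sigma> x) \<in> fst C" for G x
      using density_chart[OF that(1) \<sigma> _ C(1) that(3)] that(2) K'(2) by (auto simp: \<Theta>_def \<Gamma>_def D_def)
    let ?O = "(snd C ` fst C) \<times> (UNIV :: (complex^'n^'n) set)"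
    have oO: "open ?O" using chart_homeo(2)[OF C(1)] by (simp add: open_Times)
    have contdet: "continuous_on S (\<lambda>w. det (snd w :: complex^'n^'n))" for S :: "((complex^'n) \<times> (complex^'n^'n)) set"
      unfolding det_def by (intro continuous_intros)
    have cont\<Theta>: "continuous_on ?O \<Theta>"
      unfolding \<Theta>_def
      by (intro continuous_on_Re continuous_on_mult contdet
          continuous_on_compose2[OF cholomorphic_on_continuous[OF coef_holomorphic[OF C(1)]] continuous_on_fst[OF continuous_on_id]]) auto
    define \<Omega> where "\<Omega> = ?O \<inter> \<Theta> -` {0<..}"
    have \<Omega>: "open \<Omega>" unfolding \<Omega>_def by (rule continuous_open_preimage[OF cont\<Theta> oO open_greaterThan])
    have k1: "Ck_on 1 (V \<inter> (F \<circ> \<sigma>) -` fst C) (snd C \<circ> F \<circ> \<sigma>)"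
      using lpF(3) C(1) unfolding C1_map_def comp_assoc by blast
    have "continuous_on K' (\<lambda>x. frechet_derivative (snd C \<circ> F \<circ> \<sigma>) (at x) (axis j 1))" for j
    proof -
      have "continuous_on (V \<inter> (F \<circ> \<sigma>) -` fst C) (\<lambda>x. frechet_derivative (snd C \<circ> F \<circ> \<sigma>) (at x) (axis j 1))"
        using k1 by simp
      then show ?thesis by (rule continuous_on_subset) (use d(2) K'_def in auto)
    qed
    then have "continuous_on K' (D F)" unfolding D_def by (intro continuous_on_vec_lambda)
    moreover have "continuous_on K' (\<lambda>x. snd C (F (\<sigma> x)))"
      using continuous_on_subset[OF Ck_on_imp_continuous_on[OF k1], of K'] d(2) by (auto simp: K'_def o_def)
    ultimately have "continuous_on K' (\<Gamma> F)" unfolding \<Gamma>_def by (intro continuous_on_Pair)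
    then have cpt: "compact (\<Gamma> F ` K')" using K'(1) by (rule compact_continuous_image)
    have "\<Gamma> F ` K' \<subseteq> \<Omega>"
    proof (intro image_subsetI)
      fix x assume x: "x \<in> K'"
      have "F (\<sigma> x) \<in> fst C" using x K'(3) by blast
      then show "\<Gamma> F x \<in> \<Omega>" using dens[OF F x] pos[of x] x K'(4) by (auto simp: \<Omega>_def \<Gamma>_def)
    qed
    then obtain e where e: "e > 0" "(\<Union>w\<in>\<Gamma> F ` K'. ball w e) \<subseteq> \<Omega>"
      by (rule compact_subset_open_imp_ball_epsilon_subset[OF cpt \<Omega>])
    \<comment> \<open>The values differ by less than \<open>\<epsilon>\<close> and the derivative
      matrices by at most \<open>\<epsilon>\<close> times the dimension; the second extra
      \<open>\<epsilon>\<close> is slack.\<close>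
    define \<epsilon> where "\<epsilon> = e / (real CARD('n) + 2)"
    have \<epsilon>: "\<epsilon> > 0" "\<epsilon> * (real CARD('n) + 2) = e" using e(1) by (auto simp: \<epsilon>_def add_nonneg_pos)
    have "eventually (\<lambda>G. G \<in> smooth_nbhd C \<sigma> K' 1 \<epsilon> F) (nhdsin ETop F)"
      by (rule eventually_smooth_nbhd[OF C(1) \<sigma> K'(1,2) \<epsilon>(1) F K'(3)])
    with eventually_in_E have "eventually (\<lambda>G. \<forall>x\<in>K'. volume_density A \<phi> (G \<circ> \<sigma>) x > 0) (nhdsin ETop F)"
    proof eventually_elim
      case (elim G)
      show ?case
      proof
        fix x assume x: "x \<in> K'"
        have Gx: "G (\<sigma> x) \<in> fst C" using elim(2) x by (auto simp: smooth_nbhd_def)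
        have nb: "norm (iter_deriv vs (snd C \<circ> G \<circ> \<sigma>) x - iter_deriv vs (snd C \<circ> F \<circ> \<sigma>) x) < \<epsilon>"
          if "set vs \<subseteq> Basis" "length vs \<le> 1" for vs
          using elim(2) x that by (simp add: smooth_nbhd_def)
        have 0: "norm (snd C (G (\<sigma> x)) - snd C (F (\<sigma> x))) < \<epsilon>" using nb[of "[]"] by simp
        have "norm ((D G x - D F x) $ j) \<le> \<epsilon>" for j
          using nb[of "[axis j 1]"] by (simp add: D_def axis_in_Basis_iff less_imp_le)
        then have 1: "norm (D G x - D F x) \<le> real CARD('n) * \<epsilon>" by (rule norm_matrix_le)
        have "dist (\<Gamma> F x) (\<Gamma> G x) \<le> dist (snd C (F (\<sigma> x))) (snd C (G (\<sigma> x))) + dist (D F x) (D G x)"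
          unfolding \<Gamma>_def dist_Pair_Pair by (rule sqrt_sum_squares_le_sum) auto
        also have "\<dots> < \<epsilon> + real CARD('n) * \<epsilon> + \<epsilon>"
          using 0 1 \<epsilon>(1) by (simp add: dist_norm norm_minus_commute)
        also have "\<dots> = e" using \<epsilon>(2) by (simp add: algebra_simps)
        finally have "\<Gamma> G x \<in> ball (\<Gamma> F x) e" by simp
        then have "\<Gamma> G x \<in> \<Omega>" using e(2) x by blast
        then show "volume_density A \<phi> (G \<circ> \<sigma>) x > 0" using dens[OF elim(1) x Gx] by (simp add: \<Omega>_def)
      qed
    qed
    then show ?thesis using d(1) by (auto simp: K'_def)
  qed
  have "\<exists>d. \<forall>y\<in>K. d y > 0 \<and> eventually (\<lambda>G. \<forall>x\<in>K \<inter> cball y (d y). volume_density A \<phi> (G \<circ> \<sigma>) x > 0) (nhdsin ETop F)"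
    by (rule bchoice, rule ballI) (rule ex)
  then obtain d where d0: "\<forall>y\<in>K. d y > 0 \<and> eventually (\<lambda>G. \<forall>x\<in>K \<inter> cball y (d y). volume_density A \<phi> (G \<circ> \<sigma>) x > 0) (nhdsin ETop F)" ..
  have d: "d y > 0" "eventually (\<lambda>G. \<forall>x\<in>K \<inter> cball y (d y). volume_density A \<phi> (G \<circ> \<sigma>) x > 0) (nhdsin ETop F)"
    if "y \<in> K" for y using bspec[OF d0 that] by blast+
  have cov: "K \<subseteq> (\<Union>y\<in>K. ball y (d y))" using d(1) by (meson UN_I centre_in_ball subsetI)
  obtain I where I: "I \<subseteq> K" "finite I" "K \<subseteq> (\<Union>y\<in>I. ball y (d y))"
    by (rule compactE_image[OF K(1) open_ball cov])
  have "eventually (\<lambda>G. \<forall>y\<in>I. \<forall>x\<in>K \<inter> cball y (d y). volume_density A \<phi> (G \<circ> \<sigma>) x > 0) (nhdsin ETop F)"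
    using I d(2) by (intro eventually_ball_finite) auto
  then show ?thesis
  proof eventually_elim
    case (elim G)
    show ?case
    proof
      fix x assume x: "x \<in> K"
      then obtain y where "y \<in> I" "x \<in> ball y (d y)" using I(3) by blast
      then show "volume_density A \<phi> (G \<circ> \<sigma>) x > 0" using elim x by auto
    qed
  qed
qed

text \<open>On the image phi is real and nonzero, so the density does not vanish at the point. If it
  is negative, a reflection of the parameters changes its sign; continuity then gives a
  neighbourhood where it stays positive.\<close>

lemma oriented_ball:
  assumes F: "F \<in> E" and p: "p \<in> L0"
  obtains V \<sigma> x e where "local_param A L0 V \<sigma>" "e > 0" "cball x e \<subseteq> V" "\<sigma> x = p"
    "\<And>y. y \<in> V \<Longrightarrow> volume_density A \<phi> (F \<circ> \<sigma>) y > 0"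
proof -
  obtain V \<sigma> where "local_param A L0 V \<sigma>" "p \<in> \<sigma> ` V"
    using submanifold0 p unfolding submanifold_def by blast
  then obtain x where \<sigma>: "local_param A L0 V \<sigma>" "x \<in> V" "\<sigma> x = p" by blast
  note sF = embeddingD(3)[OF F]
  have nz: "volume_density A \<phi> (F \<circ> \<sigma>) x \<noteq> 0"
    using slag_pull[OF kaehler sF embeddingD(4)[OF F \<sigma>(1)] \<sigma>(2)] by (auto simp: volume_density_pull complex_eq_iff)
  have "\<exists>V \<sigma> x. local_param A L0 V \<sigma> \<and> x \<in> V \<and> \<sigma> x = p \<and> volume_density A \<phi> (F \<circ> \<sigma>) x > 0"
  proof (cases "volume_density A \<phi> (F \<circ> \<sigma>) x > 0")
    case True then show ?thesis using \<sigma> by blast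
  next
    case False
    fix k :: 'n
    \<comment> \<open>The reflection in one coordinate: an involution of determinant -1.\<close>
    define R where "R = (\<lambda>v::real^'n. \<chi> i. if i = k then - v $ i else v $ i)"
    have RR: "R (R v) = v" for v by (simp add: R_def vec_eq_iff)
    have linR: "linear R" by (auto simp: linear_iff R_def vec_eq_iff)
    then have blR: "bounded_linear R" by (simp add: linear_conv_bounded_linear)
    have "matrix R $ i $ i = (if i = k then -1 else 1)" "i \<noteq> j \<Longrightarrow> matrix R $ i $ j = 0" for i j
      by (auto simp: matrix_def R_def axis_def)
    then have "det (matrix R) = (\<Prod>i\<in>UNIV. if i = k then -1 else 1)"
      by (simp add: det_diagonal)
    then have detR: "det (matrix R) = -1" by simp
    note lp' = local_param_linear[OF \<sigma>(1) blR RR]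
    note lpF = local_paramD[OF embeddingD(4)[OF F \<sigma>(1)]]
    have "pull A \<phi> (F \<circ> (\<sigma> \<circ> R)) (R x) = pull A \<phi> (F \<circ> \<sigma>) (R (R x)) * of_real (det (matrix R))"
      by (rule pull_compose[OF lpF(3) _ bounded_linear_imp_has_derivative[OF blR] open_UNIV]) (use \<sigma>(2) RR in auto)
    then have "volume_density A \<phi> (F \<circ> (\<sigma> \<circ> R)) (R x) > 0"
      using False nz by (simp add: volume_density_pull detR RR)
    moreover have "R x \<in> R -` V" "(\<sigma> \<circ> R) (R x) = p" using \<sigma> RR by auto
    ultimately show ?thesis using lp' by blast
  qed
  then obtain V \<sigma> x where \<sigma>: "local_param A L0 V \<sigma>" "x \<in> V" "\<sigma> x = p" "volume_density A \<phi> (F \<circ> \<sigma>) x > 0" by blast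
  note lp = local_paramD[OF \<sigma>(1)]
  define V' where "V' = V \<inter> volume_density A \<phi> (F \<circ> \<sigma>) -` {0<..}"
  have V': "open V'" "V' \<subseteq> V" "x \<in> V'"
    using continuous_open_preimage[OF continuous_on_volume_density[OF embeddingD(4)[OF F \<sigma>(1)]] lp(1) open_greaterThan] \<sigma>
    by (auto simp: V'_def)
  obtain e where e: "e > 0" "cball x e \<subseteq> V'" using V' by (meson open_contains_cball)
  show thesis
    by (rule that[OF local_param_subset[OF \<sigma>(1) V'(1,2)] e \<sigma>(3)]) (simp add: V'_def)
qed

text \<open>The image of \<open>F\<close> serves as the fixed submanifold, and a nearby
  \<open>G\<close> is viewed on it as the map \<open>Q\<close>, the inverse of \<open>F\<close>
  followed by \<open>G\<close>. Closeness of values puts \<open>Q\<close> near the identity, and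
  closeness of first derivatives preserves the orientation.\<close>

lemma integral_locally_constant:
  assumes F: "F \<in> E"
  shows "eventually (\<lambda>G. slag_integral A \<phi> f (G ` L0) = slag_integral A \<phi> f (F ` L0)) (nhdsin ETop F)"
proof -
  let ?L = "F ` L0"
  have "\<exists>V \<sigma> x e. local_param A L0 V \<sigma> \<and> (0::real) < e \<and> cball x e \<subseteq> V \<and> \<sigma> x = p \<and>
    (\<forall>y\<in>V. volume_density A \<phi> (F \<circ> \<sigma>) y > 0)" if p: "p \<in> L0" for p
    by (rule oriented_ball[OF F p]) blast
  then obtain V \<sigma> x e where d: "\<And>p. p \<in> L0 \<Longrightarrow> local_param A L0 (V p) (\<sigma> p) \<and> (0::real) < e p \<and> cball (x p) (e p) \<subseteq> V p \<and>
    \<sigma> p (x p) = p \<and> (\<forall>y\<in>V p. volume_density A \<phi> (F \<circ> \<sigma> p) y > 0)" by metis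
  \<comment> \<open>Open balls whose closures stay in the parameter domains: compactness of the
    closures gives finite volume and a uniform positivity condition on \<open>G\<close>.\<close>
  define B where "B = (\<lambda>p. ball (x p) (e p))"
  have BV: "open (B p)" "B p \<subseteq> V p" if "p \<in> L0" for p using d[OF that] by (auto simp: B_def)
  have lpB: "local_param A L0 (B p) (\<sigma> p)" if "p \<in> L0" for p
    using local_param_subset[OF _ BV[OF that]] d[OF that] by blast
  have "\<exists>Y. open Y \<and> \<sigma> p ` B p = L0 \<inter> Y" if "p \<in> L0" for p
    using lpB[OF that] unfolding local_param_def openin_open by blast
  then obtain Y where Y: "\<And>p. p \<in> L0 \<Longrightarrow> open (Y p)" "\<And>p. p \<in> L0 \<Longrightarrow> \<sigma> p ` B p = L0 \<inter> Y p" by metis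
  have cov: "L0 \<subseteq> (\<Union>p\<in>L0. Y p)"
  proof
    fix p assume p: "p \<in> L0"
    have "x p \<in> B p" using d[OF p] by (simp add: B_def)
    then have "p \<in> \<sigma> p ` B p" using d[OF p] by force
    then show "p \<in> (\<Union>p\<in>L0. Y p)" using Y(2)[OF p] p by blast
  qed
  obtain I where I: "I \<subseteq> L0" "finite I" "L0 \<subseteq> (\<Union>p\<in>I. Y p)" by (rule compactE_image[OF compact0 Y(1) cov])
  define N where "N = card I"
  obtain h where h: "bij_betw h {..<N} I"
    using ex_bij_betw_nat_finite[OF I(2)] by (auto simp: N_def atLeast0LessThan)
  have hI: "h i \<in> L0" if "i < N" for i using bij_betw_apply[OF h, of i] that I(1) by auto
  define W where "W = (\<lambda>i. B (h i))"
  define s where "s = (\<lambda>i. \<sigma> (h i))"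
  have lps: "local_param A L0 (W i) (s i)" if "i < N" for i using lpB[OF hI[OF that]] by (simp add: W_def s_def)
  have cov0: "L0 \<subseteq> (\<Union>i<N. s i ` W i)"
  proof
    fix q assume q: "q \<in> L0"
    then obtain p where p: "p \<in> I" "q \<in> Y p" using I(3) by blast
    then obtain i where i: "i < N" "p = h i" using h by (auto simp: bij_betw_def)
    have "q \<in> s i ` W i" using Y(2)[OF hI[OF i(1)]] p q i(2) by (simp add: s_def W_def)
    then show "q \<in> (\<Union>i<N. s i ` W i)" using i(1) by blast
  qed
  have opar: "oriented_param A \<phi> ?L (W i) (F \<circ> s i)" if "i < N" for i
    unfolding oriented_param_def using embeddingD(4)[OF F lps[OF that]] d[OF hI[OF that]] BV(2)[OF hI[OF that]]
    by (auto simp: W_def s_def)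
  have fin: "(\<integral>\<^sup>+y\<in>W i. ennreal (volume_density A \<phi> (F \<circ> s i) y) \<partial>lborel) < \<infinity>" if "i < N" for i
  proof -
    let ?K = "cball (x (h i)) (e (h i))" and ?v = "volume_density A \<phi> (F \<circ> s i)"
    have dd: "local_param A L0 (V (h i)) (s i)" "?K \<subseteq> V (h i)" using d[OF hI[OF that]] by (auto simp: s_def)
    have "continuous_on ?K ?v"
      using continuous_on_subset[OF continuous_on_volume_density[OF embeddingD(4)[OF F dd(1)]] dd(2)] .
    then have "bounded (?v ` ?K)" using compact_continuous_image compact_cball compact_imp_bounded by blast
    then obtain b where "\<forall>z\<in>?v ` ?K. norm z \<le> b" unfolding bounded_iff by blast
    then have b: "\<And>y. y \<in> ?K \<Longrightarrow> norm (?v y) \<le> b" by blast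
    have "(\<integral>\<^sup>+y\<in>W i. ennreal (?v y) \<partial>lborel) \<le> (\<integral>\<^sup>+y. ennreal b * indicator ?K y \<partial>lborel)"
    proof (rule nn_integral_mono)
      fix y
      show "ennreal (?v y) * indicator (W i) y \<le> ennreal b * indicator ?K y"
      proof (cases "y \<in> W i")
        case True
        then have "y \<in> ?K" by (simp add: W_def B_def)
        then show ?thesis using b[of y] True by (auto intro!: ennreal_leI)
      qed simp
    qed
    also have "\<dots> = ennreal b * emeasure lborel ?K" by (simp add: nn_integral_cmult_indicator)
    also have "\<dots> < \<infinity>" using emeasure_compact_finite[OF compact_cball, of "x (h i)" "e (h i)"] by (simp add: ennreal_mult_less_top)
    finally show ?thesis .
  qed
  have covF: "?L \<subseteq> (\<Union>i<N. (F \<circ> s i) ` W i)"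
    unfolding image_comp[symmetric] image_UN[symmetric] using cov0 by (rule image_mono)
  have preal: "Im (pull A \<phi> (F \<circ> s i) y) = 0" if "i < N" "y \<in> W i" for i y
    by (rule slag_pull(1)[OF kaehler embeddingD(3)[OF F] embeddingD(4)[OF F lps[OF that(1)]] that(2)])
  interpret C: slag_cover A \<phi> ?L N W "\<lambda>i. F \<circ> s i" U f
    by unfold_locales
      (use opar covF compact_continuous_image[OF embeddingD(6)[OF F] compact0] openU embeddingD(2)[OF F] holf preal fin in auto)
  obtain Fi where Fi: "homeomorphism L0 ?L F Fi" using embeddingD(1)[OF F] by (auto simp: smooth_embedding_def)
  have base: "slag_integral A \<phi> f ?L = C.J id"
    using C.slag_integral_image[OF C.C1L_id] opar preal by (simp add: comp_assoc)
  have lim: "filterlim (\<lambda>G. G \<circ> Fi) C.near_id (nhdsin ETop F)"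
  proof (rule C.filterlim_near_id)
    fix K X assume K: "compact K" "K \<subseteq> ?L" "open X" "K \<subseteq> X"
    have "continuous_on K Fi" using Fi K(2) continuous_on_subset by (auto simp: homeomorphism_def)
    then have c: "compact (Fi ` K)" using K(1) by (rule compact_continuous_image)
    have s: "Fi ` K \<subseteq> L0" using Fi K(2) by (auto simp: homeomorphism_def)
    have "F (Fi q) \<in> X" if "q \<in> K" for q
    proof -
      have "F (Fi q) = q" by (rule homeomorphism_apply2[OF Fi]) (use that K(2) in blast)
      then show ?thesis using that K(4) by auto
    qed
    then have "F ` Fi ` K \<subseteq> X" by blast
    from eventually_compact_open[OF F c s K(3) this]
    show "eventually (\<lambda>G. (G \<circ> Fi) ` K \<subseteq> X) (nhdsin ETop F)" by (simp add: image_comp)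
  qed
  have ev1: "eventually (\<lambda>G. C.C1L (G \<circ> Fi) \<longrightarrow> C.J (G \<circ> Fi) = C.J id) (nhdsin ETop F)"
    using lim C.J_near_id unfolding filterlim_iff by blast
  have ev2: "eventually (\<lambda>G. \<forall>i\<in>{..<N}. \<forall>y\<in>cball (x (h i)) (e (h i)). volume_density A \<phi> (G \<circ> s i) y > 0) (nhdsin ETop F)"
  proof (rule eventually_ball_finite[OF finite_lessThan], rule ballI)
    fix i assume "i \<in> {..<N}"
    then have i: "i < N" by simp
    have dd: "local_param A L0 (V (h i)) (s i)" "cball (x (h i)) (e (h i)) \<subseteq> V (h i)"
      "\<And>y. y \<in> V (h i) \<Longrightarrow> volume_density A \<phi> (F \<circ> s i) y > 0" using d[OF hI[OF i]] by (auto simp: s_def)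
    show "eventually (\<lambda>G. \<forall>y\<in>cball (x (h i)) (e (h i)). volume_density A \<phi> (G \<circ> s i) y > 0) (nhdsin ETop F)"
      using dd by (intro eventually_density_pos[OF F dd(1) compact_cball dd(2)]) auto
  qed
  show ?thesis
    using eventually_in_E ev1 ev2
  proof eventually_elim
    case (elim G)
    note G = elim(1)
    define Q where "Q = G \<circ> Fi"
    have QF: "Q (F q) = G q" if "q \<in> L0" for q using homeomorphism_apply1[OF Fi that] by (simp add: Q_def)
    have QL: "Q ` ?L = G ` L0" using QF by (auto simp: image_comp o_def) 
    have Qs: "(G \<circ> s i) y = (Q \<circ> (F \<circ> s i)) y" if "i < N" "y \<in> W i" for i y
    proof -
      have "s i y \<in> L0" using local_paramD(4)[OF lps[OF that(1)]] that(2) by blast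
      then show ?thesis using QF by simp
    qed
    have lpG: "local_param A (Q ` ?L) (W i) (Q \<circ> (F \<circ> s i))" if "i < N" for i
      unfolding QL by (rule local_param_cong[OF embeddingD(4)[OF G lps[OF that]] Qs[OF that]])
    have pullQ: "pull A \<phi> (Q \<circ> (F \<circ> s i)) y = pull A \<phi> (G \<circ> s i) y" if "i < N" "y \<in> W i" for i y
      by (rule pull_cong[OF local_paramD(1)[OF lps[OF that(1)]] that(2)]) (use Qs[OF that(1)] in simp)
    have opQ: "oriented_param A \<phi> (Q ` ?L) (W i) (Q \<circ> (F \<circ> s i))" if "i < N" for i
      unfolding oriented_param_def
    proof (intro conjI ballI lpG[OF that])
      fix y assume y: "y \<in> W i"
      then have "y \<in> cball (x (h i)) (e (h i))" by (simp add: W_def B_def)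
      then show "volume_density A \<phi> (Q \<circ> (F \<circ> s i)) y > 0"
        using elim(3) that by (simp add: volume_density_pull pullQ[OF that y])
    qed
    have C1: "C.C1L Q"
      unfolding C.C1L_def using local_paramD(3)[OF lpG] embeddingD(2)[OF G] QL by auto
    have injQ: "inj_on Q ?L"
    proof (rule inj_onI)
      fix p q assume pq: "p \<in> ?L" "q \<in> ?L" "Q p = Q q"
      then obtain p' q' where p': "p' \<in> L0" "p = F p'" "q' \<in> L0" "q = F q'" by blast
      then have "G p' = G q'" using pq(3) QF by simp
      then have "p' = q'" using inj_onD[OF embeddingD(5)[OF G]] p' by blast
      then show "p = q" using p' by simp
    qed
    have contQ: "continuous_on ?L Q"
      unfolding Q_def
      by (rule continuous_on_compose) (use Fi embeddingD(6)[OF G] in \<open>auto simp: homeomorphism_def\<close>)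
    have "Im (pull A \<phi> (Q \<circ> (F \<circ> s i)) y) = 0" if "i < N" "y \<in> W i" for i y
      unfolding pullQ[OF that] by (rule slag_pull(1)[OF kaehler embeddingD(3)[OF G] embeddingD(4)[OF G lps[OF that(1)]] that(2)])
    from C.slag_integral_image[OF C1 injQ opQ this contQ]
    have "slag_integral A \<phi> f (G ` L0) = C.J Q" by (simp only: QL)
    then show ?case using elim(2) C1 base by (simp add: Q_def)
  qed
qed

section \<open>Passage to the moduli space and its components\<close>

lemma submanifold_of_class:
  assumes "F \<in> X" "X \<in> E // reparam_rel A \<omega> \<phi> L0 U"
  shows "submanifold_of_class L0 X = F ` L0"
proof -
  have "G ` L0 = F ` L0" if G: "G \<in> X" for G
  proof -
    have "(F, G) \<in> reparam_rel A \<omega> \<phi> L0 U"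
      using quotient_eq_iff[OF equiv_reparam_rel[OF submanifold0] assms(2) assms(2) assms(1) G] by blast
    then obtain \<psi> where \<psi>: "diffeomorphism_of A L0 \<psi>" "\<And>p. p \<in> L0 \<Longrightarrow> G p = F (\<psi> p)" by (auto simp: reparam_rel_def)
    have "G ` L0 = F ` \<psi> ` L0" using \<psi>(2) by (auto simp: image_comp)
    also have "\<psi> ` L0 = L0" using \<psi>(1) by (simp add: diffeomorphism_of_def bij_betw_def)
    finally show ?thesis .
  qed
  then show ?thesis using assms(1) unfolding submanifold_of_class_def by blast
qed

text \<open>Local constancy makes any condition on the value of the integral open. In the quotient
  topology this is tested on the union of the classes, which is a set of embeddings. The arbitrary
  predicate covers a condition together with its negation.\<close>

lemma openin_level_sets:
  "openin (moduli_space A \<omega> \<phi> L0 U)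
     {X \<in> E // reparam_rel A \<omega> \<phi> L0 U. P (slag_integral A \<phi> f (submanifold_of_class L0 X))}" (is "openin _ ?W")
proof -
  have eq: "\<Union>?W = {F \<in> E. P (slag_integral A \<phi> f (F ` L0))}"
  proof (intro equalityI subsetI)
    fix F assume "F \<in> \<Union>?W"
    then obtain X where X: "X \<in> E // reparam_rel A \<omega> \<phi> L0 U" "F \<in> X" "P (slag_integral A \<phi> f (submanifold_of_class L0 X))" by blast
    moreover have "F \<in> E" using in_quotient_imp_subset[OF equiv_reparam_rel[OF submanifold0] X(1)] X(2) by blast
    ultimately show "F \<in> {F \<in> E. P (slag_integral A \<phi> f (F ` L0))}" by (simp add: submanifold_of_class)
  next
    fix F assume F: "F \<in> {F \<in> E. P (slag_integral A \<phi> f (F ` L0))}"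
    let ?X = "reparam_rel A \<omega> \<phi> L0 U `` {F}"
    have "?X \<in> E // reparam_rel A \<omega> \<phi> L0 U" using F by (auto intro: quotientI)
    moreover have "F \<in> ?X" using F equiv_class_self[OF equiv_reparam_rel[OF submanifold0]] by blast
    ultimately show "F \<in> \<Union>?W" using F submanifold_of_class[of F ?X] by auto
  qed
  have "openin ETop {F \<in> E. P (slag_integral A \<phi> f (F ` L0))}"
    unfolding openin_subopen[of _ "{F \<in> E. P (slag_integral A \<phi> f (F ` L0))}"]
  proof
    fix F assume F: "F \<in> {F \<in> E. P (slag_integral A \<phi> f (F ` L0))}"
    then have "F \<in> topspace ETop" using topspace_ETop by blast
    then obtain T where T: "openin ETop T" "F \<in> T" "\<forall>G\<in>T. slag_integral A \<phi> f (G ` L0) = slag_integral A \<phi> f (F ` L0)"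
      using integral_locally_constant[of F] F unfolding eventually_nhdsin by blast
    have TE: "T \<subseteq> E" using openin_subset[OF T(1)] topspace_ETop by blast
    have PF: "P (slag_integral A \<phi> f (F ` L0))" using F by blast
    have "T \<subseteq> {F \<in> E. P (slag_integral A \<phi> f (F ` L0))}"
    proof
      fix G assume G: "G \<in> T"
      have "P (slag_integral A \<phi> f (G ` L0))" unfolding bspec[OF T(3) G] by (rule PF)
      then show "G \<in> {F \<in> E. P (slag_integral A \<phi> f (F ` L0))}" using G TE by blast
    qed
    then show "\<exists>T. openin ETop T \<and> F \<in> T \<and> T \<subseteq> {F \<in> E. P (slag_integral A \<phi> f (F ` L0))}"
      using T(1,2) by blast
  qed
  then show ?thesis unfolding openin_moduli_space[OF submanifold0] eq by blast
qed

lemma integral_constant_on_component: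
  "(\<lambda>X. slag_integral A \<phi> f (submanifold_of_class L0 X)) constant_on
     connected_component_of_set (moduli_space A \<omega> \<phi> L0 U) X0"
proof -
  let ?M = "moduli_space A \<omega> \<phi> L0 U" and ?Q = "E // reparam_rel A \<omega> \<phi> L0 U"
  let ?\<xi> = "\<lambda>X. slag_integral A \<phi> f (submanifold_of_class L0 X)"
  let ?S = "connected_component_of_set ?M X0"
  have con: "connectedin ?M ?S" by (rule connectedin_connected_component_of)
  have top: "topspace ?M \<subseteq> ?Q"
    using openin_moduli_space[OF submanifold0, THEN iffD1, OF openin_topspace] by blast
  have "?\<xi> X = ?\<xi> Y" if X: "X \<in> ?S" and Y: "Y \<in> ?S" for X Y
  proof (rule ccontr)
    assume ne: "?\<xi> X \<noteq> ?\<xi> Y"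
    \<comment> \<open>A component on which two values occurred would be separated by the classes
      with and without the value at \<open>X\<close>.\<close>
    let ?A = "{Z \<in> ?Q. ?\<xi> Z = ?\<xi> X}" and ?B = "{Z \<in> ?Q. ?\<xi> Z \<noteq> ?\<xi> X}"
    have SQ: "?S \<subseteq> ?Q" using con top by (auto simp: connectedin_def)
    have "openin ?M ?A" "openin ?M ?B"
      using openin_level_sets[of "\<lambda>c. c = ?\<xi> X"] openin_level_sets[of "\<lambda>c. c \<noteq> ?\<xi> X"] by simp_all
    moreover have "?S \<subseteq> ?A \<union> ?B" "?A \<inter> ?B \<inter> ?S = {}" using SQ by blast+
    moreover have "?A \<inter> ?S \<noteq> {}" "?B \<inter> ?S \<noteq> {}" using X Y SQ ne by (auto simp: disjoint_iff)
    ultimately show False using con unfolding connectedin by blast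
  qed
  then show ?thesis unfolding constant_on_def by metis
qed

end

theorem theorem3p4p1:
  fixes A :: "('m::{t2_space,second_countable_topology}, 'n::finite) chart set"
    and \<omega> :: "('m, 'n) chart \<Rightarrow> 'm \<Rightarrow> complex^'n \<Rightarrow> complex^'n \<Rightarrow> real"
    and \<phi> :: "('m, 'n) chart \<Rightarrow> 'm \<Rightarrow> ('n \<Rightarrow> complex^'n) \<Rightarrow> complex"
    and L0 U :: "'m set"
    and f :: "'m \<Rightarrow> complex"
  assumes "complex_atlas A"
    and "kaehler_form A \<omega>"
    and "holomorphic_volume_form A \<phi>"
    and "compact L0"
    and "special_lagrangian A \<omega> \<phi> L0"
    and "open U" and "L0 \<subseteq> U"
    and "holomorphic_fun_on A U f"
  shows "(\<lambda>X. slag_integral A \<phi> f (submanifold_of_class L0 X)) constant_on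
           connected_component_of_set (moduli_space A \<omega> \<phi> L0 U) (base_point A \<omega> \<phi> L0 U)"
  proof -
  interpret slag_moduli A \<phi> \<omega> L0 U f
    using assms by unfold_locales
  show ?thesis by (rule integral_constant_on_component)
qed


end
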